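(* Let $A$ be a Mackey complete continuous inverse algebra over $\mathbb{K}\in\{\mathbb{R},\mathbb{C}\}$, $G$ a Lie group with Lie algebra $\mathfrak g$ acting smoothly on $A$ by automorphisms via $\mu_A\colon G\to\mathrm{Aut}(A)$, and $E$ a finitely generated projective right $A$-module with $\mu_A(G)\subseteq\mathrm{Aut}(A)_E$. Let $$\hat G=\{(\phi,g)\in\Gamma L(E)\times G:\phi(s.a)=\phi(s).\mu_A(g)(a)\ \text{ for all } s\in E,a\in A\}$$ carry its natural Lie group structure as an extension of $G$ by $\mathrm{GL}_A(E)$. Then the Lie algebra $\hat{\mathfrak g}:=\mathbf L(\hat G)$ is isomorphic to $$\mathbf L(\mu_A)^*\widehat{\mathrm{DEnd}}(E)\cong\{(x,\phi)\in\mathfrak g\times\mathrm{DEnd}(E):(\phi,\mathbf L(\mu_A)x)\in\widehat{\mathrm{DEnd}}(E)\}.$$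
   Context: A continuous inverse algebra (CIA) is a unital associative locally convex topological algebra over $\mathbb{K}$ whose unit group is open and whose inversion is continuous. A locally convex space is Mackey complete if every smooth curve defined on $[0,1]$ has a (weak) integral in it. Lie groups are modeled on locally convex spaces; $\mathbf L(G)$ denotes the Lie algebra of $G$. $\mathrm{Aut}(A)$ is the group of topological algebra automorphisms; the action is smooth if $(g,a)\mapsto\mu_A(g)(a)$ is smooth on $G\times A$. $\mathrm{der}(A)$ is the Lie algebra of continuous derivations of $A$, and $\mathbf L(\mu_A)\colon\mathfrak g\to\mathrm{der}(A)$ is the Lie algebra homomorphism given by differentiating the action: $\mathbf L(\mu_A)(x)(a)$ is the derivative at $(\mathbf 1,a)$ of $(g,b)\mapsto\mu_A(g)(b)$ in direction $(x,0)$. $E\cong pA^n$ for an idempotent $p\in M_n(A)$, topologized as the subspace $pA^n\subseteq A^n$. $\rho_E(a)s:=s.a$. $\mathrm{End}_{\mathbb K}(E)$, $\mathrm{End}_A(E)$ are the algebras of continuous $\mathbb{K}$-linear, resp. $A$-linear, endomorphisms, with unit groups $\mathrm{GL}_{\mathbb K}(E)$, $\mathrm{GL}_A(E)$. $\Gamma L(E)$ is the group of all $\phi\in\mathrm{GL}_{\mathbb K}(E)$ for which some $\phi_A\in\mathrm{Aut}(A)$ satisfies $\phi(s.a)=\phi(s).\phi_A(a)$ for all $s,a$; $\mathrm{Aut}(A)_E$ is the set of $\psi\in\mathrm{Aut}(A)$ for which some $\phi\in\mathrm{GL}_{\mathbb K}(E)$ satisfies $\phi(s.a)=\phi(s).\psi(a)$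 for all $s,a$. Further, $$\mathrm{DEnd}(E)=\{\phi\in\mathrm{End}_{\mathbb K}(E):(\exists D_\phi\in\mathrm{der}(A))(\forall a\in A)\ [\phi,\rho_E(a)]=\rho_E(D_\phi(a))\},$$ $$\widehat{\mathrm{DEnd}}(E)=\{(\phi,D)\in\mathrm{End}_{\mathbb K}(E)\times\mathrm{der}(A):(\forall a\in A)\ [\phi,\rho_E(a)]=\rho_E(D.a)\},$$ and $\mathbf L(\mu_A)^*\widehat{\mathrm{DEnd}}(E)=\{(x,(\phi,D))\in\mathfrak g\times\widehat{\mathrm{DEnd}}(E):\mathbf L(\mu_A)x=D\}$ is the pull-back Lie algebra, with componentwise bracket. Lie group structure on $\hat G$: $\mathrm{GL}_A(E)$ is a Lie group as the open unit group of the CIA $\mathrm{End}_A(E)\cong pM_n(A)p$ (left multiplication on $pA^n\cong E$). Identify $E$ with $pA^n$, let $g*x$ and $g\sharp s$ denote the entrywise actions of $g\in G$ (via $\mu_A$) on $x\in M_n(A)$ and $s\in A^n$, put $\gamma(g)=p\,(g*p)+(\mathbf 1-p)(\mathbf 1-g*p)$, $U_G=\{g\in G:\gamma(g)\in\mathrm{GL}_n(A)\}$, $S_E(g)(s)=\gamma(g)\cdot(g\sharp s)$ and $\sigma(g)=(S_E(g),g)\in\hat G$ for $g\in U_G$. With $q(\phi,g)=g$, the Lie group structure on $\hat G$ is the one for which $\mathrm{GL}_A(E)\times U_G\to q^{-1}(U_G)$, $(\phi,g)\mapsto\phi\,\sigma(g)$ (with $\phi$ identified with $(\phi,\mathbf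 1)$), is a diffeomorphism onto an open subset of $\hat G$; with it, $\hat G$ is a Lie group extension of $G$ by $\mathrm{GL}_A(E)$. *)

theory Defs
  imports "HOL-Analysis.Analysis" "HOL-Algebra.Group"
begin

section \<open>The ground field and locally convex spaces\<close>

text \<open>Up to isomorphism, the only instances are the real and the complex numbers.\<close>

class real_or_complex = real_normed_field +
  assumes real_or_complex:
    "(\<forall>z. \<exists>x. z = x *\<^sub>R 1) \<or>
     (\<exists>j. j * j = - 1 \<and> (\<forall>z. \<exists>x y. z = x *\<^sub>R 1 + y *\<^sub>R j))"

instance real :: real_or_complex
  by standard simp

instance complex :: real_or_complex
proof
  have "\<i> * \<i> = (- 1 :: complex)"
    by simp
  moreover have "z = Re z *\<^sub>R 1 + Im z *\<^sub>R \<i>" for z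
    by (simp add: complex_eq_iff)
  ultimately show "(\<forall>z::complex. \<exists>x. z = x *\<^sub>R 1) \<or>
     (\<exists>j::complex. j * j = - 1 \<and> (\<forall>z. \<exists>x y. z = x *\<^sub>R 1 + y *\<^sub>R j))"
    by blast
qed

text \<open>Locally convex spaces are Hausdorff. All differential calculus below is over the reals, so
  only the underlying real space enters; a locally convex space over the complex numbers has
  the same underlying real locally convex topology.\<close>

class locally_convex_space = real_vector + topological_ab_group_add + t2_space +
  assumes tendsto_scaleR_Pair:
      "filterlim (\<lambda>z. fst z *\<^sub>R snd z) (nhds (r *\<^sub>R x)) (nhds r \<times>\<^sub>F nhds x)"
    and locally_convex:
      "open U \<Longrightarrow> 0 \<in> U \<Longrightarrow>
        \<exists>W. open W \<and> 0 \<in> W \<and> W \<subseteq> U \<and>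
          (\<forall>x\<in>W. \<forall>y\<in>W. \<forall>t. 0 \<le> t \<and> t \<le> 1 \<longrightarrow> (1 - t) *\<^sub>R x + t *\<^sub>R y \<in> W)"

instance real_normed_vector \<subseteq> locally_convex_space
proof
  fix r :: real and x :: 'a
  have "((\<lambda>z. fst z *\<^sub>R snd z) \<longlongrightarrow> r *\<^sub>R x) (nhds (r, x))"
    by (intro tendsto_intros) (auto simp: nhds_prod filterlim_fst filterlim_snd)
  then show "filterlim (\<lambda>z. fst z *\<^sub>R snd z) (nhds (r *\<^sub>R x)) (nhds r \<times>\<^sub>F nhds x)"
    by (simp add: nhds_prod)
next
  fix U :: "'a set"
  assume "open U" "0 \<in> U"
  then obtain e where e: "e > 0" "ball 0 e \<subseteq> U"
    using open_contains_ball by blast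
  have "\<forall>x\<in>ball 0 e. \<forall>y\<in>ball 0 e. \<forall>t. 0 \<le> t \<and> t \<le> 1 \<longrightarrow>
      (1 - t) *\<^sub>R x + t *\<^sub>R y \<in> ball (0::'a) e"
    using convex_ball[of "0::'a" e] unfolding convex_alt by blast
  with e show "\<exists>W. open W \<and> 0 \<in> W \<and> W \<subseteq> U \<and>
          (\<forall>x\<in>W. \<forall>y\<in>W. \<forall>t. 0 \<le> t \<and> t \<le> 1 \<longrightarrow> (1 - t) *\<^sub>R x + t *\<^sub>R y \<in> W)"
    by (intro exI[of _ "ball 0 e"]) auto
qed

instance prod :: (topological_monoid_add, topological_monoid_add) topological_monoid_add
proof
  fix a b :: "'a \<times> 'b"
  have "((\<lambda>x. (fst (fst x) + fst (snd x), snd (fst x) + snd (snd x))) \<longlongrightarrow>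
      (fst a + fst b, snd a + snd b)) (nhds (a, b))"
    by (intro tendsto_intros) (auto simp: filterlim_fst filterlim_snd nhds_prod)
  then show "filterlim (\<lambda>x. fst x + snd x) (nhds (a + b)) (nhds a \<times>\<^sub>F nhds b)"
    by (simp add: nhds_prod plus_prod_def)
qed

instance prod :: (topological_group_add, topological_group_add) topological_group_add
proof
  fix a :: "'a \<times> 'b"
  have "((\<lambda>x. (- fst x, - snd x)) \<longlongrightarrow> (- fst a, - snd a)) (nhds a)"
    by (intro tendsto_intros filterlim_ident)
  then show "(uminus \<longlongrightarrow> - a) (nhds a)"
    by (simp add: uminus_prod_def[abs_def] case_prod_unfold)
qed

instance prod :: (topological_ab_group_add, topological_ab_group_add) topological_ab_group_add ..

instance prod :: (locally_convex_space, locally_convex_space) locally_convex_space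
proof
  fix r :: real and x :: "'a \<times> 'b"
  have "((\<lambda>z. fst z *\<^sub>R fst (snd z)) \<longlongrightarrow> r *\<^sub>R fst x) (nhds r \<times>\<^sub>F nhds x)"
    by (rule filterlim_compose[OF tendsto_scaleR_Pair, of "\<lambda>z. (fst z, fst (snd z))", simplified],
        intro filterlim_Pair filterlim_fst tendsto_fst filterlim_snd)
  moreover have "((\<lambda>z. fst z *\<^sub>R snd (snd z)) \<longlongrightarrow> r *\<^sub>R snd x) (nhds r \<times>\<^sub>F nhds x)"
    by (rule filterlim_compose[OF tendsto_scaleR_Pair, of "\<lambda>z. (fst z, snd (snd z))", simplified],
        intro filterlim_Pair filterlim_fst tendsto_snd filterlim_snd)
  ultimately show "filterlim (\<lambda>z. fst z *\<^sub>R snd z) (nhds (r *\<^sub>R x)) (nhds r \<times>\<^sub>F nhds x)"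
    using tendsto_Pair by (fastforce simp: scaleR_prod_def)
next
  fix U :: "('a \<times> 'b) set"
  assume "open U" "0 \<in> U"
  then obtain A B where AB: "open A" "open B" "0 \<in> A" "0 \<in> B" "A \<times> B \<subseteq> U"
    by (metis open_prod_elim mem_Sigma_iff zero_prod_def)
  obtain V where V: "open V" "0 \<in> V" "V \<subseteq> A"
    "\<forall>x\<in>V. \<forall>y\<in>V. \<forall>t. 0 \<le> t \<and> t \<le> 1 \<longrightarrow> (1 - t) *\<^sub>R x + t *\<^sub>R y \<in> V"
    using locally_convex AB by meson
  obtain W where W: "open W" "0 \<in> W" "W \<subseteq> B"
    "\<forall>x\<in>W. \<forall>y\<in>W. \<forall>t. 0 \<le> t \<and> t \<le> 1 \<longrightarrow> (1 - t) *\<^sub>R x + t *\<^sub>R y \<in> W"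
    using locally_convex AB by meson
  show "\<exists>W. open W \<and> 0 \<in> W \<and> W \<subseteq> U \<and>
          (\<forall>x\<in>W. \<forall>y\<in>W. \<forall>t. 0 \<le> t \<and> t \<le> 1 \<longrightarrow> (1 - t) *\<^sub>R x + t *\<^sub>R y \<in> W)"
    using V W AB by (intro exI[of _ "V \<times> W"]) (auto intro: open_Times simp: zero_prod_def)
qed

instance vec :: (t0_space, finite) t0_space
proof
  fix x y :: "'a ^ 'b"
  assume "x \<noteq> y"
  then obtain i where i: "x $ i \<noteq> y $ i"
    by (auto simp: vec_eq_iff)
  then obtain U where "open U" "\<not> (x $ i \<in> U \<longleftrightarrow> y $ i \<in> U)"
    using t0_space_class.t0_space[OF i] by blast
  then show "\<exists>U. open U \<and> \<not> (x \<in> U \<longleftrightarrow> y \<in> U)"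
    by (intro exI[of _ "(\<lambda>z. z $ i) -` U"]) (auto intro: open_vimage_vec_nth)
qed

instance vec :: (t1_space, finite) t1_space
proof
  fix x y :: "'a ^ 'b"
  assume "x \<noteq> y"
  then obtain i where i: "x $ i \<noteq> y $ i"
    by (auto simp: vec_eq_iff)
  then obtain U where "open U" "x $ i \<in> U" "y $ i \<notin> U"
    using t1_space[OF i] by blast
  then show "\<exists>U. open U \<and> x \<in> U \<and> y \<notin> U"
    by (intro exI[of _ "(\<lambda>z. z $ i) -` U"]) (auto intro: open_vimage_vec_nth)
qed

instance vec :: (t2_space, finite) t2_space
proof
  fix x y :: "'a ^ 'b"
  assume "x \<noteq> y"
  then obtain i where i: "x $ i \<noteq> y $ i"
    by (auto simp: vec_eq_iff)
  then obtain U V where "open U" "open V" "x $ i \<in> U" "y $ i \<in> V" "U \<inter> V = {}"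
    using hausdorff[OF i] by blast
  then show "\<exists>U V. open U \<and> open V \<and> x \<in> U \<and> y \<in> V \<and> U \<inter> V = {}"
    by (intro exI[of _ "(\<lambda>z. z $ i) -` U"] exI[of _ "(\<lambda>z. z $ i) -` V"])
      (auto intro: open_vimage_vec_nth)
qed

instance vec :: (topological_monoid_add, finite) topological_monoid_add
proof
  fix a b :: "'a ^ 'b"
  show "filterlim (\<lambda>x. fst x + snd x) (nhds (a + b)) (nhds a \<times>\<^sub>F nhds b)"
  proof (rule vec_tendstoI)
    fix i
    have "((\<lambda>x. fst x $ i + snd x $ i) \<longlongrightarrow> a $ i + b $ i) (nhds a \<times>\<^sub>F nhds b)"
      by (intro tendsto_intros filterlim_fst filterlim_snd)
    then show "((\<lambda>x. (fst x + snd x) $ i) \<longlongrightarrow> (a + b) $ i) (nhds a \<times>\<^sub>F nhds b)"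
      by simp
  qed
qed

instance vec :: (topological_group_add, finite) topological_group_add
proof
  fix a :: "'a ^ 'b"
  show "(uminus \<longlongrightarrow> - a) (nhds a)"
  proof (rule vec_tendstoI)
    fix i
    have "((\<lambda>x. - (x $ i)) \<longlongrightarrow> - (a $ i)) (nhds a)"
      by (intro tendsto_intros filterlim_ident)
    then show "((\<lambda>x. (- x) $ i) \<longlongrightarrow> (- a) $ i) (nhds a)"
      by simp
  qed
qed

instance vec :: (topological_ab_group_add, finite) topological_ab_group_add ..

instance vec :: (locally_convex_space, finite) locally_convex_space
proof
  fix r :: real and x :: "'a ^ 'b"
  show "filterlim (\<lambda>z. fst z *\<^sub>R snd z) (nhds (r *\<^sub>R x)) (nhds r \<times>\<^sub>F nhds x)"
  proof (rule vec_tendstoI)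
    fix i
    have "((\<lambda>z. fst z *\<^sub>R (snd z $ i)) \<longlongrightarrow> r *\<^sub>R (x $ i)) (nhds r \<times>\<^sub>F nhds x)"
      by (rule filterlim_compose[OF tendsto_scaleR_Pair, of "\<lambda>z. (fst z, snd z $ i)", simplified],
          intro filterlim_Pair filterlim_fst tendsto_vec_nth filterlim_snd)
    then show "((\<lambda>z. (fst z *\<^sub>R snd z) $ i) \<longlongrightarrow> (r *\<^sub>R x) $ i) (nhds r \<times>\<^sub>F nhds x)"
      by simp
  qed
next
  fix U :: "('a ^ 'b) set"
  assume "open U" "0 \<in> U"
  then obtain A where A: "\<And>i. open (A i)" "\<And>i. 0 \<in> A i"
      "\<And>x. \<forall>i. x $ i \<in> A i \<Longrightarrow> x \<in> U"
    unfolding open_vec_def using zero_index by metis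
  have "\<forall>i. \<exists>V. open V \<and> 0 \<in> V \<and> V \<subseteq> A i \<and>
      (\<forall>x\<in>V. \<forall>y\<in>V. \<forall>t. 0 \<le> t \<and> t \<le> 1 \<longrightarrow> (1 - t) *\<^sub>R x + t *\<^sub>R y \<in> V)"
    using locally_convex A by meson
  then obtain V where V: "\<And>i. open (V i)" "\<And>i. 0 \<in> V i" "\<And>i. V i \<subseteq> A i"
      "\<And>i. \<forall>x\<in>V i. \<forall>y\<in>V i. \<forall>t. 0 \<le> t \<and> t \<le> 1 \<longrightarrow> (1 - t) *\<^sub>R x + t *\<^sub>R y \<in> V i"
    by metis
  have "open {x :: 'a ^ 'b. \<forall>i. x $ i \<in> V i}"
    using V(1) by (intro open_vector_box allI)
  then show "\<exists>W. open W \<and> 0 \<in> W \<and> W \<subseteq> U \<and>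
          (\<forall>x\<in>W. \<forall>y\<in>W. \<forall>t. 0 \<le> t \<and> t \<le> 1 \<longrightarrow> (1 - t) *\<^sub>R x + t *\<^sub>R y \<in> W)"
  proof (intro exI[of _ "{x. \<forall>i. x $ i \<in> V i}"] conjI)
    show "{x. \<forall>i. x $ i \<in> V i} \<subseteq> U"
      using V(3) A(3) by blast
  qed (use V(2,4) in auto)
qed

section \<open>Smooth maps\<close>

definition dir_deriv :: "('v::real_vector \<Rightarrow> 'w::{real_vector,t2_space}) \<Rightarrow> 'v \<Rightarrow> 'v \<Rightarrow> 'w"
  where "dir_deriv f x h = Lim (at 0) (\<lambda>t::real. (f (x + t *\<^sub>R h) - f x) /\<^sub>R t)"

text \<open>A locally convex space is rendered as a linear subspace of a type of class
  \<^class>\<open>locally_convex_space\<close>, with the subspace topology, since the model spaces that occur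
  (such as \<open>p M\<^sub>n(A) p\<close>) need not be whole types. A map from an open subset \<open>U\<close> of \<open>V\<close> to \<open>W\<close> is smooth
  (in the Michal--Bastiani sense) if all iterated directional derivatives
  \<open>d\<^sup>j f (x) (h\<^sub>0, \<dots>, h\<^sub>j\<^sub>-\<^sub>1)\<close> exist in \<open>W\<close> and are jointly continuous in all arguments. Here \<open>d j x h\<close> depends
  only on \<open>h 0, \<dots>, h (j - 1)\<close>, so that continuity on a product of countably many copies of \<open>V\<close> is
  the same as continuity on the product of \<open>j\<close> copies.\<close>

definition smooth_on ::
  "'v::locally_convex_space set \<Rightarrow> 'v set \<Rightarrow> 'w::locally_convex_space set \<Rightarrow> ('v \<Rightarrow> 'w) \<Rightarrow> bool"
  where "smooth_on V U W f \<longleftrightarrow>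
    openin (top_of_set V) U \<and>
    (\<exists>d :: nat \<Rightarrow> 'v \<Rightarrow> (nat \<Rightarrow> 'v) \<Rightarrow> 'w.
      (\<forall>x\<in>U. \<forall>h. range h \<subseteq> V \<longrightarrow> d 0 x h = f x) \<and>
      (\<forall>j. \<forall>x\<in>U. \<forall>h. range h \<subseteq> V \<longrightarrow>
        ((\<lambda>t::real. (d j (x + t *\<^sub>R h j) h - d j x h) /\<^sub>R t) \<longlongrightarrow> d (Suc j) x h) (at 0)) \<and>
      (\<forall>j. \<forall>x\<in>U. \<forall>h. range h \<subseteq> V \<longrightarrow> d j x h \<in> W) \<and>
      (\<forall>j. continuous_on (U \<times> {h. range h \<subseteq> V}) (\<lambda>(x, h). d j x h)))"

definition smooth_curve_01 :: "(real \<Rightarrow> 'v::locally_convex_space) \<Rightarrow> bool"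
  where "smooth_curve_01 c \<longleftrightarrow>
    (\<exists>d :: nat \<Rightarrow> real \<Rightarrow> 'v.
      (\<forall>t\<in>{0..1}. d 0 t = c t) \<and>
      (\<forall>j. \<forall>t\<in>{0..1}.
        ((\<lambda>s. (d j s - d j t) /\<^sub>R (s - t)) \<longlongrightarrow> d (Suc j) t) (at t within {0..1})))"

definition mackey_complete :: "'v::locally_convex_space itself \<Rightarrow> bool"
  where "mackey_complete TYPE('v) \<longleftrightarrow>
    (\<forall>c :: real \<Rightarrow> 'v. smooth_curve_01 c \<longrightarrow>
      (\<exists>I. \<forall>l :: 'v \<Rightarrow> real. Real_Vector_Spaces.linear l \<and> continuous_on UNIV l \<longrightarrow>
        ((\<lambda>t. l (c t)) has_integral l I) {0..1}))"

section \<open>Manifolds\<close>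

record ('p, 'v) manifold =
  mtop :: "'p topology"
  mspace :: "'v set"
  charts :: "('p set \<times> ('p \<Rightarrow> 'v)) set"

definition smooth_manifold :: "('p, 'v::locally_convex_space) manifold \<Rightarrow> bool"
  where "smooth_manifold M \<longleftrightarrow>
    subspace (mspace M) \<and>
    Hausdorff_space (mtop M) \<and>
    (\<Union>(U, \<phi>)\<in>charts M. U) = topspace (mtop M) \<and>
    (\<forall>(U, \<phi>)\<in>charts M.
      openin (mtop M) U \<and>
      openin (top_of_set (mspace M)) (\<phi> ` U) \<and>
      homeomorphic_map (subtopology (mtop M) U) (top_of_set (\<phi> ` U)) \<phi>) \<and>
    (\<forall>(U, \<phi>)\<in>charts M. \<forall>(U', \<psi>)\<in>charts M.
      smooth_on (mspace M) (\<phi> ` (U \<inter> U')) (mspace M) (\<psi> \<circ> inv_into U \<phi>))"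

definition smooth_map ::
  "('p, 'v::locally_convex_space) manifold \<Rightarrow> ('q, 'w::locally_convex_space) manifold \<Rightarrow>
    ('p \<Rightarrow> 'q) \<Rightarrow> bool"
  where "smooth_map M N f \<longleftrightarrow>
    continuous_map (mtop M) (mtop N) f \<and>
    (\<forall>(U, \<phi>)\<in>charts M. \<forall>(U', \<psi>)\<in>charts N.
      smooth_on (mspace M) (\<phi> ` (U \<inter> f -` U')) (mspace N) (\<psi> \<circ> f \<circ> inv_into U \<phi>))"

definition diffeomorphism ::
  "('p, 'v::locally_convex_space) manifold \<Rightarrow> ('q, 'w::locally_convex_space) manifold \<Rightarrow>
    ('p \<Rightarrow> 'q) \<Rightarrow> bool"
  where "diffeomorphism M N f \<longleftrightarrow>
    bij_betw f (topspace (mtop M)) (topspace (mtop N)) \<and>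
    smooth_map M N f \<and> smooth_map N M (inv_into (topspace (mtop M)) f)"

definition lcs_manifold :: "'v set \<Rightarrow> ('v::locally_convex_space, 'v) manifold"
  where "lcs_manifold V = \<lparr>mtop = top_of_set V, mspace = V, charts = {(V, \<lambda>x. x)}\<rparr>"

definition prod_manifold ::
  "('p, 'v) manifold \<Rightarrow> ('q, 'w) manifold \<Rightarrow> ('p \<times> 'q, 'v \<times> 'w) manifold"
  where "prod_manifold M N =
    \<lparr>mtop = prod_topology (mtop M) (mtop N),
     mspace = mspace M \<times> mspace N,
     charts = {(U \<times> U', map_prod \<phi> \<psi>) |U \<phi> U' \<psi>. (U, \<phi>) \<in> charts M \<and> (U', \<psi>) \<in> charts N}\<rparr>"

definition open_submanifold :: "('p, 'v) manifold \<Rightarrow> 'p set \<Rightarrow> ('p, 'v) manifold"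
  where "open_submanifold M S =
    \<lparr>mtop = subtopology (mtop M) S,
     mspace = mspace M,
     charts = {(U \<inter> S, \<phi>) |U \<phi>. (U, \<phi>) \<in> charts M}\<rparr>"

text \<open>A tangent vector at \<open>x\<close> is the compatible family of its coordinate vectors in all charts
  around \<open>x\<close> (and \<open>0\<close> in the other charts, to make it unique as a function).\<close>

definition charts_at :: "('p, 'v) manifold \<Rightarrow> 'p \<Rightarrow> ('p set \<times> ('p \<Rightarrow> 'v)) set"
  where "charts_at M x = {c \<in> charts M. x \<in> fst c}"

type_synonym ('p, 'v) tangent_vector = "('p set \<times> ('p \<Rightarrow> 'v)) \<Rightarrow> 'v"

definition tangent_space ::
  "('p, 'v::locally_convex_space) manifold \<Rightarrow> 'p \<Rightarrow> ('p, 'v) tangent_vector set"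
  where "tangent_space M x =
    {\<xi>. (\<forall>c\<in>charts_at M x. \<xi> c \<in> mspace M) \<and>
        (\<forall>c\<in>charts_at M x. \<forall>c'\<in>charts_at M x.
          \<xi> c' = dir_deriv (snd c' \<circ> inv_into (fst c) (snd c)) (snd c x) (\<xi> c)) \<and>
        (\<forall>c. c \<notin> charts_at M x \<longrightarrow> \<xi> c = 0)}"

definition tangent_map ::
  "('p, 'v::locally_convex_space) manifold \<Rightarrow> ('q, 'w::locally_convex_space) manifold \<Rightarrow>
    ('p \<Rightarrow> 'q) \<Rightarrow> 'p \<Rightarrow> ('p, 'v) tangent_vector \<Rightarrow> ('q, 'w) tangent_vector"
  where "tangent_map M N f x \<xi> =
    (\<lambda>c'. if c' \<in> charts_at N (f x)
      then let c = (SOME c. c \<in> charts_at M x)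
           in dir_deriv (snd c' \<circ> f \<circ> inv_into (fst c) (snd c)) (snd c x) (\<xi> c)
      else 0)"

text \<open>The bracket of vector fields, in a chart: \<open>[X, Y] = dY (X) - dX (Y)\<close>.\<close>

definition vector_field_bracket ::
  "('p, 'v::locally_convex_space) manifold \<Rightarrow>
    ('p \<Rightarrow> ('p, 'v) tangent_vector) \<Rightarrow> ('p \<Rightarrow> ('p, 'v) tangent_vector) \<Rightarrow>
    'p \<Rightarrow> ('p, 'v) tangent_vector"
  where "vector_field_bracket M X Y x =
    (\<lambda>c. if c \<in> charts_at M x
      then dir_deriv (\<lambda>y. Y (inv_into (fst c) (snd c) y) c) (snd c x) (X x c)
         - dir_deriv (\<lambda>y. X (inv_into (fst c) (snd c) y) c) (snd c x) (Y x c)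
      else 0)"

section \<open>Lie algebras\<close>

record 'x lie_algebra =
  lcarrier :: "'x set"
  ladd :: "'x \<Rightarrow> 'x \<Rightarrow> 'x"
  lscale :: "real \<Rightarrow> 'x \<Rightarrow> 'x"
  lbracket :: "'x \<Rightarrow> 'x \<Rightarrow> 'x"

definition lie_isomorphic :: "'x lie_algebra \<Rightarrow> 'y lie_algebra \<Rightarrow> bool"
  where "lie_isomorphic L L' \<longleftrightarrow>
    (\<exists>f. bij_betw f (lcarrier L) (lcarrier L') \<and>
      (\<forall>x\<in>lcarrier L. \<forall>y\<in>lcarrier L. f (ladd L x y) = ladd L' (f x) (f y)) \<and>
      (\<forall>r. \<forall>x\<in>lcarrier L. f (lscale L r x) = lscale L' r (f x)) \<and>
      (\<forall>x\<in>lcarrier L. \<forall>y\<in>lcarrier L. f (lbracket L x y) = lbracket L' (f x) (f y)))"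

definition prod_lie_algebra :: "'x lie_algebra \<Rightarrow> 'y lie_algebra \<Rightarrow> ('x \<times> 'y) lie_algebra"
  where "prod_lie_algebra L L' =
    \<lparr>lcarrier = lcarrier L \<times> lcarrier L',
     ladd = (\<lambda>(x, y) (x', y'). (ladd L x x', ladd L' y y')),
     lscale = (\<lambda>r (x, y). (lscale L r x, lscale L' r y)),
     lbracket = (\<lambda>(x, y) (x', y'). (lbracket L x x', lbracket L' y y'))\<rparr>"

definition commutator :: "('v::ab_group_add \<Rightarrow> 'v) \<Rightarrow> ('v \<Rightarrow> 'v) \<Rightarrow> 'v \<Rightarrow> 'v"
  where "commutator \<phi> \<psi> = (\<lambda>s. \<phi> (\<psi> s) - \<psi> (\<phi> s))"

definition commutator_lie_algebra ::
  "(real \<Rightarrow> 'v \<Rightarrow> 'v) \<Rightarrow> ('v::ab_group_add \<Rightarrow> 'v) set \<Rightarrow> ('v \<Rightarrow> 'v) lie_algebra"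
  where "commutator_lie_algebra rscale S =
    \<lparr>lcarrier = S,
     ladd = (\<lambda>\<phi> \<psi> s. \<phi> s + \<psi> s),
     lscale = (\<lambda>r \<phi> s. rscale r (\<phi> s)),
     lbracket = commutator\<rparr>"

section \<open>Lie groups\<close>

definition lie_group ::
  "('g, 'm) monoid_scheme \<Rightarrow> ('g, 'v::locally_convex_space) manifold \<Rightarrow> bool"
  where "lie_group G M \<longleftrightarrow>
    Group.group G \<and> smooth_manifold M \<and> topspace (mtop M) = carrier G \<and>
    smooth_map (prod_manifold M M) M (\<lambda>(g, h). g \<otimes>\<^bsub>G\<^esub> h) \<and>
    smooth_map M M (m_inv G)"

definition left_invariant_field ::
  "('g, 'm) monoid_scheme \<Rightarrow> ('g, 'v::locally_convex_space) manifold \<Rightarrow>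
    ('g, 'v) tangent_vector \<Rightarrow> 'g \<Rightarrow> ('g, 'v) tangent_vector"
  where "left_invariant_field G M \<xi> g = tangent_map M M (\<lambda>h. g \<otimes>\<^bsub>G\<^esub> h) \<one>\<^bsub>G\<^esub> \<xi>"

definition Lie_algebra_of ::
  "('g, 'm) monoid_scheme \<Rightarrow> ('g, 'v::locally_convex_space) manifold \<Rightarrow>
    ('g, 'v) tangent_vector lie_algebra"
  where "Lie_algebra_of G M =
    \<lparr>lcarrier = tangent_space M \<one>\<^bsub>G\<^esub>,
     ladd = (\<lambda>\<xi> \<eta> c. \<xi> c + \<eta> c),
     lscale = (\<lambda>r \<xi> c. r *\<^sub>R \<xi> c),
     lbracket = (\<lambda>\<xi> \<eta>. vector_field_bracket M
       (left_invariant_field G M \<xi>) (left_invariant_field G M \<eta>) \<one>\<^bsub>G\<^esub>)\<rparr>"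

section \<open>Continuous inverse algebras\<close>

definition algebra_units :: "'a::ring_1 set"
  where "algebra_units = {a. \<exists>b. a * b = 1 \<and> b * a = 1}"

definition algebra_inverse :: "'a::ring_1 \<Rightarrow> 'a"
  where "algebra_inverse a = (THE b. a * b = 1 \<and> b * a = 1)"

locale continuous_inverse_algebra = vector_space sc
  for sc :: "'k::real_or_complex \<Rightarrow> 'a::{real_algebra_1,locally_convex_space} \<Rightarrow> 'a" +
  assumes scale_of_real: "sc (of_real r) a = r *\<^sub>R a"
    and mult_scale_left: "sc c a * b = sc c (a * b)"
    and mult_scale_right: "a * sc c b = sc c (a * b)"
    and continuous_scale: "continuous_on UNIV (\<lambda>(c, a). sc c a)"
    and continuous_mult: "continuous_on UNIV (\<lambda>(a, b). a * b :: 'a)"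
    and open_units: "open (algebra_units :: 'a set)"
    and continuous_inverse: "continuous_on algebra_units (algebra_inverse :: 'a \<Rightarrow> 'a)"

definition Aut :: "('k::field \<Rightarrow> 'a \<Rightarrow> 'a) \<Rightarrow> ('a::{ring_1,topological_space} \<Rightarrow> 'a) set"
  where "Aut sc =
    {\<psi>. Vector_Spaces.linear sc sc \<psi> \<and> (\<forall>a b. \<psi> (a * b) = \<psi> a * \<psi> b) \<and> bij \<psi> \<and>
      continuous_on UNIV \<psi> \<and> continuous_on UNIV (inv_into UNIV \<psi>)}"

definition Aut_group :: "('k::field \<Rightarrow> 'a \<Rightarrow> 'a) \<Rightarrow> ('a::{ring_1,topological_space} \<Rightarrow> 'a) monoid"
  where "Aut_group sc = \<lparr>carrier = Aut sc, mult = (\<circ>), one = id\<rparr>"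

definition der :: "('k::field \<Rightarrow> 'a \<Rightarrow> 'a) \<Rightarrow> ('a::{ring_1,topological_space} \<Rightarrow> 'a) set"
  where "der sc =
    {D. Vector_Spaces.linear sc sc D \<and> continuous_on UNIV D \<and>
      (\<forall>a b. D (a * b) = D a * b + a * D b)}"

definition smooth_action ::
  "('g, 'm) monoid_scheme \<Rightarrow> ('g, 'v::locally_convex_space) manifold \<Rightarrow>
    ('k::field \<Rightarrow> 'a \<Rightarrow> 'a) \<Rightarrow> ('g \<Rightarrow> 'a::{ring_1,locally_convex_space} \<Rightarrow> 'a) \<Rightarrow> bool"
  where "smooth_action G M sc \<mu> \<longleftrightarrow>
    \<mu> \<in> hom G (Aut_group sc) \<and>
    smooth_map (prod_manifold M (lcs_manifold UNIV)) (lcs_manifold UNIV) (\<lambda>(g, a). \<mu> g a)"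

text \<open>\<open>L(\<mu>)(x)(a)\<close>: the derivative of \<open>(g, b) \<mapsto> \<mu> g b\<close> at \<open>(\<one>, a)\<close> in direction \<open>(x, 0)\<close>, computed in a
  chart of the group around \<open>\<one>\<close>.\<close>

definition Lie_action ::
  "('g, 'm) monoid_scheme \<Rightarrow> ('g, 'v::locally_convex_space) manifold \<Rightarrow>
    ('g \<Rightarrow> 'a::locally_convex_space \<Rightarrow> 'a) \<Rightarrow> ('g, 'v) tangent_vector \<Rightarrow> 'a \<Rightarrow> 'a"
  where "Lie_action G M \<mu> x a =
    (let c = (SOME c. c \<in> charts_at M \<one>\<^bsub>G\<^esub>)
     in dir_deriv (\<lambda>(y, b). \<mu> (inv_into (fst c) (snd c) y) b) (snd c \<one>\<^bsub>G\<^esub>, a) (x c, 0))"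

section \<open>Finitely generated projective right modules\<close>

definition right_module :: "('e::ab_group_add \<Rightarrow> 'a::ring_1 \<Rightarrow> 'e) \<Rightarrow> bool"
  where "right_module act \<longleftrightarrow>
    (\<forall>s t a. act (s + t) a = act s a + act t a) \<and>
    (\<forall>s a b. act s (a + b) = act s a + act s b) \<and>
    (\<forall>s a b. act s (a * b) = act (act s a) b) \<and>
    (\<forall>s. act s 1 = s)"

text \<open>\<open>\<iota>\<close> identifies the module, algebraically and topologically, with \<open>p A\<^sup>n \<subseteq> A\<^sup>n\<close>.\<close>

definition fg_projective ::
  "('e::{ab_group_add,topological_space} \<Rightarrow> 'a::{ring_1,topological_space} \<Rightarrow> 'e) \<Rightarrow>
    'a ^ 'n ^ 'n \<Rightarrow> ('e \<Rightarrow> 'a ^ 'n) \<Rightarrow> bool"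
  where "fg_projective act p \<iota> \<longleftrightarrow>
    right_module act \<and> p ** p = p \<and>
    inj \<iota> \<and> range \<iota> = range (\<lambda>x. p *v x) \<and>
    (\<forall>s t. \<iota> (s + t) = \<iota> s + \<iota> t) \<and>
    (\<forall>s a. \<iota> (act s a) = (\<chi> i. \<iota> s $ i * a)) \<and>
    homeomorphic_map euclidean (top_of_set (range \<iota>)) \<iota>"

definition module_scale ::
  "('k \<Rightarrow> 'a \<Rightarrow> 'a) \<Rightarrow> ('e \<Rightarrow> 'a::one \<Rightarrow> 'e) \<Rightarrow> 'k \<Rightarrow> 'e \<Rightarrow> 'e"
  where "module_scale sc act c s = act s (sc c 1)"

definition End_K ::
  "('k::field \<Rightarrow> 'a \<Rightarrow> 'a) \<Rightarrow> ('e \<Rightarrow> 'a::one \<Rightarrow> 'e) \<Rightarrow>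
    ('e::{ab_group_add,topological_space} \<Rightarrow> 'e) set"
  where "End_K sc act =
    {\<phi>. Vector_Spaces.linear (module_scale sc act) (module_scale sc act) \<phi> \<and>
      continuous_on UNIV \<phi>}"

definition GL_K ::
  "('k::field \<Rightarrow> 'a \<Rightarrow> 'a) \<Rightarrow> ('e \<Rightarrow> 'a::one \<Rightarrow> 'e) \<Rightarrow>
    ('e::{ab_group_add,topological_space} \<Rightarrow> 'e) set"
  where "GL_K sc act =
    {\<phi> \<in> End_K sc act. \<exists>\<psi>\<in>End_K sc act. \<phi> \<circ> \<psi> = id \<and> \<psi> \<circ> \<phi> = id}"

definition End_A ::
  "('k::field \<Rightarrow> 'a \<Rightarrow> 'a) \<Rightarrow> ('e \<Rightarrow> 'a::one \<Rightarrow> 'e) \<Rightarrow>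
    ('e::{ab_group_add,topological_space} \<Rightarrow> 'e) set"
  where "End_A sc act = {\<phi> \<in> End_K sc act. \<forall>s a. \<phi> (act s a) = act (\<phi> s) a}"

definition GL_A ::
  "('k::field \<Rightarrow> 'a \<Rightarrow> 'a) \<Rightarrow> ('e \<Rightarrow> 'a::one \<Rightarrow> 'e) \<Rightarrow>
    ('e::{ab_group_add,topological_space} \<Rightarrow> 'e) set"
  where "GL_A sc act =
    {\<phi> \<in> End_A sc act. \<exists>\<psi>\<in>End_A sc act. \<phi> \<circ> \<psi> = id \<and> \<psi> \<circ> \<phi> = id}"

definition GammaL ::
  "('k::field \<Rightarrow> 'a \<Rightarrow> 'a) \<Rightarrow> ('e \<Rightarrow> 'a::{ring_1,topological_space} \<Rightarrow> 'e) \<Rightarrow>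
    ('e::{ab_group_add,topological_space} \<Rightarrow> 'e) set"
  where "GammaL sc act =
    {\<phi> \<in> GL_K sc act. \<exists>\<psi>\<in>Aut sc. \<forall>s a. \<phi> (act s a) = act (\<phi> s) (\<psi> a)}"

definition Aut_E ::
  "('k::field \<Rightarrow> 'a \<Rightarrow> 'a) \<Rightarrow> ('e::{ab_group_add,topological_space} \<Rightarrow> 'a \<Rightarrow> 'e) \<Rightarrow>
    ('a::{ring_1,topological_space} \<Rightarrow> 'a) set"
  where "Aut_E sc act =
    {\<psi> \<in> Aut sc. \<exists>\<phi>\<in>GL_K sc act. \<forall>s a. \<phi> (act s a) = act (\<phi> s) (\<psi> a)}"

definition DEnd ::
  "('k::field \<Rightarrow> 'a \<Rightarrow> 'a) \<Rightarrow> ('e \<Rightarrow> 'a::{ring_1,topological_space} \<Rightarrow> 'e) \<Rightarrow>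
    ('e::{ab_group_add,topological_space} \<Rightarrow> 'e) set"
  where "DEnd sc act =
    {\<phi> \<in> End_K sc act.
      \<exists>D\<in>der sc. \<forall>a. commutator \<phi> (\<lambda>s. act s a) = (\<lambda>s. act s (D a))}"

definition DEnd_hat ::
  "('k::field \<Rightarrow> 'a \<Rightarrow> 'a) \<Rightarrow> ('e \<Rightarrow> 'a::{ring_1,topological_space} \<Rightarrow> 'e) \<Rightarrow>
    (('e::{ab_group_add,topological_space} \<Rightarrow> 'e) \<times> ('a \<Rightarrow> 'a)) set"
  where "DEnd_hat sc act =
    {(\<phi>, D). \<phi> \<in> End_K sc act \<and> D \<in> der sc \<and>
      (\<forall>a. commutator \<phi> (\<lambda>s. act s a) = (\<lambda>s. act s (D a)))}"

text \<open>The Lie algebras are considered over the reals, as \<open>G\<close> is a real Lie group.\<close>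

definition End_lie_algebra ::
  "('k::real_or_complex \<Rightarrow> 'a \<Rightarrow> 'a) \<Rightarrow> ('e \<Rightarrow> 'a::one \<Rightarrow> 'e) \<Rightarrow>
    ('e::{ab_group_add,topological_space} \<Rightarrow> 'e) lie_algebra"
  where "End_lie_algebra sc act =
    commutator_lie_algebra (\<lambda>r. module_scale sc act (of_real r)) (End_K sc act)"

definition der_lie_algebra ::
  "('k::real_or_complex \<Rightarrow> 'a \<Rightarrow> 'a) \<Rightarrow> ('a::{ring_1,topological_space} \<Rightarrow> 'a) lie_algebra"
  where "der_lie_algebra sc = commutator_lie_algebra (\<lambda>r. sc (of_real r)) (der sc)"

definition DEnd_hat_lie_algebra ::
  "('k::real_or_complex \<Rightarrow> 'a \<Rightarrow> 'a) \<Rightarrow> ('e \<Rightarrow> 'a::{ring_1,topological_space} \<Rightarrow> 'e) \<Rightarrow>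
    (('e::{ab_group_add,topological_space} \<Rightarrow> 'e) \<times> ('a \<Rightarrow> 'a)) lie_algebra"
  where "DEnd_hat_lie_algebra sc act =
    (prod_lie_algebra (End_lie_algebra sc act) (der_lie_algebra sc))
      \<lparr>lcarrier := DEnd_hat sc act\<rparr>"

definition pullback_DEnd_hat ::
  "('g, 'm) monoid_scheme \<Rightarrow> ('g, 'v::locally_convex_space) manifold \<Rightarrow>
    ('g \<Rightarrow> 'a \<Rightarrow> 'a) \<Rightarrow> ('k::real_or_complex \<Rightarrow> 'a \<Rightarrow> 'a) \<Rightarrow>
    ('e \<Rightarrow> 'a::{ring_1,locally_convex_space} \<Rightarrow> 'e) \<Rightarrow>
    (('g, 'v) tangent_vector \<times>
      (('e::{ab_group_add,topological_space} \<Rightarrow> 'e) \<times> ('a \<Rightarrow> 'a))) lie_algebra"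
  where "pullback_DEnd_hat G M \<mu> sc act =
    (prod_lie_algebra (Lie_algebra_of G M) (DEnd_hat_lie_algebra sc act))
      \<lparr>lcarrier := {(x, (\<phi>, D)). x \<in> lcarrier (Lie_algebra_of G M) \<and>
        (\<phi>, D) \<in> DEnd_hat sc act \<and> Lie_action G M \<mu> x = D}\<rparr>"

definition pullback_DEnd ::
  "('g, 'm) monoid_scheme \<Rightarrow> ('g, 'v::locally_convex_space) manifold \<Rightarrow>
    ('g \<Rightarrow> 'a \<Rightarrow> 'a) \<Rightarrow> ('k::real_or_complex \<Rightarrow> 'a \<Rightarrow> 'a) \<Rightarrow>
    ('e \<Rightarrow> 'a::{ring_1,locally_convex_space} \<Rightarrow> 'e) \<Rightarrow>
    (('g, 'v) tangent_vector \<times> ('e::{ab_group_add,topological_space} \<Rightarrow> 'e)) lie_algebra"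
  where "pullback_DEnd G M \<mu> sc act =
    (prod_lie_algebra (Lie_algebra_of G M) (End_lie_algebra sc act))
      \<lparr>lcarrier := {(x, \<phi>). x \<in> lcarrier (Lie_algebra_of G M) \<and> \<phi> \<in> DEnd sc act \<and>
        (\<phi>, Lie_action G M \<mu> x) \<in> DEnd_hat sc act}\<rparr>"

section \<open>The extension of \<open>G\<close>\<close>

definition G_hat ::
  "('g, 'm) monoid_scheme \<Rightarrow> ('g \<Rightarrow> 'a \<Rightarrow> 'a) \<Rightarrow> ('k::field \<Rightarrow> 'a \<Rightarrow> 'a) \<Rightarrow>
    ('e::{ab_group_add,topological_space} \<Rightarrow> 'a::{ring_1,topological_space} \<Rightarrow> 'e) \<Rightarrow>
    (('e \<Rightarrow> 'e) \<times> 'g) monoid"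
  where "G_hat G \<mu> sc act =
    \<lparr>carrier = {(\<phi>, g). \<phi> \<in> GammaL sc act \<and> g \<in> carrier G \<and>
       (\<forall>s a. \<phi> (act s a) = act (\<phi> s) (\<mu> g a))},
     mult = (\<lambda>(\<phi>, g) (\<psi>, h). (\<phi> \<circ> \<psi>, g \<otimes>\<^bsub>G\<^esub> h)),
     one = (id, \<one>\<^bsub>G\<^esub>)\<rparr>"

text \<open>The matrix in \<open>p M\<^sub>n(A) p\<close> that acts on \<open>p A\<^sup>n\<close> from the left as the given endomorphism of the
  module; on \<open>GL_A\<close> it is the (global) chart.\<close>

definition matrix_of_End ::
  "'a::ring_1 ^ 'n ^ 'n \<Rightarrow> ('e \<Rightarrow> 'a ^ 'n) \<Rightarrow> ('e \<Rightarrow> 'e) \<Rightarrow> 'a ^ 'n ^ 'n"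
  where "matrix_of_End p \<iota> \<phi> =
    (THE m. m \<in> range (\<lambda>x. p ** x ** p) \<and> (\<forall>s. \<iota> (\<phi> s) = m *v \<iota> s))"

definition GL_A_manifold ::
  "('k::field \<Rightarrow> 'a \<Rightarrow> 'a) \<Rightarrow> ('e::{ab_group_add,topological_space} \<Rightarrow> 'a \<Rightarrow> 'e) \<Rightarrow>
    'a::{ring_1,topological_space} ^ 'n ^ 'n \<Rightarrow> ('e \<Rightarrow> 'a ^ 'n) \<Rightarrow> ('e \<Rightarrow> 'e, 'a ^ 'n ^ 'n) manifold"
  where "GL_A_manifold sc act p \<iota> =
    \<lparr>mtop = pullback_topology (GL_A sc act) (matrix_of_End p \<iota>) euclidean,
     mspace = range (\<lambda>x. p ** x ** p),
     charts = {(GL_A sc act, matrix_of_End p \<iota>)}\<rparr>"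

definition matrix_action :: "('g \<Rightarrow> 'a \<Rightarrow> 'a) \<Rightarrow> 'g \<Rightarrow> 'a ^ 'n ^ 'n \<Rightarrow> 'a ^ 'n ^ 'n"
  where "matrix_action \<mu> g x = (\<chi> i j. \<mu> g (x $ i $ j))"

definition vector_action :: "('g \<Rightarrow> 'a \<Rightarrow> 'a) \<Rightarrow> 'g \<Rightarrow> 'a ^ 'n \<Rightarrow> 'a ^ 'n"
  where "vector_action \<mu> g s = (\<chi> i. \<mu> g (s $ i))"

definition gamma :: "('g \<Rightarrow> 'a \<Rightarrow> 'a) \<Rightarrow> 'a::ring_1 ^ 'n ^ 'n \<Rightarrow> 'g \<Rightarrow> 'a ^ 'n ^ 'n"
  where "gamma \<mu> p g =
    p ** matrix_action \<mu> g p + (mat 1 - p) ** (mat 1 - matrix_action \<mu> g p)"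

definition U_G ::
  "('g, 'm) monoid_scheme \<Rightarrow> ('g \<Rightarrow> 'a \<Rightarrow> 'a) \<Rightarrow> 'a::ring_1 ^ 'n ^ 'n \<Rightarrow> 'g set"
  where "U_G G \<mu> p = {g \<in> carrier G. invertible (gamma \<mu> p g)}"

definition S_E ::
  "('g \<Rightarrow> 'a \<Rightarrow> 'a) \<Rightarrow> 'a::ring_1 ^ 'n ^ 'n \<Rightarrow> ('e \<Rightarrow> 'a ^ 'n) \<Rightarrow> 'g \<Rightarrow> 'e \<Rightarrow> 'e"
  where "S_E \<mu> p \<iota> g s = inv_into UNIV \<iota> (gamma \<mu> p g *v vector_action \<mu> g (\<iota> s))"

definition sigma ::
  "('g \<Rightarrow> 'a \<Rightarrow> 'a) \<Rightarrow> 'a::ring_1 ^ 'n ^ 'n \<Rightarrow> ('e \<Rightarrow> 'a ^ 'n) \<Rightarrow> 'g \<Rightarrow> ('e \<Rightarrow> 'e) \<times> 'g"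
  where "sigma \<mu> p \<iota> g = (S_E \<mu> p \<iota> g, g)"

text \<open>This property determines a Lie group structure on \<open>G_hat\<close> uniquely, because left
  translations are diffeomorphisms.\<close>

definition natural_lie_structure ::
  "('g, 'm) monoid_scheme \<Rightarrow> ('g, 'v::locally_convex_space) manifold \<Rightarrow>
    ('g \<Rightarrow> 'a \<Rightarrow> 'a) \<Rightarrow> ('k::real_or_complex \<Rightarrow> 'a \<Rightarrow> 'a) \<Rightarrow>
    ('e::{ab_group_add,topological_space} \<Rightarrow> 'a::{ring_1,locally_convex_space} \<Rightarrow> 'e) \<Rightarrow>
    'a ^ 'n ^ 'n \<Rightarrow> ('e \<Rightarrow> 'a ^ 'n) \<Rightarrow>
    (('e \<Rightarrow> 'e) \<times> 'g, 'w::locally_convex_space) manifold \<Rightarrow> bool"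
  where "natural_lie_structure G M \<mu> sc act p \<iota> M_hat \<longleftrightarrow>
    (let H = G_hat G \<mu> sc act;
         Q = {(\<phi>, g) \<in> carrier H. g \<in> U_G G \<mu> p}
     in lie_group H M_hat \<and>
        openin (mtop M_hat) Q \<and>
        diffeomorphism
          (prod_manifold (GL_A_manifold sc act p \<iota>) (open_submanifold M (U_G G \<mu> p)))
          (open_submanifold M_hat Q)
          (\<lambda>(\<phi>, g). (\<phi>, \<one>\<^bsub>G\<^esub>) \<otimes>\<^bsub>H\<^esub> sigma \<mu> p \<iota> g))"

end

theory Submission
  imports Defs
begin

text \<open>The extension \<open>G_hat\<close> comes with two homomorphisms: the projection \<open>q (\<phi>, g) = g\<close> onto \<open>G\<close>, and the
  linear action \<open>(\<phi>, g).s = \<phi> s\<close> on \<open>E\<close>. Differentiating both at the identity sends \<open>\<xi> \<in> L(G_hat)\<close> to the pair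
  \<open>(dq \<xi>, dE \<xi>)\<close>, and this pair, completed by the derivation \<open>L(\<mu>) (dq \<xi>)\<close>, is the image of \<open>\<xi>\<close> under
  the isomorphism.

  Bijectivity is a computation in the trivialization \<open>(\<phi>, g) \<mapsto> \<phi> \<sigma>(g)\<close>. Since
  \<open>\<gamma>(g) (g \<sharp> s) = p (g \<sharp> s)\<close> for \<open>s \<in> p A\<^sup>n\<close>, the
  element with coordinates \<open>(m, g)\<close> acts on \<open>p A\<^sup>n\<close> by \<open>s \<mapsto> m (g \<sharp> s)\<close>, where \<open>m \<in> p M\<^sub>n(A) p\<close>. Hence the
  tangent vector with coordinates \<open>(m, x)\<close> acts by \<open>s \<mapsto> m s + p D(s)\<close>, where \<open>D = L(\<mu>) x\<close> is applied
  entrywise. The map \<open>s \<mapsto> p D(s)\<close> is the Grassmann connection: it is one solution \<open>\<phi>\<close> of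
  \<open>[\<phi>, \<rho>\<^sub>E(a)] = \<rho>\<^sub>E(D a)\<close>, and two solutions for the same \<open>D\<close> differ by an \<open>A\<close>-linear endomorphism, that
  is, by an element of \<open>p M\<^sub>n(A) p\<close>. So \<open>(m, x) \<mapsto> (x, m + p D)\<close> is a bijection onto the pull-back
  (\<open>conn_DEnd_hat\<close>, \<open>DEnd_hat_conn\<close>, \<open>conn_inject\<close>, \<open>dcoord_bij\<close>).

  That brackets are preserved rests on one formula, \<open>derivative_of_bracket\<close>: if \<open>X\<close>, \<open>Y\<close> are vector
  fields and \<open>F\<close> is \<open>C\<^sup>2\<close>, then \<open>dF ([X, Y])\<close> is the derivative of \<open>dF (Y)\<close> along \<open>X\<close> minus the derivative
  of \<open>dF (X)\<close> along \<open>Y\<close>, because the second derivative of \<open>F\<close> is symmetric. For left invariant fields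
  and \<open>F (\<gamma>) = \<rho>(\<gamma>) w\<close> with a linear action \<open>\<rho>\<close>, the function \<open>dF (Y)\<close> is again an orbit map, that of
  \<open>d\<rho>(\<eta>) w\<close>, and the formula becomes \<open>d\<rho>([\<xi>, \<eta>]) = [d\<rho>(\<xi>), d\<rho>(\<eta>)]\<close> (\<open>action_bracket\<close>); this is used for
  \<open>G_hat\<close> acting on \<open>E\<close> and for \<open>G\<close> acting on \<open>A\<close>. For \<open>F = q\<close> in a chart, \<open>dF (Y)\<close> is the left
  invariant field of \<open>dq \<eta>\<close> composed with \<open>q\<close>, and the formula becomes \<open>dq [\<xi>, \<eta>] = [dq \<xi>, dq \<eta>]\<close>
  (\<open>dq_bracket\<close>).

  The calculus is that of \<open>C\<^sup>2\<close> maps between locally convex spaces. It is built on a mean value theorem for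
  curves whose derivative stays in a convex set; this turns continuity of the derivative into strict
  differentiability, from which the chain rule, linearity of the derivative and the symmetry of
  second derivatives follow.\<close>

section \<open>Convex neighbourhoods and the mean value theorem\<close>

lemma tendsto_scaleR_lcs:
  fixes g :: "'i \<Rightarrow> 'a::locally_convex_space"
  assumes "(f \<longlongrightarrow> r) F" "(g \<longlongrightarrow> x) F"
  shows "((\<lambda>i. f i *\<^sub>R g i) \<longlongrightarrow> r *\<^sub>R x) F"
  using filterlim_compose[OF tendsto_scaleR_Pair filterlim_Pair[OF assms]] by simp

lemma convex_nbhd_add:
  fixes a :: "'a::locally_convex_space"
  assumes "open S" "a \<in> S"
  shows "\<exists>N. open N \<and> convex N \<and> 0 \<in> N \<and> (\<forall>x\<in>N. \<forall>y\<in>N. a + x + y \<in> S)"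
proof -
  have "((\<lambda>z. a + fst z + snd z) \<longlongrightarrow> a + fst 0 + snd 0) (nhds (0 :: 'a \<times> 'a))"
    using tendsto_fst[of "\<lambda>z. z" "0 :: 'a \<times> 'a"] tendsto_snd[of "\<lambda>z. z" "0 :: 'a \<times> 'a"]
    by (intro tendsto_add tendsto_const) (auto simp: filterlim_ident)
  then have "eventually (\<lambda>z. a + fst z + snd z \<in> S) (nhds (0 :: 'a \<times> 'a))"
    using assms by (intro topological_tendstoD) auto
  then obtain T where T: "open T" "0 \<in> T" "\<And>z. z \<in> T \<Longrightarrow> a + fst z + snd z \<in> S"
    unfolding eventually_nhds by blast
  then obtain A B where AB: "open A" "open B" "0 \<in> A" "0 \<in> B" "A \<times> B \<subseteq> T"
    by (metis open_prod_elim mem_Sigma_iff zero_prod_def)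
  have "0 \<in> A \<inter> B" using AB by simp
  from locally_convex[OF open_Int[OF AB(1,2)] this]
  obtain N where N: "open N" "0 \<in> N" "N \<subseteq> A \<inter> B"
      "\<forall>x\<in>N. \<forall>y\<in>N. \<forall>t. 0 \<le> t \<and> t \<le> 1 \<longrightarrow> (1 - t) *\<^sub>R x + t *\<^sub>R y \<in> N"
    by blast
  have "a + x + y \<in> S" if "x \<in> N" "y \<in> N" for x y
  proof -
    have "(x, y) \<in> T" using that N(3) AB(5) by blast
    then show ?thesis using T(3)[of "(x, y)"] by simp
  qed
  moreover have "convex N"
    using N(4) unfolding convex_alt by simp
  ultimately show ?thesis
    using N(1,2) by (intro exI[of _ N]) simp
qed

lemma convex_nbhd_at:
  fixes a :: "'a::locally_convex_space"
  assumes "open S" "a \<in> S"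
  shows "\<exists>C. open C \<and> convex C \<and> a \<in> C \<and> C \<subseteq> S"
proof -
  obtain N where N: "open N" "convex N" "0 \<in> N" "\<forall>x\<in>N. \<forall>y\<in>N. a + x + y \<in> S"
    using convex_nbhd_add[OF assms] by blast
  have eq: "(+) a ` N = (\<lambda>z. z - a) -` N"
    by (auto simp: image_iff intro!: bexI[of _ "_ - a"])
  have "continuous_on UNIV (\<lambda>z. z - a)"
    by (intro continuous_intros)
  then have "open ((+) a ` N)"
    unfolding eq using N(1) open_vimage by blast
  moreover have "(+) a ` N \<subseteq> S"
  proof
    fix z assume "z \<in> (+) a ` N"
    then obtain n where "n \<in> N" "z = a + n" by auto
    then show "z \<in> S" using N(4)[rule_format, of n 0] N(3) by simp
  qed
  moreover have "a \<in> (+) a ` N"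
    using N(3) by (auto simp: image_iff)
  ultimately show ?thesis
    using N(2) convex_translation by blast
qed

text \<open>The increment of a curve lies in every convex neighbourhood of the convex set \<open>K\<close> of its
  velocities. Near each parameter the slopes of the curve lie in the convex set \<open>K + N\<close>, slopes over
  adjacent intervals are averaged when the intervals are joined, and bisection reduces \<open>[0, 1]\<close> to such
  short intervals.\<close>

lemma mean_value_convex:
  fixes c c' :: "real \<Rightarrow> 'a::locally_convex_space"
  assumes d: "\<And>s. 0 \<le> s \<Longrightarrow> s \<le> 1 \<Longrightarrow> ((\<lambda>r. (c (s + r) - c s) /\<^sub>R r) \<longlongrightarrow> c' s) (at 0)"
    and K: "convex K" "\<And>s. 0 \<le> s \<Longrightarrow> s \<le> 1 \<Longrightarrow> c' s \<in> K"
    and N: "open N" "convex N" "0 \<in> N"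
  shows "\<exists>k\<in>K. \<exists>n\<in>N. c 1 - c 0 = k + n"
proof -
  define S where "S = (\<Union>k\<in>K. \<Union>n\<in>N. {k + n})"
  have S: "convex S"
    unfolding S_def by (intro convex_sums K N)
  have S_slope: "\<exists>d>0. \<forall>r. r \<noteq> 0 \<and> \<bar>r\<bar> < d \<longrightarrow> (c (s + r) - c s) /\<^sub>R r \<in> S"
    if s: "0 \<le> s" "s \<le> 1" for s
  proof -
    have "((\<lambda>r. (c (s + r) - c s) /\<^sub>R r - c' s) \<longlongrightarrow> c' s - c' s) (at 0)"
      by (intro tendsto_diff d s tendsto_const)
    then have "eventually (\<lambda>r. (c (s + r) - c s) /\<^sub>R r - c' s \<in> N) (at 0)"
      using N by (intro topological_tendstoD) auto
    moreover have "v \<in> S" if "v - c' s \<in> N" for v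
      unfolding S_def using that K(2)[OF s] by (intro UN_I[of "c' s"] UN_I[of "v - c' s"]) auto
    ultimately have "eventually (\<lambda>r. (c (s + r) - c s) /\<^sub>R r \<in> S) (at 0)"
      by (auto elim!: eventually_mono)
    then show ?thesis
      by (auto simp: eventually_at dist_real_def)
  qed
  define P where "P a b \<longleftrightarrow> (0 \<le> a \<and> a \<le> b \<and> b \<le> 1 \<longrightarrow> (\<exists>z\<in>S. c b - c a = (b - a) *\<^sub>R z))" for a b
  have join: "\<exists>v\<in>S. c b - c a = (b - a) *\<^sub>R v"
    if le: "a \<le> x" "x \<le> b" and z: "z \<in> S" "c x - c a = (x - a) *\<^sub>R z" and w: "w \<in> S" "c b - c x = (b - x) *\<^sub>R w"
    for a b x z w
  proof (cases "a = b")
    case True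
    then show ?thesis using z(1) by auto
  next
    case False
    then have ba: "b - a > 0" using le by simp
    let ?v = "((x - a) / (b - a)) *\<^sub>R z + ((b - x) / (b - a)) *\<^sub>R w"
    have "?v \<in> S"
      using le ba by (intro convexD[OF S] z w) (auto simp: add_divide_distrib[symmetric])
    moreover have "c b - c a = (c x - c a) + (c b - c x)" by simp
    then have "c b - c a = (b - a) *\<^sub>R ?v"
      using z w ba by (simp add: scaleR_add_right)
    ultimately show ?thesis by blast
  qed
  have "P 0 1"
  proof (rule Bolzano)
    fix a b e assume P: "P a b" "P b e" "a \<le> b" "b \<le> e"
    show "P a e" unfolding P_def
    proof
      assume *: "0 \<le> a \<and> a \<le> e \<and> e \<le> 1"
      then obtain z w where "z \<in> S" "c b - c a = (b - a) *\<^sub>R z" "w \<in> S" "c e - c b = (e - b) *\<^sub>R w"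
        using P unfolding P_def by auto
      then show "\<exists>z\<in>S. c e - c a = (e - a) *\<^sub>R z"
        by (rule join[OF P(3,4)])
    qed
  next
    fix x :: real assume x: "0 \<le> x" "x \<le> 1"
    then obtain d where d: "d > 0" "\<And>r. r \<noteq> 0 \<Longrightarrow> \<bar>r\<bar> < d \<Longrightarrow> (c (x + r) - c x) /\<^sub>R r \<in> S"
      using S_slope by blast
    have step: "\<exists>z\<in>S. c (x + r) - c x = r *\<^sub>R z" if "\<bar>r\<bar> < d" for r
    proof (cases "r = 0")
      case True
      have "(c (x + d/2) - c x) /\<^sub>R (d/2) \<in> S" using d(1) by (intro d(2)) auto
      with True show ?thesis by auto
    next
      case False
      with d(2) that show ?thesis
        by (intro bexI[of _ "(c (x + r) - c x) /\<^sub>R r"]) auto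
    qed
    show "\<exists>d>0. \<forall>a b. a \<le> x \<and> x \<le> b \<and> b - a < d \<longrightarrow> P a b"
    proof (intro exI[of _ d] conjI d(1) allI impI)
      fix a b assume ab: "a \<le> x \<and> x \<le> b \<and> b - a < d"
      obtain w where w: "w \<in> S" "c b - c x = (b - x) *\<^sub>R w"
        using step[of "b - x"] ab by auto
      obtain z where z: "z \<in> S" "c a - c x = (a - x) *\<^sub>R z"
        using step[of "a - x"] ab by auto
      have "c x - c a = (x - a) *\<^sub>R z"
        using z(2) by (metis minus_diff_eq scaleR_minus_left)
      then show "P a b"
        unfolding P_def using join[OF _ _ z(1) _ w] ab by blast
    qed
  qed simp
  then show ?thesis
    unfolding P_def S_def by auto
qed

section \<open>Continuously differentiable maps\<close>

definition has_dir_deriv ::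
  "('v::real_vector \<Rightarrow> 'w::{real_vector,t2_space}) \<Rightarrow> 'v \<Rightarrow> 'v \<Rightarrow> 'w \<Rightarrow> bool"
  where "has_dir_deriv f x h l \<longleftrightarrow> ((\<lambda>t::real. (f (x + t *\<^sub>R h) - f x) /\<^sub>R t) \<longlongrightarrow> l) (at 0)"

text \<open>The derivative is a function \<open>df\<close> of the pair of base point and direction, so that it can itself be
  differentiated. As in the definition of smoothness, \<open>V\<close> and \<open>W\<close> are subspaces of the ambient types and
  \<open>U\<close> is relatively open in \<open>V\<close>; only pairs in \<open>U \<times> V\<close> matter.\<close>

definition C1_on ::
  "'v::locally_convex_space set \<Rightarrow> 'v set \<Rightarrow> 'w::locally_convex_space set \<Rightarrow> ('v \<Rightarrow> 'w) \<Rightarrow>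
    ('v \<times> 'v \<Rightarrow> 'w) \<Rightarrow> bool"
  where "C1_on V U W f df \<longleftrightarrow>
    subspace V \<and> subspace W \<and> openin (top_of_set V) U \<and>
    (\<forall>x\<in>U. f x \<in> W) \<and> (\<forall>x\<in>U. \<forall>h\<in>V. df (x, h) \<in> W) \<and>
    (\<forall>x\<in>U. \<forall>h\<in>V. has_dir_deriv f x h (df (x, h))) \<and>
    continuous_on U f \<and> continuous_on (U \<times> V) df"

lemma C1_onD:
  assumes "C1_on V U W f df"
  shows "subspace V" "subspace W" "openin (top_of_set V) U" "U \<subseteq> V"
    "\<And>x. x \<in> U \<Longrightarrow> f x \<in> W" "\<And>x h. x \<in> U \<Longrightarrow> h \<in> V \<Longrightarrow> df (x, h) \<in> W"
    "\<And>x h. x \<in> U \<Longrightarrow> h \<in> V \<Longrightarrow> ((\<lambda>t. (f (x + t *\<^sub>R h) - f x) /\<^sub>R t) \<longlongrightarrow> df (x, h)) (at 0)"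
    "continuous_on U f" "continuous_on (U \<times> V) df"
  using assms unfolding C1_on_def has_dir_deriv_def by (auto dest: openin_imp_subset)

lemma openin_convex_nbhd:
  fixes V :: "'v::locally_convex_space set"
  assumes "openin (top_of_set V) U" "x \<in> U"
  shows "\<exists>C. open C \<and> convex C \<and> x \<in> C \<and> V \<inter> C \<subseteq> U"
proof -
  obtain T where "open T" "U = V \<inter> T"
    using assms(1) by (auto simp: openin_open)
  then show ?thesis
    using convex_nbhd_at[of T x] assms(2) by blast
qed

lemma at0_nontrivial: "at (0::real) \<noteq> bot"
  by simp

lemma tendsto_line:
  fixes x h :: "'v::locally_convex_space"
  shows "((\<lambda>t::real. x + t *\<^sub>R h) \<longlongrightarrow> x) (at 0)"
proof -
  have "((\<lambda>t::real. x + t *\<^sub>R h) \<longlongrightarrow> x + 0 *\<^sub>R h) (at 0)"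
    by (intro tendsto_add tendsto_scaleR_lcs tendsto_const tendsto_ident_at)
  then show ?thesis by simp
qed

lemma eventually_in_openin:
  assumes "openin (top_of_set V) U" "x \<in> U" "(X \<longlongrightarrow> x) F" "eventually (\<lambda>i. X i \<in> V) F"
  shows "eventually (\<lambda>i. X i \<in> U) F"
proof -
  obtain T where T: "open T" "U = V \<inter> T"
    using assms(1) by (auto simp: openin_open)
  then have "eventually (\<lambda>i. X i \<in> T) F"
    using assms by (intro topological_tendstoD) auto
  with assms(4) show ?thesis
    by eventually_elim (use T in auto)
qed

lemma eventually_line:
  fixes x h :: "'v::locally_convex_space"
  assumes "subspace V" "openin (top_of_set V) U" "x \<in> U" "h \<in> V"
  shows "eventually (\<lambda>t::real. x + t *\<^sub>R h \<in> U) (at 0)"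
  using assms openin_imp_subset[OF assms(2)]
  by (intro eventually_in_openin[OF assms(2,3) tendsto_line] always_eventually)
     (auto intro!: subspace_add subspace_scale)

lemma tendsto_continuous_on:
  assumes "continuous_on S f" "x \<in> S" "(X \<longlongrightarrow> x) F" "eventually (\<lambda>i. X i \<in> S) F"
  shows "((\<lambda>i. f (X i)) \<longlongrightarrow> f x) F"
  using continuous_on_tendsto_compose[OF assms(1,3,2,4)] .

text \<open>Strict differentiability: base point, direction and increment may all vary. The difference
  quotient is the increment over \<open>[0, 1]\<close> of a curve whose velocities are values of \<open>df\<close> close to \<open>df (x, h)\<close>,
  so the mean value theorem applies. The statement is phrased with an arbitrary filter because the chain rule
  inserts a varying direction and the second difference quotient a varying base point.\<close>

lemma C1_on_strict:
  assumes f: "C1_on V U W f df" and x: "x \<in> U" and h: "h \<in> V"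
    and X: "(X \<longlongrightarrow> x) F" and H: "(H \<longlongrightarrow> h) F" and T: "(T \<longlongrightarrow> 0) F"
    and ev: "eventually (\<lambda>i. X i \<in> V \<and> H i \<in> V \<and> T i \<noteq> (0::real)) F"
  shows "((\<lambda>i. (f (X i + T i *\<^sub>R H i) - f (X i)) /\<^sub>R T i) \<longlongrightarrow> df (x, h)) F"
proof (rule topological_tendstoI)
  note D = C1_onD[OF f]
  fix S assume S: "open S" "df (x, h) \<in> S"
  obtain N where N: "open N" "convex N" "0 \<in> N" "\<forall>a\<in>N. \<forall>b\<in>N. df (x, h) + a + b \<in> S"
    using convex_nbhd_add[OF S] by blast
  define K where "K = (+) (df (x, h)) ` N"
  have K: "convex K" "k \<in> K \<longleftrightarrow> k - df (x, h) \<in> N" for k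
    unfolding K_def using N(2) by (auto simp: image_iff intro!: bexI[of _ "k - _"])
  obtain C0 where C0: "open C0" "x \<in> C0" "V \<inter> C0 \<subseteq> U"
    using openin_convex_nbhd[OF D(3) x] by blast
  have "continuous_on (U \<times> V) (\<lambda>z. df z - df (x, h))"
    by (intro continuous_intros D)
  then obtain Z where Z: "open Z" "(\<lambda>z. df z - df (x, h)) -` N \<inter> (U \<times> V) = Z \<inter> (U \<times> V)"
    using N(1) unfolding continuous_on_open_invariant by metis
  have "(x, h) \<in> Z"
    using Z(2) x h N(3) by auto
  then obtain A B where AB: "open A" "open B" "x \<in> A" "h \<in> B" "A \<times> B \<subseteq> Z"
    using Z(1) by (metis open_prod_elim mem_Sigma_iff)
  obtain C where C: "open C" "convex C" "x \<in> C" "C \<subseteq> A \<inter> C0"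
    using convex_nbhd_at[of "A \<inter> C0" x] AB C0 by auto
  have dfK: "df (y, k) \<in> K" if "y \<in> V" "y \<in> C" "k \<in> V" "k \<in> B" for y k
  proof -
    have "y \<in> U" using that C C0 by auto
    then have "(y, k) \<in> Z \<inter> (U \<times> V)" using that C AB by auto
    then show ?thesis using Z(2) K(2) by auto
  qed
  have "((\<lambda>i. X i + T i *\<^sub>R H i) \<longlongrightarrow> x + 0 *\<^sub>R h) F"
    by (intro tendsto_add tendsto_scaleR_lcs X T H)
  then have ev1: "eventually (\<lambda>i. X i + T i *\<^sub>R H i \<in> C) F"
    using C by (intro topological_tendstoD) auto
  have ev2: "eventually (\<lambda>i. X i \<in> C) F"
    using C X by (intro topological_tendstoD) auto
  have ev3: "eventually (\<lambda>i. H i \<in> B) F"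
    using AB H by (intro topological_tendstoD) auto
  from ev ev1 ev2 ev3
  show "eventually (\<lambda>i. (f (X i + T i *\<^sub>R H i) - f (X i)) /\<^sub>R T i \<in> S) F"
  proof eventually_elim
    case (elim i)
    let ?c = "\<lambda>s. f (X i + s *\<^sub>R T i *\<^sub>R H i) /\<^sub>R T i"
    have inC: "X i + s *\<^sub>R T i *\<^sub>R H i \<in> C \<and> X i + s *\<^sub>R T i *\<^sub>R H i \<in> V" if "0 \<le> s" "s \<le> 1" for s
    proof
      have "(1 - s) *\<^sub>R X i + s *\<^sub>R (X i + T i *\<^sub>R H i) \<in> C"
        using elim that by (intro convexD_alt[OF C(2)]) auto
      then show "X i + s *\<^sub>R T i *\<^sub>R H i \<in> C"
        by (simp add: algebra_simps)
      show "X i + s *\<^sub>R T i *\<^sub>R H i \<in> V"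
        using elim D(1) by (auto intro!: subspace_add subspace_scale)
    qed
    have "\<exists>k\<in>K. \<exists>n\<in>N. ?c 1 - ?c 0 = k + n"
    proof (rule mean_value_convex[where c' = "\<lambda>s. df (X i + s *\<^sub>R T i *\<^sub>R H i, H i)"])
      fix s :: real assume s: "0 \<le> s" "s \<le> 1"
      let ?y = "X i + s *\<^sub>R T i *\<^sub>R H i"
      have y: "?y \<in> U" using inC[OF s] C C0 by auto
      have "filterlim (\<lambda>r. r * T i) (at 0) (at 0)"
        using elim by (auto intro!: filterlim_atI tendsto_eq_intros simp: eventually_at_filter)
      then have "((\<lambda>r. (f (?y + (r * T i) *\<^sub>R H i) - f ?y) /\<^sub>R (r * T i)) \<longlongrightarrow> df (?y, H i)) (at 0)"
        using filterlim_compose[OF D(7)[OF y, of "H i"]] elim by blast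
      then show "((\<lambda>r. (?c (s + r) - ?c s) /\<^sub>R r) \<longlongrightarrow> df (?y, H i)) (at 0)"
        by (simp add: algebra_simps scaleR_diff_right)
      show "df (?y, H i) \<in> K"
        using inC[OF s] elim by (intro dfK) auto
    qed (use K N in auto)
    then obtain k n where kn: "k \<in> K" "n \<in> N" "?c 1 - ?c 0 = k + n"
      by blast
    then have "df (x, h) + (k - df (x, h)) + n \<in> S"
      using N(4) K(2) by blast
    then show ?case
      using kn(3) by (simp add: algebra_simps scaleR_diff_right)
  qed
qed

lemma has_dir_deriv_unique: "has_dir_deriv f x h l \<Longrightarrow> has_dir_deriv f x h l' \<Longrightarrow> l = l'"
  unfolding has_dir_deriv_def by (rule tendsto_unique[OF at0_nontrivial])

lemma has_dir_deriv_dir_deriv: "has_dir_deriv f x h l \<Longrightarrow> dir_deriv f x h = l"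
  unfolding has_dir_deriv_def dir_deriv_def by (rule tendsto_Lim) simp_all

lemma C1_on_has_dir_deriv: "C1_on V U W f df \<Longrightarrow> x \<in> U \<Longrightarrow> h \<in> V \<Longrightarrow> has_dir_deriv f x h (df (x, h))"
  unfolding has_dir_deriv_def by (rule C1_onD(7))

lemma quotient_eventually_eq:
  fixes x :: "'v::locally_convex_space"
  assumes "subspace V" "openin (top_of_set V) T" "x \<in> T" "h \<in> V" "\<And>y. y \<in> T \<Longrightarrow> f y = g y"
  shows "eventually (\<lambda>t::real. (f (x + t *\<^sub>R h) - f x) /\<^sub>R t = (g (x + t *\<^sub>R h) - g x) /\<^sub>R t) (at 0)"
  using eventually_line[OF assms(1-4)] by eventually_elim (simp add: assms)

lemma has_dir_deriv_cong:
  fixes x :: "'v::locally_convex_space"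
  assumes "has_dir_deriv f x h l" "subspace V" "openin (top_of_set V) T" "x \<in> T" "h \<in> V" "\<And>y. y \<in> T \<Longrightarrow> f y = g y"
  shows "has_dir_deriv g x h l"
  using assms(1) quotient_eventually_eq[OF assms(2-6)] unfolding has_dir_deriv_def
  by (rule Lim_transform_eventually)

lemma dir_deriv_cong:
  fixes x :: "'v::locally_convex_space"
  assumes "subspace V" "openin (top_of_set V) T" "x \<in> T" "h \<in> V" "\<And>y. y \<in> T \<Longrightarrow> f y = g y"
  shows "dir_deriv f x h = dir_deriv g x h"
proof -
  have "eventually (\<lambda>t::real. (f (x + t *\<^sub>R h) - f x) /\<^sub>R t = (g (x + t *\<^sub>R h) - g x) /\<^sub>R t) (at 0)"
    by (rule quotient_eventually_eq[OF assms(1-4)]) (rule assms(5))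
  note tendsto_cong[OF this]
  then show ?thesis
    unfolding dir_deriv_def t2_space_class.Lim_def by simp
qed

text \<open>The difference quotient of \<open>g \<circ> f\<close> is the one of \<open>g\<close> at \<open>f x\<close> in the direction of the difference
  quotient of \<open>f\<close>, which converges to \<open>l\<close>.\<close>

lemma has_dir_deriv_chain:
  assumes f: "has_dir_deriv f x h l" and g: "C1_on W T Z g dg" and fx: "f x \<in> T" and l: "l \<in> W"
    and ev: "eventually (\<lambda>t::real. f (x + t *\<^sub>R h) \<in> W) (at 0)"
  shows "has_dir_deriv (\<lambda>y. g (f y)) x h (dg (f x, l))"
proof -
  have ne: "eventually (\<lambda>t::real. t \<noteq> 0) (at 0)"
    by (simp add: eventually_at_filter)
  have fxW: "f x \<in> W" using C1_onD(4)[OF g] fx by blast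
  from ev ne have "eventually (\<lambda>t. f x \<in> W \<and> (f (x + t *\<^sub>R h) - f x) /\<^sub>R t \<in> W \<and> t \<noteq> 0) (at (0::real))"
  proof eventually_elim
    case (elim t)
    then have "(f (x + t *\<^sub>R h) - f x) /\<^sub>R t \<in> W"
      using fxW by (intro subspace_scale subspace_diff C1_onD(1)[OF g])
    with elim fxW show ?case by simp
  qed
  then have "((\<lambda>t. (g (f x + t *\<^sub>R ((f (x + t *\<^sub>R h) - f x) /\<^sub>R t)) - g (f x)) /\<^sub>R t) \<longlongrightarrow> dg (f x, l)) (at 0)"
    using f unfolding has_dir_deriv_def
    by (intro C1_on_strict[OF g] fx l tendsto_const tendsto_ident_at)
  moreover have "eventually (\<lambda>t. (g (f x + t *\<^sub>R ((f (x + t *\<^sub>R h) - f x) /\<^sub>R t)) - g (f x)) /\<^sub>R t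
      = (g (f (x + t *\<^sub>R h)) - g (f x)) /\<^sub>R t) (at (0::real))"
    using ne by eventually_elim auto
  ultimately show ?thesis
    unfolding has_dir_deriv_def by (rule Lim_transform_eventually)
qed

lemma has_dir_deriv_add:
  assumes "has_dir_deriv f x h (l :: 'w::locally_convex_space)" "has_dir_deriv g x h l'"
  shows "has_dir_deriv (\<lambda>y. f y + g y) x h (l + l')"
  using tendsto_add[OF assms[unfolded has_dir_deriv_def]] unfolding has_dir_deriv_def
  by (simp add: algebra_simps scaleR_diff_right)

lemma C1_on_dir_deriv: "C1_on V U W f df \<Longrightarrow> x \<in> U \<Longrightarrow> h \<in> V \<Longrightarrow> dir_deriv f x h = df (x, h)"
  by (intro has_dir_deriv_dir_deriv C1_on_has_dir_deriv)

text \<open>Move first along \<open>h\<close> and then along \<open>k\<close>: strict differentiability handles the second step, whose base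
  point varies.\<close>

lemma C1_on_add_right:
  assumes f: "C1_on V U W f df" and x: "x \<in> U" and h: "h \<in> V" "k \<in> V"
  shows "df (x, h + k) = df (x, h) + df (x, k)"
proof -
  note D = C1_onD[OF f]
  have "((\<lambda>t. (f ((x + t *\<^sub>R h) + t *\<^sub>R k) - f (x + t *\<^sub>R h)) /\<^sub>R t) \<longlongrightarrow> df (x, k)) (at 0)"
  proof (intro C1_on_strict[OF f x h(2)] tendsto_line tendsto_const tendsto_ident_at)
    have "x + t *\<^sub>R h \<in> V" for t
      using D(1,4) x h by (auto intro!: subspace_add subspace_scale)
    then show "eventually (\<lambda>t. x + t *\<^sub>R h \<in> V \<and> k \<in> V \<and> t \<noteq> 0) (at 0)"
      using h by (simp add: eventually_at_filter)
  qed
  from tendsto_add[OF this D(7)[OF x h(1)]]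
  have "((\<lambda>t. (f (x + t *\<^sub>R (h + k)) - f x) /\<^sub>R t) \<longlongrightarrow> df (x, k) + df (x, h)) (at 0)"
    by (simp add: algebra_simps scaleR_diff_right)
  from tendsto_unique[OF at0_nontrivial D(7)[OF x subspace_add[OF D(1) h]] this]
  show ?thesis by (simp only: add.commute)
qed

lemma C1_on_scale_right:
  assumes f: "C1_on V U W f df" and x: "x \<in> U" and h: "h \<in> V"
  shows "df (x, r *\<^sub>R h) = r *\<^sub>R df (x, h)"
proof (cases "r = 0")
  case True
  have "df (x, 0 + 0) = df (x, 0) + df (x, 0)"
    by (rule C1_on_add_right[OF f x]) (use C1_onD(1)[OF f] subspace_0 in auto)
  with True show ?thesis by simp
next
  case False
  note D = C1_onD[OF f]
  have "filterlim (\<lambda>t. t * r) (at 0) (at (0::real))"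
    using False by (auto intro!: filterlim_atI tendsto_eq_intros simp: eventually_at_filter)
  from filterlim_compose[OF D(7)[OF x h] this]
  have "((\<lambda>t. r *\<^sub>R ((f (x + (t * r) *\<^sub>R h) - f x) /\<^sub>R (t * r))) \<longlongrightarrow> r *\<^sub>R df (x, h)) (at 0)"
    by (intro tendsto_scaleR_lcs tendsto_const)
  moreover have "r *\<^sub>R ((f (x + (t * r) *\<^sub>R h) - f x) /\<^sub>R (t * r)) = (f (x + t *\<^sub>R (r *\<^sub>R h)) - f x) /\<^sub>R t" for t
  proof -
    have "r * inverse (t * r) = inverse t" using False by (simp add: field_simps)
    then show ?thesis by (simp only: scaleR_scaleR)
  qed
  ultimately have "((\<lambda>t. (f (x + t *\<^sub>R (r *\<^sub>R h)) - f x) /\<^sub>R t) \<longlongrightarrow> r *\<^sub>R df (x, h)) (at 0)"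
    by (simp only:)
  from tendsto_unique[OF at0_nontrivial D(7)[OF x subspace_scale[OF D(1) h]] this]
  show ?thesis .
qed

lemma C1_on_cong:
  assumes f: "C1_on V U W f df"
    and eq: "\<And>x. x \<in> U \<Longrightarrow> g x = f x" "\<And>x h. x \<in> U \<Longrightarrow> h \<in> V \<Longrightarrow> dg (x, h) = df (x, h)"
  shows "C1_on V U W g dg"
  unfolding C1_on_def
proof (intro conjI ballI)
  note D = C1_onD[OF f]
  fix x h assume xh: "x \<in> U" "h \<in> V"
  show "has_dir_deriv g x h (dg (x, h))"
    unfolding eq(2)[OF xh]
    by (rule has_dir_deriv_cong[OF C1_on_has_dir_deriv[OF f xh] D(1,3) xh]) (simp add: eq(1))
next
  show "continuous_on U g"
    by (rule continuous_on_eq[OF C1_onD(8)[OF f]]) (simp add: eq(1))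
  show "continuous_on (U \<times> V) dg"
    by (rule continuous_on_eq[OF C1_onD(9)[OF f]]) (auto simp: eq(2))
qed (use C1_onD[OF f] eq in auto)

lemma C1_on_subset:
  assumes "C1_on V U W f df" "openin (top_of_set V) U'" "U' \<subseteq> U"
  shows "C1_on V U' W f df"
  using assms unfolding C1_on_def
  by (auto intro: continuous_on_subset[of U f] continuous_on_subset[of "U \<times> V" df])

lemma C1_on_codomain:
  assumes "C1_on V U W f df" "subspace W'" "\<And>x. x \<in> U \<Longrightarrow> f x \<in> W'"
    "\<And>x h. x \<in> U \<Longrightarrow> h \<in> V \<Longrightarrow> df (x, h) \<in> W'"
  shows "C1_on V U W' f df"
  using assms unfolding C1_on_def by auto

lemma C1_on_compose:
  assumes f: "C1_on V U W f df" and g: "C1_on W U' Z g dg" and sub: "\<And>x. x \<in> U \<Longrightarrow> f x \<in> U'"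
  shows "C1_on V U Z (\<lambda>x. g (f x)) (\<lambda>z. dg (f (fst z), df z))"
  unfolding C1_on_def
proof (intro conjI ballI)
  note Df = C1_onD[OF f]
  fix x h assume xh: "x \<in> U" "h \<in> V"
  have "eventually (\<lambda>t::real. f (x + t *\<^sub>R h) \<in> W) (at 0)"
    using eventually_line[OF Df(1,3) xh] by eventually_elim (rule Df(5))
  from has_dir_deriv_chain[OF C1_on_has_dir_deriv[OF f xh] g sub[OF xh(1)] Df(6)[OF xh] this]
  show "has_dir_deriv (\<lambda>x. g (f x)) x h (dg (f (fst (x, h)), df (x, h)))"
    by simp
next
  note Df = C1_onD[OF f] note Dg = C1_onD[OF g]
  show "continuous_on U (\<lambda>x. g (f x))"
    by (rule continuous_on_compose2[OF Dg(8) Df(8)]) (use sub in auto)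
  have "continuous_on (U \<times> V) (\<lambda>z. f (fst z))"
    by (rule continuous_on_compose2[OF Df(8)]) (auto intro: continuous_intros)
  then show "continuous_on (U \<times> V) (\<lambda>z. dg (f (fst z), df z))"
    by (intro continuous_on_compose2[OF Dg(9)] continuous_on_Pair Df) (use sub Df in auto)
qed (use C1_onD[OF f] C1_onD[OF g] sub in auto)

lemma C1_on_linear:
  assumes "subspace V" "subspace W" "openin (top_of_set V) U"
    and "\<And>x. x \<in> V \<Longrightarrow> f x \<in> W" "\<And>x y. x \<in> V \<Longrightarrow> y \<in> V \<Longrightarrow> f (x + y) = f x + f y"
    and "\<And>r x. x \<in> V \<Longrightarrow> f (r *\<^sub>R x) = r *\<^sub>R f x" "continuous_on V f"
  shows "C1_on V U W f (\<lambda>z. f (snd z))"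
  unfolding C1_on_def has_dir_deriv_def
proof (intro conjI ballI)
  have UV: "U \<subseteq> V" using assms(3) by (rule openin_imp_subset)
  fix x h assume xh: "x \<in> U" "h \<in> V"
  have "f (x + t *\<^sub>R h) = f x + t *\<^sub>R f h" for t
    using xh UV assms(5)[of x "t *\<^sub>R h"] assms(6)[of h t] subspace_scale[OF assms(1)] by auto
  then have "eventually (\<lambda>t::real. f h = (f (x + t *\<^sub>R h) - f x) /\<^sub>R t) (at 0)"
    by (simp add: eventually_at_filter)
  from Lim_transform_eventually[OF tendsto_const this]
  show "((\<lambda>t. (f (x + t *\<^sub>R h) - f x) /\<^sub>R t) \<longlongrightarrow> f (snd (x, h))) (at 0)"
    by simp
next
  show "continuous_on U f"
    using assms continuous_on_subset openin_imp_subset by blast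
  show "continuous_on (U \<times> V) (\<lambda>z. f (snd z))"
    by (rule continuous_on_compose2[OF assms(7)]) (auto intro: continuous_intros)
qed (use assms openin_imp_subset[OF assms(3)] in auto)

lemma C1_on_const:
  assumes "subspace V" "subspace W" "openin (top_of_set V) U" "c \<in> W"
  shows "C1_on V U W (\<lambda>x. c) (\<lambda>z. 0)"
  unfolding C1_on_def has_dir_deriv_def using assms by (auto simp: subspace_0)

lemma C1_on_Pair:
  assumes f: "C1_on V U W f df" and g: "C1_on V U Z g dg"
  shows "C1_on V U (W \<times> Z) (\<lambda>x. (f x, g x)) (\<lambda>z. (df z, dg z))"
  unfolding C1_on_def has_dir_deriv_def
proof (intro conjI ballI)
  fix x h assume xh: "x \<in> U" "h \<in> V"
  from tendsto_Pair[OF C1_onD(7)[OF f xh] C1_onD(7)[OF g xh]]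
  show "((\<lambda>t. ((f (x + t *\<^sub>R h), g (x + t *\<^sub>R h)) - (f x, g x)) /\<^sub>R t) \<longlongrightarrow> (df (x, h), dg (x, h))) (at 0)"
    by (simp add: scaleR_prod_def)
qed (use C1_onD[OF f] C1_onD[OF g] in \<open>auto intro: continuous_on_Pair subspace_Times\<close>)

lemma C1_on_vec:
  fixes f :: "'n::finite \<Rightarrow> 'v::locally_convex_space \<Rightarrow> 'w::locally_convex_space"
  assumes f: "\<And>i. C1_on V U UNIV (f i) (df i)"
  shows "C1_on V U UNIV (\<lambda>x. \<chi> i. f i x) (\<lambda>z. \<chi> i. df i z)"
  unfolding C1_on_def has_dir_deriv_def
proof (intro conjI ballI)
  fix x h assume xh: "x \<in> U" "h \<in> V"
  show "((\<lambda>t. ((\<chi> i. f i (x + t *\<^sub>R h)) - (\<chi> i. f i x)) /\<^sub>R t) \<longlongrightarrow> (\<chi> i. df i (x, h))) (at 0)"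
    using C1_onD(7)[OF f xh] by (intro vec_tendstoI) simp
qed (use C1_onD[OF f] in \<open>auto intro: continuous_on_vec_lambda\<close>)

definition continuous_bilinear ::
  "('a::locally_convex_space \<Rightarrow> 'b::locally_convex_space \<Rightarrow> 'c::locally_convex_space) \<Rightarrow> bool"
  where "continuous_bilinear b \<longleftrightarrow>
    continuous_on UNIV (\<lambda>z. b (fst z) (snd z)) \<and>
    (\<forall>x y z. b (x + y) z = b x z + b y z) \<and> (\<forall>x y z. b x (y + z) = b x y + b x z) \<and>
    (\<forall>r x y. b (r *\<^sub>R x) y = r *\<^sub>R b x y) \<and> (\<forall>r x y. b x (r *\<^sub>R y) = r *\<^sub>R b x y)"

lemma continuous_bilinear_tendsto:
  assumes "continuous_bilinear b" "(f \<longlongrightarrow> x) F" "(g \<longlongrightarrow> y) F"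
  shows "((\<lambda>i. b (f i) (g i)) \<longlongrightarrow> b x y) F"
proof -
  have "continuous_on UNIV (\<lambda>z. b (fst z) (snd z))"
    using assms(1) by (simp add: continuous_bilinear_def)
  from continuous_on_tendsto_compose[OF this tendsto_Pair[OF assms(2,3)]]
  show ?thesis by simp
qed

lemma continuous_on_bilinear:
  fixes f :: "'x::topological_space \<Rightarrow> 'a::locally_convex_space"
  assumes "continuous_bilinear b" "continuous_on S f" "continuous_on S g"
  shows "continuous_on S (\<lambda>x. b (f x) (g x))"
  using assms unfolding continuous_on_def by (blast intro: continuous_bilinear_tendsto)

lemma continuous_bilinear_diff:
  assumes "continuous_bilinear b"
  shows "b (x - x') y = b x y - b x' y" "b x (y - y') = b x y - b x y'"
  using assms unfolding continuous_bilinear_def by (metis add_diff_cancel_right' diff_add_cancel)+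

lemma C1_on_bilinear:
  assumes b: "continuous_bilinear b" and f: "C1_on V U W f df" and g: "C1_on V U Z g dg"
  shows "C1_on V U UNIV (\<lambda>x. b (f x) (g x)) (\<lambda>z. b (df z) (g (fst z)) + b (f (fst z)) (dg z))"
  unfolding C1_on_def has_dir_deriv_def
proof (intro conjI ballI)
  note Df = C1_onD[OF f] note Dg = C1_onD[OF g]
  have scale: "b (r *\<^sub>R x) y = r *\<^sub>R b x y" "b x (r *\<^sub>R y) = r *\<^sub>R b x y" for r x y
    using b by (simp_all add: continuous_bilinear_def)
  fix x h assume xh: "x \<in> U" "h \<in> V"
  have "eventually (\<lambda>t. x + t *\<^sub>R h \<in> U) (at (0::real))"
    by (intro eventually_line[OF Df(1)] Df(3) xh)
  from tendsto_continuous_on[OF Dg(8) xh(1) tendsto_line this]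
  have "((\<lambda>t. g (x + t *\<^sub>R h)) \<longlongrightarrow> g x) (at 0)" .
  from tendsto_add[OF continuous_bilinear_tendsto[OF b Df(7)[OF xh] this]
      continuous_bilinear_tendsto[OF b tendsto_const[of "f x"] Dg(7)[OF xh]]]
  show "((\<lambda>t. (b (f (x + t *\<^sub>R h)) (g (x + t *\<^sub>R h)) - b (f x) (g x)) /\<^sub>R t) \<longlongrightarrow>
    b (df (x, h)) (g (fst (x, h))) + b (f (fst (x, h))) (dg (x, h))) (at 0)"
    by (simp add: scale continuous_bilinear_diff[OF b] scaleR_diff_right)
next
  note Df = C1_onD[OF f] note Dg = C1_onD[OF g]
  show "continuous_on U (\<lambda>x. b (f x) (g x))"
    by (intro continuous_on_bilinear[OF b] Df Dg)
  have "continuous_on (U \<times> V) (\<lambda>z. f (fst z))" "continuous_on (U \<times> V) (\<lambda>z. g (fst z))"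
    by (rule continuous_on_compose2[OF Df(8)] continuous_on_compose2[OF Dg(8)]; auto intro: continuous_intros)+
  then show "continuous_on (U \<times> V) (\<lambda>z. b (df z) (g (fst z)) + b (f (fst z)) (dg z))"
    by (intro continuous_on_add continuous_on_bilinear[OF b] Df Dg)
qed (use C1_onD[OF f] in auto)

lemma C1_on_add:
  assumes f: "C1_on V U W f df" and g: "C1_on V U W g dg"
  shows "C1_on V U W (\<lambda>x. f x + g x) (\<lambda>z. df z + dg z)"
  unfolding C1_on_def
proof (intro conjI ballI)
  fix x h assume "x \<in> U" "h \<in> V"
  then show "has_dir_deriv (\<lambda>x. f x + g x) x h (df (x, h) + dg (x, h))"
    by (intro has_dir_deriv_add C1_on_has_dir_deriv[OF f] C1_on_has_dir_deriv[OF g])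
qed (use C1_onD[OF f] C1_onD[OF g] in \<open>auto intro: continuous_on_add subspace_add\<close>)

section \<open>Twice continuously differentiable maps\<close>

text \<open>Demanding that \<open>df\<close> be \<open>C\<^sup>1\<close> on \<open>U \<times> V\<close>, with both arguments varying, rather than in the base point only,
  makes closure under composition a consequence of the chain rule for \<open>C\<^sup>1\<close> maps.\<close>

definition C2_on ::
  "'v::locally_convex_space set \<Rightarrow> 'v set \<Rightarrow> 'w::locally_convex_space set \<Rightarrow> ('v \<Rightarrow> 'w) \<Rightarrow> bool"
  where "C2_on V U W f \<longleftrightarrow>
    (\<exists>df ddf. C1_on V U W f df \<and> C1_on (V \<times> V) (U \<times> V) W df ddf)"

lemma C2_onD:
  assumes "C2_on V U W f"
  shows "subspace V" "subspace W" "openin (top_of_set V) U" "U \<subseteq> V"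
    "\<And>x. x \<in> U \<Longrightarrow> f x \<in> W" "continuous_on U f"
  using assms unfolding C2_on_def by (auto dest: C1_onD)

lemma C1_on_fst:
  assumes "C1_on V U W f df"
  shows "C1_on (V \<times> V) (U \<times> V) W (\<lambda>z. f (fst z)) (\<lambda>w. df (fst (fst w), fst (snd w)))"
proof -
  note D = C1_onD[OF assms]
  have "C1_on (V \<times> V) (U \<times> V) V fst (\<lambda>z. fst (snd z))"
    using D(1,3) by (intro C1_on_linear subspace_Times openin_Times) (auto intro: continuous_intros)
  from C1_on_compose[OF this assms] show ?thesis by (auto simp: mem_Times_iff)
qed

lemma C2_on_compose:
  assumes f: "C2_on V U W f" and g: "C2_on W U' Z g" and sub: "\<And>x. x \<in> U \<Longrightarrow> f x \<in> U'"
  shows "C2_on V U Z (\<lambda>x. g (f x))"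
proof -
  obtain df ddf where f: "C1_on V U W f df" "C1_on (V \<times> V) (U \<times> V) W df ddf"
    using f unfolding C2_on_def by blast
  obtain dg ddg where g: "C1_on W U' Z g dg" "C1_on (W \<times> W) (U' \<times> W) Z dg ddg"
    using g unfolding C2_on_def by blast
  have "C1_on (V \<times> V) (U \<times> V) (W \<times> W) (\<lambda>z. (f (fst z), df z))
      (\<lambda>w. (df (fst (fst w), fst (snd w)), ddf w))"
    by (intro C1_on_Pair C1_on_fst f)
  then have "C1_on (V \<times> V) (U \<times> V) Z (\<lambda>z. dg (f (fst z), df z))
      (\<lambda>w. ddg ((f (fst (fst w)), df (fst w)), (df (fst (fst w), fst (snd w)), ddf w)))"
    by (rule C1_on_compose[OF _ g(2)]) (use sub C1_onD(6)[OF f(1)] in auto)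
  with C1_on_compose[OF f(1) g(1) sub] show ?thesis
    unfolding C2_on_def by blast
qed

lemma C2_on_cong:
  assumes "C2_on V U W f" "\<And>x. x \<in> U \<Longrightarrow> g x = f x"
  shows "C2_on V U W g"
proof -
  obtain df ddf where f: "C1_on V U W f df" "C1_on (V \<times> V) (U \<times> V) W df ddf"
    using assms(1) unfolding C2_on_def by blast
  have "C1_on V U W g df"
    by (rule C1_on_cong[OF f(1)]) (simp_all add: assms(2))
  with f(2) show ?thesis
    unfolding C2_on_def by blast
qed

lemma C2_on_subset:
  assumes "C2_on V U W f" "openin (top_of_set V) U'" "U' \<subseteq> U"
  shows "C2_on V U' W f"
proof -
  obtain df ddf where f: "C1_on V U W f df" "C1_on (V \<times> V) (U \<times> V) W df ddf"
    using assms(1) unfolding C2_on_def by blast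
  have "openin (top_of_set (V \<times> V)) (U' \<times> V)"
    using assms(2) by (intro openin_Times) auto
  then show ?thesis
    unfolding C2_on_def using C1_on_subset[OF f(1) assms(2,3)] C1_on_subset[OF f(2)] assms(3) by blast
qed

lemma C2_on_linear:
  assumes "subspace V" "subspace W" "openin (top_of_set V) U"
    and "\<And>x. x \<in> V \<Longrightarrow> f x \<in> W" "\<And>x y. x \<in> V \<Longrightarrow> y \<in> V \<Longrightarrow> f (x + y) = f x + f y"
    and "\<And>r x. x \<in> V \<Longrightarrow> f (r *\<^sub>R x) = r *\<^sub>R f x" "continuous_on V f"
  shows "C2_on V U W f"
proof -
  have "C1_on (V \<times> V) (U \<times> V) W (\<lambda>z. f (snd z)) (\<lambda>z. f (snd (snd z)))"
    using assms
    by (intro C1_on_linear subspace_Times openin_Times continuous_on_compose2[OF assms(7)])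
       (auto intro: continuous_intros)
  with C1_on_linear[OF assms] show ?thesis
    unfolding C2_on_def by blast
qed

lemma C2_on_const:
  assumes "subspace V" "subspace W" "openin (top_of_set V) U" "c \<in> W"
  shows "C2_on V U W (\<lambda>x. c)"
proof -
  have "C1_on (V \<times> V) (U \<times> V) W (\<lambda>z. 0) (\<lambda>z. 0)"
    by (intro C1_on_const subspace_Times openin_Times assms subspace_0) simp
  with C1_on_const[OF assms] show ?thesis
    unfolding C2_on_def by blast
qed

lemma C2_on_Pair:
  assumes "C2_on V U W f" "C2_on V U Z g"
  shows "C2_on V U (W \<times> Z) (\<lambda>x. (f x, g x))"
  using assms unfolding C2_on_def by (blast intro: C1_on_Pair)

lemma C2_on_vec:
  fixes f :: "'n::finite \<Rightarrow> 'v::locally_convex_space \<Rightarrow> 'w::locally_convex_space"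
  assumes f: "\<And>i. C2_on V U UNIV (f i)"
  shows "C2_on V U UNIV (\<lambda>x. \<chi> i. f i x)"
proof -
  obtain df ddf where "\<And>i. C1_on V U UNIV (f i) (df i)" "\<And>i. C1_on (V \<times> V) (U \<times> V) UNIV (df i) (ddf i)"
    using f unfolding C2_on_def by metis
  then show ?thesis
    unfolding C2_on_def by (blast intro: C1_on_vec)
qed

lemma C2_on_bilinear:
  assumes b: "continuous_bilinear b" and f: "C2_on V U W f" and g: "C2_on V U Z g"
  shows "C2_on V U UNIV (\<lambda>x. b (f x) (g x))"
proof -
  obtain df ddf where f: "C1_on V U W f df" "C1_on (V \<times> V) (U \<times> V) W df ddf"
    using f unfolding C2_on_def by blast
  obtain dg ddg where g: "C1_on V U Z g dg" "C1_on (V \<times> V) (U \<times> V) Z dg ddg"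
    using g unfolding C2_on_def by blast
  note C1_on_add[OF C1_on_bilinear[OF b f(2) C1_on_fst[OF g(1)]]
      C1_on_bilinear[OF b C1_on_fst[OF f(1)] g(2)]]
  with C1_on_bilinear[OF b f(1) g(1)] show ?thesis
    unfolding C2_on_def by blast
qed

text \<open>Difference quotients of a map into a closed subspace stay in it, hence so do all derivatives.\<close>

lemma C2_on_codomain:
  assumes f: "C2_on V U UNIV f" and W: "subspace W" "closed W" "\<And>x. x \<in> U \<Longrightarrow> f x \<in> W"
  shows "C2_on V U W f"
proof -
  obtain df ddf where f: "C1_on V U UNIV f df" "C1_on (V \<times> V) (U \<times> V) UNIV df ddf"
    using f unfolding C2_on_def by blast
  have *: "dg (x, h) \<in> W" if g: "C1_on V' U' UNIV g dg" "\<And>x. x \<in> U' \<Longrightarrow> g x \<in> W" "x \<in> U'" "h \<in> V'"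
    for V' U' :: "'x::locally_convex_space set" and g dg x h
  proof (rule Lim_in_closed_set[OF W(2) _ at0_nontrivial C1_onD(7)[OF g(1,3,4)]])
    have "eventually (\<lambda>t. x + t *\<^sub>R h \<in> U') (at (0::real))"
      using C1_onD[OF g(1)] g by (intro eventually_line) auto
    then show "eventually (\<lambda>t. (g (x + t *\<^sub>R h) - g x) /\<^sub>R t \<in> W) (at 0)"
      by eventually_elim (use W(1) g in \<open>auto intro!: subspace_diff subspace_scale\<close>)
  qed
  have df: "C1_on V U W f df"
    by (rule C1_on_codomain[OF f(1) W(1)]) (use W(3) *[OF f(1) W(3)] in auto)
  have "C1_on (V \<times> V) (U \<times> V) W df ddf"
    by (rule C1_on_codomain[OF f(2) W(1)]) (use C1_onD(6)[OF df] *[OF f(2)] in auto)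
  with df show ?thesis
    unfolding C2_on_def by blast
qed

section \<open>Symmetry of the second derivative\<close>

lemma eventually_prod_principal:
  "eventually P (F \<times>\<^sub>F principal S) \<longleftrightarrow> eventually (\<lambda>x. \<forall>y\<in>S. P (x, y)) F"
proof
  assume "eventually P (F \<times>\<^sub>F principal S)"
  then obtain Pf Pg where P: "eventually Pf F" "\<forall>y\<in>S. Pg y" "\<forall>x y. Pf x \<longrightarrow> Pg y \<longrightarrow> P (x, y)"
    unfolding eventually_prod_filter eventually_principal by (elim exE conjE) (rule that)
  from P(1) show "eventually (\<lambda>x. \<forall>y\<in>S. P (x, y)) F"
    by eventually_elim (simp add: P(2,3))
next
  assume "eventually (\<lambda>x. \<forall>y\<in>S. P (x, y)) F"
  then show "eventually P (F \<times>\<^sub>F principal S)"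
    unfolding eventually_prod_filter eventually_principal
    by (intro exI[of _ "\<lambda>x. \<forall>y\<in>S. P (x, y)"] exI[of _ "\<lambda>y. y \<in> S"]) simp
qed

text \<open>The second difference is the increment over \<open>s \<in> [0, 1]\<close> of \<open>f (x + s t h + t k) - f (x + s t h)\<close>,
  whose velocity is \<open>t\<^sup>2\<close> times a difference quotient of \<open>df\<close> in direction \<open>(k, 0)\<close>. By strict
  differentiability of \<open>df\<close> these quotients are close to the limit uniformly in \<open>s\<close>, which the
  filter \<open>F\<close> expresses.\<close>

lemma second_difference_quotient:
  assumes f: "C1_on V U W f df" and df: "C1_on (V \<times> V) (U \<times> V) W df ddf"
    and x: "x \<in> U" and h: "h \<in> V" and k: "k \<in> V"
  shows "((\<lambda>t. (f (x + t *\<^sub>R h + t *\<^sub>R k) - f (x + t *\<^sub>R h) - f (x + t *\<^sub>R k) + f x) /\<^sub>R (t * t))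
    \<longlongrightarrow> ddf ((x, h), (k, 0))) (at 0)"
proof (rule topological_tendstoI)
  note D = C1_onD[OF f]
  fix S assume S: "open S" "ddf ((x, h), (k, 0)) \<in> S"
  obtain N where N: "open N" "convex N" "0 \<in> N" "\<forall>a\<in>N. \<forall>b\<in>N. ddf ((x, h), (k, 0)) + a + b \<in> S"
    using convex_nbhd_add[OF S] by blast
  define K where "K = (+) (ddf ((x, h), (k, 0))) ` N"
  have K: "convex K" "z \<in> K \<longleftrightarrow> z - ddf ((x, h), (k, 0)) \<in> N" for z
    unfolding K_def using N(2) by (auto simp: image_iff intro!: bexI[of _ "z - _"])
  define F where "F = at (0::real) \<times>\<^sub>F principal {0..1::real}"
  have fstF: "filterlim fst (at 0) F"
    unfolding F_def by (rule filterlim_fst)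
  then have fst0: "(fst \<longlongrightarrow> 0) F"
    unfolding filterlim_at by auto
  have prod0: "((\<lambda>z. snd z * fst z) \<longlongrightarrow> 0) F"
  proof (rule tendsto_0_le[OF fst0])
    show "eventually (\<lambda>z. norm (snd z * fst z) \<le> norm (fst z) * 1) F"
      unfolding F_def eventually_prod_principal
      by (intro always_eventually) (auto simp: abs_mult mult_left_le_one_le)
  qed
  have mem: "x + a *\<^sub>R h + b *\<^sub>R k \<in> V" for a b
    using D(1,4) x h k by (auto intro!: subspace_add subspace_scale)
  have "((\<lambda>z. (df ((x + (snd z * fst z) *\<^sub>R h, h) + fst z *\<^sub>R (k, 0)) - df (x + (snd z * fst z) *\<^sub>R h, h)) /\<^sub>R fst z)
      \<longlongrightarrow> ddf ((x, h), (k, 0))) F"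
  proof (rule C1_on_strict[OF df _ _ _ tendsto_const fst0])
    have "((\<lambda>z. x + (snd z * fst z) *\<^sub>R h) \<longlongrightarrow> x + 0 *\<^sub>R h) F"
      by (intro tendsto_add tendsto_scaleR_lcs prod0 tendsto_const)
    then show "((\<lambda>z. (x + (snd z * fst z) *\<^sub>R h, h)) \<longlongrightarrow> (x, h)) F"
      by (intro tendsto_Pair tendsto_const) simp
    show "eventually (\<lambda>z. (x + (snd z * fst z) *\<^sub>R h, h) \<in> V \<times> V \<and> (k, 0) \<in> V \<times> V \<and> fst z \<noteq> 0) F"
      unfolding F_def eventually_prod_principal
      using mem[of _ 0] h k subspace_0[OF D(1)] by (simp add: eventually_at_filter)
  qed (use x h k subspace_0[OF D(1)] in auto)
  moreover have "open ((\<lambda>z. z - ddf ((x, h), (k, 0))) -` N)"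
    by (intro open_vimage N continuous_intros)
  ultimately have "eventually (\<lambda>z. (df ((x + (snd z * fst z) *\<^sub>R h, h) + fst z *\<^sub>R (k, 0)) - df (x + (snd z * fst z) *\<^sub>R h, h)) /\<^sub>R fst z
      \<in> (\<lambda>z. z - ddf ((x, h), (k, 0))) -` N) F"
    using N(3) by (intro topological_tendstoD) auto
  then have ev: "eventually (\<lambda>t. \<forall>s\<in>{0..1}. (df (x + (s * t) *\<^sub>R h + t *\<^sub>R k, h) - df (x + (s * t) *\<^sub>R h, h)) /\<^sub>R t \<in> K) (at 0)"
    unfolding F_def eventually_prod_principal using K(2) by simp
  obtain C where C: "open C" "convex C" "x \<in> C" "V \<inter> C \<subseteq> U"
    using openin_convex_nbhd[OF D(3) x] by blast
  have near: "eventually (\<lambda>t::real. x + t *\<^sub>R y + t *\<^sub>R z \<in> C) (at 0)" for y z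
  proof -
    have "((\<lambda>t::real. x + t *\<^sub>R y + t *\<^sub>R z) \<longlongrightarrow> x + 0 *\<^sub>R y + 0 *\<^sub>R z) (at 0)"
      by (intro tendsto_add tendsto_scaleR_lcs tendsto_const tendsto_ident_at)
    then show ?thesis
      using C by (intro topological_tendstoD) auto
  qed
  have "eventually (\<lambda>t::real. t \<noteq> 0) (at 0)"
    by (simp add: eventually_at_filter)
  with ev near[of h k] near[of h 0] near[of k 0]
  show "eventually (\<lambda>t. (f (x + t *\<^sub>R h + t *\<^sub>R k) - f (x + t *\<^sub>R h) - f (x + t *\<^sub>R k) + f x) /\<^sub>R (t * t) \<in> S) (at 0)"
  proof eventually_elim
    case (elim t)
    let ?c = "\<lambda>s. (f (x + (s * t) *\<^sub>R h + t *\<^sub>R k) - f (x + (s * t) *\<^sub>R h)) /\<^sub>R (t * t)"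
    let ?c' = "\<lambda>s. (df (x + (s * t) *\<^sub>R h + t *\<^sub>R k, h) - df (x + (s * t) *\<^sub>R h, h)) /\<^sub>R t"
    have in1: "x + (s * t) *\<^sub>R h + t *\<^sub>R k \<in> U" if "0 \<le> s" "s \<le> 1" for s
    proof -
      have "(1 - s) *\<^sub>R (x + t *\<^sub>R k) + s *\<^sub>R (x + t *\<^sub>R h + t *\<^sub>R k) \<in> C"
        using elim that by (intro convexD_alt[OF C(2)]) auto
      moreover have "(1 - s) *\<^sub>R (x + t *\<^sub>R k) + s *\<^sub>R (x + t *\<^sub>R h + t *\<^sub>R k) = x + (s * t) *\<^sub>R h + t *\<^sub>R k"
        by (simp add: algebra_simps)
      ultimately show ?thesis
        using C(4) mem[of "s * t" t] by auto
    qed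
    have in2: "x + (s * t) *\<^sub>R h \<in> U" if "0 \<le> s" "s \<le> 1" for s
    proof -
      have "(1 - s) *\<^sub>R x + s *\<^sub>R (x + t *\<^sub>R h) \<in> C"
        using elim that by (intro convexD_alt[OF C(2)] C(3)) auto
      moreover have "(1 - s) *\<^sub>R x + s *\<^sub>R (x + t *\<^sub>R h) = x + (s * t) *\<^sub>R h"
        by (simp add: algebra_simps)
      ultimately show ?thesis
        using C(4) mem[of "s * t" 0] by auto
    qed
    have "\<exists>k\<in>K. \<exists>n\<in>N. ?c 1 - ?c 0 = k + n"
    proof (rule mean_value_convex[where c' = ?c'])
      fix s :: real assume s: "0 \<le> s" "s \<le> 1"
      have lim: "filterlim (\<lambda>r. r * t) (at 0) (at 0)"
        using elim by (auto intro!: filterlim_atI tendsto_eq_intros simp: eventually_at_filter)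
      from tendsto_diff[OF filterlim_compose[OF D(7)[OF in1[OF s] h] lim] filterlim_compose[OF D(7)[OF in2[OF s] h] lim]]
      have "((\<lambda>r. inverse t *\<^sub>R ((f (x + (s * t) *\<^sub>R h + t *\<^sub>R k + (r * t) *\<^sub>R h) - f (x + (s * t) *\<^sub>R h + t *\<^sub>R k)) /\<^sub>R (r * t)
          - (f (x + (s * t) *\<^sub>R h + (r * t) *\<^sub>R h) - f (x + (s * t) *\<^sub>R h)) /\<^sub>R (r * t))) \<longlongrightarrow> ?c' s) (at 0)"
        by (intro tendsto_scaleR_lcs tendsto_const)
      then show "((\<lambda>r. (?c (s + r) - ?c s) /\<^sub>R r) \<longlongrightarrow> ?c' s) (at 0)"
        by (rule Lim_transform_eventually, intro always_eventually allI)
           (simp add: algebra_simps scaleR_diff_right)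
      show "?c' s \<in> K"
        using elim s by auto
    qed (use K N in auto)
    then obtain z n where kn: "z \<in> K" "n \<in> N" "?c 1 - ?c 0 = z + n"
      by blast
    then have "ddf ((x, h), (k, 0)) + (z - ddf ((x, h), (k, 0))) + n \<in> S"
      using N(4) K(2) by blast
    then have "?c 1 - ?c 0 \<in> S"
      using kn(3) by simp
    moreover have "?c 1 - ?c 0 = (f (x + t *\<^sub>R h + t *\<^sub>R k) - f (x + t *\<^sub>R h) - f (x + t *\<^sub>R k) + f x) /\<^sub>R (t * t)"
      by (simp add: scaleR_diff_right scaleR_add_right)
    ultimately show ?case by simp
  qed
qed

text \<open>The second difference is symmetric in \<open>h\<close> and \<open>k\<close>.\<close>

lemma second_derivative_symmetric:
  assumes f: "C1_on V U W f df" and df: "C1_on (V \<times> V) (U \<times> V) W df ddf"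
    and x: "x \<in> U" and h: "h \<in> V" and k: "k \<in> V"
  shows "ddf ((x, h), (k, 0)) = ddf ((x, k), (h, 0))"
proof -
  have "((\<lambda>t. (f (x + t *\<^sub>R h + t *\<^sub>R k) - f (x + t *\<^sub>R h) - f (x + t *\<^sub>R k) + f x) /\<^sub>R (t * t))
    \<longlongrightarrow> ddf ((x, k), (h, 0))) (at 0)"
    by (rule Lim_transform_eventually[OF second_difference_quotient[OF f df x k h]])
       (intro always_eventually allI, simp add: algebra_simps)
  from tendsto_unique[OF at0_nontrivial second_difference_quotient[OF f df x h k] this]
  show ?thesis .
qed

lemma derivative_along_field:
  assumes f: "C1_on V U W f df" and df: "C1_on (V \<times> V) (U \<times> V) W df ddf"
    and x: "x \<in> U" and h: "h \<in> V" and O: "openin (top_of_set V) T" "x \<in> T" "\<And>y. y \<in> T \<Longrightarrow> Y y \<in> V"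
    and Y: "has_dir_deriv Y x h Y'" "Y' \<in> V"
  shows "has_dir_deriv (\<lambda>y. df (y, Y y)) x h (ddf ((x, Y x), (h, 0)) + df (x, Y'))"
proof -
  note D = C1_onD[OF f]
  note DD = C1_onD[OF df]
  have Yx: "Y x \<in> V" using O by auto
  have "eventually (\<lambda>t::real. x + t *\<^sub>R h \<in> T) (at 0)"
    by (intro eventually_line[OF D(1)] O h)
  then have evT: "eventually (\<lambda>t::real. x + t *\<^sub>R h \<in> T \<and> t \<noteq> 0) (at 0)"
    by (simp add: eventually_at_filter)
  have "((\<lambda>t. (df ((x, Y x) + t *\<^sub>R (h, (Y (x + t *\<^sub>R h) - Y x) /\<^sub>R t)) - df (x, Y x)) /\<^sub>R t)
      \<longlongrightarrow> ddf ((x, Y x), (h, Y'))) (at 0)"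
  proof (rule C1_on_strict[OF df])
    show "((\<lambda>t. (h, (Y (x + t *\<^sub>R h) - Y x) /\<^sub>R t)) \<longlongrightarrow> (h, Y')) (at 0)"
      by (intro tendsto_Pair tendsto_const Y(1)[unfolded has_dir_deriv_def])
    show "eventually (\<lambda>t. (x, Y x) \<in> V \<times> V \<and> (h, (Y (x + t *\<^sub>R h) - Y x) /\<^sub>R t) \<in> V \<times> V \<and> t \<noteq> 0) (at 0)"
      using evT
    proof eventually_elim
      case (elim t)
      then have "(Y (x + t *\<^sub>R h) - Y x) /\<^sub>R t \<in> V"
        using O(3) Yx D(1) by (intro subspace_scale subspace_diff) auto
      with elim Yx x h D(4) show ?case by auto
    qed
  qed (use x h Y Yx in \<open>auto intro: tendsto_ident_at\<close>)
  moreover have "eventually (\<lambda>t. (df ((x, Y x) + t *\<^sub>R (h, (Y (x + t *\<^sub>R h) - Y x) /\<^sub>R t)) - df (x, Y x)) /\<^sub>R t =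
      (df (x + t *\<^sub>R h, Y (x + t *\<^sub>R h)) - df (x, Y x)) /\<^sub>R t) (at 0)"
    using evT by eventually_elim simp
  ultimately have lim: "((\<lambda>t. (df (x + t *\<^sub>R h, Y (x + t *\<^sub>R h)) - df (x, Y x)) /\<^sub>R t)
      \<longlongrightarrow> ddf ((x, Y x), (h, Y'))) (at 0)"
    by (rule Lim_transform_eventually)
  have z: "0 \<in> V" by (rule subspace_0[OF D(1)])
  have "ddf ((x, Y x), (h, 0) + (0, Y')) = ddf ((x, Y x), (h, 0)) + ddf ((x, Y x), (0, Y'))"
    by (rule C1_on_add_right[OF df]) (use x h Y Yx z in auto)
  moreover have "ddf ((x, Y x), (0, Y')) = df (x, Y')"
  proof (rule tendsto_unique[OF at0_nontrivial DD(7)])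
    have "(df ((x, Y x) + t *\<^sub>R (0, Y')) - df (x, Y x)) /\<^sub>R t = df (x, Y')" if "t \<noteq> 0" for t
      using C1_on_add_right[OF f x Yx subspace_scale[OF D(1) Y(2)]] C1_on_scale_right[OF f x Y(2)] that by simp
    then show "((\<lambda>t. (df ((x, Y x) + t *\<^sub>R (0, Y')) - df (x, Y x)) /\<^sub>R t) \<longlongrightarrow> df (x, Y')) (at 0)"
      by (intro Lim_transform_eventually[OF tendsto_const]) (simp add: eventually_at_filter)
  qed (use x Y Yx z in auto)
  ultimately show ?thesis
    unfolding has_dir_deriv_def using lim by simp
qed

text \<open>The two second order terms \<open>ddf ((x, Y x), (X x, 0))\<close> and \<open>ddf ((x, X x), (Y x, 0))\<close> agree by symmetry
  and cancel; what remains is \<open>df\<close> applied to the bracket \<open>Y' - X'\<close>.\<close>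

lemma derivative_of_bracket:
  assumes f: "C1_on V U W f df" and df: "C1_on (V \<times> V) (U \<times> V) W df ddf"
    and x: "x \<in> U"
    and T: "openin (top_of_set V) T" "x \<in> T" "\<And>y. y \<in> T \<Longrightarrow> X y \<in> V" "\<And>y. y \<in> T \<Longrightarrow> Y y \<in> V"
    and Y: "has_dir_deriv Y x (X x) Y'" "Y' \<in> V"
    and X: "has_dir_deriv X x (Y x) X'" "X' \<in> V"
    and a: "has_dir_deriv (\<lambda>y. df (y, Y y)) x (X x) a"
    and b: "has_dir_deriv (\<lambda>y. df (y, X y)) x (Y x) b"
  shows "df (x, Y' - X') = a - b"
proof -
  note sub = C1_onD(1)[OF f]
  have XY: "X x \<in> V" "Y x \<in> V" using T by auto
  have "a = ddf ((x, Y x), (X x, 0)) + df (x, Y')"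
    by (rule has_dir_deriv_unique[OF a derivative_along_field[OF f df x XY(1) T(1,2,4) Y]])
  moreover have "b = ddf ((x, X x), (Y x, 0)) + df (x, X')"
    by (rule has_dir_deriv_unique[OF b derivative_along_field[OF f df x XY(2) T(1,2,3) X]])
  moreover have "df (x, Y' + (-1) *\<^sub>R X') = df (x, Y') + (-1) *\<^sub>R df (x, X')"
    using C1_on_add_right[OF f x Y(2) subspace_scale[OF sub X(2), of "-1"]] C1_on_scale_right[OF f x X(2), of "-1"]
    by simp
  ultimately show ?thesis
    using second_derivative_symmetric[OF f df x XY] by simp
qed

section \<open>Smooth maps\<close>

text \<open>In the definition of smoothness the directions form a sequence, and \<open>d 1 x h\<close> depends on \<open>h 0\<close> only
  because it is a limit of quotients that do. Linearity of \<open>d 1\<close> in the direction gives the derivative of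
  \<open>(x, h) \<mapsto> d 1 x h\<close> in direction \<open>(k, l)\<close> as \<open>d 2 x (h, k) + d 1 x l\<close>.\<close>

lemma smooth_on_C2:
  fixes V :: "'v::locally_convex_space set" and f :: "'v \<Rightarrow> 'w::locally_convex_space"
  assumes sm: "smooth_on V U W f" and V: "subspace V" and W: "subspace W"
  shows "C2_on V U W f"
proof -
  from sm obtain d where U: "openin (top_of_set V) U"
    and d: "\<forall>x\<in>U. \<forall>h. range h \<subseteq> V \<longrightarrow> d 0 x h = f x"
      "\<forall>j. \<forall>x\<in>U. \<forall>h. range h \<subseteq> V \<longrightarrow>
        ((\<lambda>t::real. (d j (x + t *\<^sub>R h j) h - d j x h) /\<^sub>R t) \<longlongrightarrow> d (Suc j) x h) (at 0)"
      "\<forall>j. \<forall>x\<in>U. \<forall>h. range h \<subseteq> V \<longrightarrow> d j x h \<in> W"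
      "\<forall>j. continuous_on (U \<times> {h. range h \<subseteq> V}) (\<lambda>(x, h). d j x h)"
    unfolding smooth_on_def by (elim conjE exE) (rule that)
  have d0: "d 0 x h = f x" and dW: "d j x h \<in> W"
    and dS: "((\<lambda>t::real. (d j (x + t *\<^sub>R h j) h - d j x h) /\<^sub>R t) \<longlongrightarrow> d (Suc j) x h) (at 0)"
    if "x \<in> U" "range h \<subseteq> V" for j x h
    using d(1-3)[rule_format, OF that] by simp_all
  note dc = d(4)[rule_format]
  have UV: "U \<subseteq> V" using U by (rule openin_imp_subset)
  have V0: "0 \<in> V" using V by (rule subspace_0)
  have line: "eventually (\<lambda>t::real. x + t *\<^sub>R h \<in> U \<and> t \<noteq> 0) (at 0)" if "x \<in> U" "h \<in> V" for x h
    using eventually_line[OF V U that] by (simp add: eventually_at_filter)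
  have cont: "continuous_on S (\<lambda>z. d j (p z) (q z))"
    if p: "continuous_on S p" and q: "\<And>i. continuous_on S (\<lambda>z. q z i)"
      and m: "\<And>z. z \<in> S \<Longrightarrow> p z \<in> U" "\<And>z i. z \<in> S \<Longrightarrow> q z i \<in> V"
    for S :: "'x::topological_space set" and p q j
  proof -
    have "continuous_on S (\<lambda>z. (p z, q z))"
      by (intro continuous_on_Pair p continuous_on_coordinatewise_then_product q)
    from continuous_on_compose2[OF dc this] show ?thesis
      using m by fastforce
  qed
  have lim1: "((\<lambda>t. (f (x + t *\<^sub>R h 0) - f x) /\<^sub>R t) \<longlongrightarrow> d 1 x h) (at 0)"
    if x: "x \<in> U" and h: "range h \<subseteq> V" for x h
  proof -
    have h0: "h 0 \<in> V" using h by auto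
    have "eventually (\<lambda>t. (d 0 (x + t *\<^sub>R h 0) h - d 0 x h) /\<^sub>R t = (f (x + t *\<^sub>R h 0) - f x) /\<^sub>R t) (at 0)"
      using line[OF x h0] by eventually_elim (use d0 x h in simp)
    from Lim_transform_eventually[OF dS[OF x h] this] show ?thesis by simp
  qed
  have d1: "d 1 x h = d 1 x h'" if x: "x \<in> U" and h: "range h \<subseteq> V" "range h' \<subseteq> V" "h 0 = h' 0" for x h h'
    using tendsto_unique[OF at0_nontrivial lim1[OF x h(1)]] lim1[OF x h(2)] h(3) by simp
  define df where "df = (\<lambda>z. d 1 (fst z) (\<lambda>_. snd z))"
  define sq where "sq = (\<lambda>h k (i::nat). if i = 0 then h else k :: 'v)"
  have sq: "range (sq h k) \<subseteq> V" "sq h k 0 = h" "sq h k (Suc 0) = k" if "h \<in> V" "k \<in> V" for h k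
    using that by (auto simp: sq_def)
  define ddf where "ddf = (\<lambda>w. d 2 (fst (fst w)) (sq (snd (fst w)) (fst (snd w)))
      + df (fst (fst w), snd (snd w)))"
  have C: "C1_on V U W f df"
    unfolding C1_on_def has_dir_deriv_def
  proof (intro conjI ballI V W U)
    fix x h assume xh: "x \<in> U" "h \<in> V"
    show "((\<lambda>t. (f (x + t *\<^sub>R h) - f x) /\<^sub>R t) \<longlongrightarrow> df (x, h)) (at 0)"
      using lim1[OF xh(1), of "\<lambda>_. h"] xh(2) by (auto simp: df_def)
    show "df (x, h) \<in> W"
      unfolding df_def using xh by (auto intro!: dW)
  next
    fix x assume x: "x \<in> U"
    show "f x \<in> W"
      using dW[OF x, of "\<lambda>_. 0" 0] d0[OF x, of "\<lambda>_. 0"] V0 by auto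
  next
    have "continuous_on U (\<lambda>x. d 0 x (\<lambda>_. 0))"
      by (intro cont continuous_intros) (use V0 in auto)
    then show "continuous_on U f"
      by (rule continuous_on_eq) (use d0 V0 in auto)
    show "continuous_on (U \<times> V) df"
      unfolding df_def by (intro cont continuous_intros) auto
  qed
  have CC: "C1_on (V \<times> V) (U \<times> V) W df ddf"
    unfolding C1_on_def has_dir_deriv_def
  proof (intro conjI ballI subspace_Times openin_Times V W U)
    fix x assume "x \<in> U \<times> V"
    then show "df x \<in> W"
      using C1_onD(6)[OF C] by auto
  next
    fix z w assume "z \<in> U \<times> V" "w \<in> V \<times> V"
    then obtain x h k l where z: "z = (x, h)" "x \<in> U" "h \<in> V" and w: "w = (k, l)" "k \<in> V" "l \<in> V"
      by auto
    show "ddf (z, w) \<in> W"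
      unfolding ddf_def z w
      using sq(1)[OF z(3) w(2)] z w C1_onD(6)[OF C] by (auto intro!: subspace_add[OF W] dW)
    have "((\<lambda>t. (d 1 (x + t *\<^sub>R k) (sq h k) - d 1 x (sq h k)) /\<^sub>R t) \<longlongrightarrow> d 2 x (sq h k)) (at 0)"
      using dS[OF z(2) sq(1)[OF z(3) w(2)], of 1] sq(3)[OF z(3) w(2)] by (simp add: numeral_2_eq_2)
    moreover
    have "((\<lambda>t. df (x + t *\<^sub>R k, l)) \<longlongrightarrow> df (x, l)) (at 0)"
    proof (rule tendsto_continuous_on[OF C1_onD(9)[OF C], of "(x, l)" "\<lambda>t. (x + t *\<^sub>R k, l)"])
      show "((\<lambda>t. (x + t *\<^sub>R k, l)) \<longlongrightarrow> (x, l)) (at 0)"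
        by (intro tendsto_Pair tendsto_line tendsto_const)
      show "eventually (\<lambda>t::real. (x + t *\<^sub>R k, l) \<in> U \<times> V) (at 0)"
        using line[OF z(2) w(2)] by eventually_elim (use w in auto)
    qed (use z w in auto)
    ultimately have "((\<lambda>t. (d 1 (x + t *\<^sub>R k) (sq h k) - d 1 x (sq h k)) /\<^sub>R t + df (x + t *\<^sub>R k, l)) \<longlongrightarrow>
        d 2 x (sq h k) + df (x, l)) (at 0)"
      by (rule tendsto_add)
    moreover have "eventually (\<lambda>t. (d 1 (x + t *\<^sub>R k) (sq h k) - d 1 x (sq h k)) /\<^sub>R t + df (x + t *\<^sub>R k, l)
        = (df ((x, h) + t *\<^sub>R (k, l)) - df (x, h)) /\<^sub>R t) (at 0)"
      using line[OF z(2) w(2)]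
    proof eventually_elim
      case (elim t)
      have *: "d 1 y (sq h k) = df (y, h)" if "y \<in> U" for y
        unfolding df_def using d1[OF that sq(1)[OF z(3) w(2)], of "\<lambda>_. h"] sq(2)[OF z(3) w(2)] z(3) by auto
      have "df (x + t *\<^sub>R k, h + t *\<^sub>R l) = df (x + t *\<^sub>R k, h) + t *\<^sub>R df (x + t *\<^sub>R k, l)"
        using C1_on_add_right[OF C _ z(3) subspace_scale[OF V w(3)]] C1_on_scale_right[OF C _ w(3)] elim by simp
      then show ?case
        using elim * z by (simp add: scaleR_diff_right scaleR_add_right)
    qed
    ultimately have "((\<lambda>t. (df ((x, h) + t *\<^sub>R (k, l)) - df (x, h)) /\<^sub>R t) \<longlongrightarrow> d 2 x (sq h k) + df (x, l)) (at 0)"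
      by (rule Lim_transform_eventually)
    then show "((\<lambda>t. (df (z + t *\<^sub>R w) - df z) /\<^sub>R t) \<longlongrightarrow> ddf (z, w)) (at 0)"
      unfolding ddf_def z w by simp
  next
    show "continuous_on (U \<times> V) df" by (rule C1_onD(9)[OF C])
    have "continuous_on ((U \<times> V) \<times> V \<times> V) (\<lambda>w. d 2 (fst (fst w)) (sq (snd (fst w)) (fst (snd w))))"
    proof (rule cont)
      show "continuous_on ((U \<times> V) \<times> V \<times> V) (\<lambda>w. sq (snd (fst w)) (fst (snd w)) i)" for i
        unfolding sq_def by (cases "i = 0") (auto intro!: continuous_intros)
    qed (auto intro!: continuous_intros simp: sq_def)
    moreover have "continuous_on ((U \<times> V) \<times> V \<times> V) (\<lambda>w. df (fst (fst w), snd (snd w)))"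
      by (rule continuous_on_compose2[OF C1_onD(9)[OF C]]) (auto intro!: continuous_intros)
    ultimately show "continuous_on ((U \<times> V) \<times> V \<times> V) ddf"
      unfolding ddf_def by (rule continuous_on_add)
  qed simp
  from C CC show ?thesis
    unfolding C2_on_def by blast
qed

section \<open>Local coordinates\<close>

text \<open>By the chain rule, the derivatives of mutually inverse maps are mutually inverse.\<close>

lemma local_inverse_derivative_bij:
  assumes f: "C1_on V D W f df" and g: "C1_on W D' V g dg"
    and fD: "\<And>y. y \<in> D \<Longrightarrow> f y \<in> D'" and gf: "\<And>y. y \<in> D \<Longrightarrow> g (f y) = y"
    and gD: "\<And>z. z \<in> D' \<Longrightarrow> g z \<in> D" and fg: "\<And>z. z \<in> D' \<Longrightarrow> f (g z) = z"
    and x: "x \<in> D"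
  shows "bij_betw (\<lambda>h. df (x, h)) V W"
proof (rule bij_betw_byWitness)
  have id: "has_dir_deriv (\<lambda>y. y) y h h" for y h :: "'x::locally_convex_space"
    unfolding has_dir_deriv_def
    by (rule Lim_transform_eventually[OF tendsto_const]) (simp add: eventually_at_filter)
  note fx = fD[OF x]
  show "\<forall>h\<in>V. dg (f x, df (x, h)) = h"
  proof
    fix h assume h: "h \<in> V"
    have "has_dir_deriv (\<lambda>y. g (f y)) x h (dg (f (fst (x, h)), df (x, h)))"
      by (rule C1_on_has_dir_deriv[OF C1_on_compose[OF f g fD] x h])
    moreover have "has_dir_deriv (\<lambda>y. g (f y)) x h h"
      by (rule has_dir_deriv_cong[OF id C1_onD(1)[OF f] C1_onD(3)[OF f] x h]) (simp add: gf)
    ultimately show "dg (f x, df (x, h)) = h"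
      using has_dir_deriv_unique by fastforce
  qed
  show "\<forall>k\<in>W. df (x, dg (f x, k)) = k"
  proof
    fix k assume k: "k \<in> W"
    have "has_dir_deriv (\<lambda>y. f (g y)) (f x) k (df (g (fst (f x, k)), dg (f x, k)))"
      by (rule C1_on_has_dir_deriv[OF C1_on_compose[OF g f gD] fx k])
    moreover have "has_dir_deriv (\<lambda>y. f (g y)) (f x) k k"
      by (rule has_dir_deriv_cong[OF id C1_onD(1)[OF g] C1_onD(3)[OF g] fx k]) (simp add: fg)
    ultimately have "df (g (fst (f x, k)), dg (f x, k)) = k"
      by (rule has_dir_deriv_unique)
    then show "df (x, dg (f x, k)) = k"
      by (simp add: gf x)
  qed
qed (use C1_onD(6)[OF f x] C1_onD(6)[OF g fD[OF x]] in auto)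

lemma openin_preimage_within:
  assumes "continuous_on U f" "openin (top_of_set V) U" "\<And>x. x \<in> U \<Longrightarrow> f x \<in> W" "openin (top_of_set W) T"
  shows "openin (top_of_set V) (U \<inter> f -` T)"
proof -
  have "openin (top_of_set U) (U \<inter> f -` T)"
    by (rule continuous_openin_preimage[OF assms(1) _ assms(4)]) (use assms(3) in auto)
  then show ?thesis
    using assms(2) by (rule openin_trans)
qed

lemma inv_into_map_prod:
  assumes "inj_on f A" "inj_on g B" "x \<in> f ` A" "y \<in> g ` B"
  shows "inv_into (A \<times> B) (map_prod f g) (x, y) = (inv_into A f x, inv_into B g y)"
proof (rule inv_into_f_eq)
  show "inj_on (map_prod f g) (A \<times> B)"
    using assms by (rule_tac map_prod_inj_on)
qed (use assms in \<open>auto simp: inv_into_into f_inv_into_f\<close>)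

lemma smooth_map_chart:
  assumes "smooth_map M N f" "(U, \<phi>) \<in> charts M" "(U', \<psi>) \<in> charts N"
  shows "smooth_on (mspace M) (\<phi> ` (U \<inter> f -` U')) (mspace N) (\<psi> \<circ> f \<circ> inv_into U \<phi>)"
proof -
  from assms(1) have "\<forall>(U, \<phi>)\<in>charts M. \<forall>(U', \<psi>)\<in>charts N.
      smooth_on (mspace M) (\<phi> ` (U \<inter> f -` U')) (mspace N) (\<psi> \<circ> f \<circ> inv_into U \<phi>)"
    unfolding smooth_map_def by (rule conjunct2)
  from bspec[OF this assms(2)] show ?thesis
    unfolding prod.case by (drule_tac bspec[OF _ assms(3)]) simp
qed

section \<open>Lie groups in charts\<close>

text \<open>All computations at the identity use the chart \<open>c0\<close> that the definition of the tangent map selects,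
  so that left invariant fields are directional derivatives in this chart by definition. Its inverse is
  \<open>\<psi>0\<close>, and \<open>x0\<close> is the coordinate of the identity.\<close>

locale lie_group_chart =
  fixes H :: "('g, 'm) monoid_scheme" and N :: "('g, 'v::locally_convex_space) manifold"
  assumes lie_group: "lie_group H N"
begin

definition c0 where "c0 = (SOME c. c \<in> charts_at N \<one>\<^bsub>H\<^esub>)"
definition U0 where "U0 = fst c0"
definition \<phi>0 where "\<phi>0 = snd c0"
definition \<psi>0 where "\<psi>0 = inv_into U0 \<phi>0"
definition x0 where "x0 = \<phi>0 \<one>\<^bsub>H\<^esub>"

abbreviation "V \<equiv> mspace N"
abbreviation "charts1 \<equiv> charts_at N \<one>\<^bsub>H\<^esub>"
abbreviation "tangent1 \<equiv> tangent_space N \<one>\<^bsub>H\<^esub>"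

lemma group: "Group.group H"
  and manifold: "smooth_manifold N"
  and space: "topspace (mtop N) = carrier H"
  and smooth_mult: "smooth_map (prod_manifold N N) N (\<lambda>(g, h). g \<otimes>\<^bsub>H\<^esub> h)"
  using lie_group unfolding lie_group_def by blast+

lemma one_closed: "\<one>\<^bsub>H\<^esub> \<in> carrier H"
  using group by (simp add: group.is_monoid)

lemma subspace_V: "subspace V"
  using manifold unfolding smooth_manifold_def by blast

lemma chart_simps:
  assumes "c \<in> charts N"
  shows "openin (mtop N) (fst c)" "openin (top_of_set V) (snd c ` fst c)" "inj_on (snd c) (fst c)"
    "fst c \<subseteq> carrier H"
proof -
  have *: "openin (mtop N) (fst c) \<and> openin (top_of_set V) (snd c ` fst c) \<and>
      homeomorphic_map (subtopology (mtop N) (fst c)) (top_of_set (snd c ` fst c)) (snd c)"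
    using manifold assms unfolding smooth_manifold_def by (auto simp: case_prod_unfold)
  then show sub: "fst c \<subseteq> carrier H"
    using openin_subset space by blast
  show "openin (mtop N) (fst c)" "openin (top_of_set V) (snd c ` fst c)"
    using * by blast+
  have "inj_on (snd c) (topspace (subtopology (mtop N) (fst c)))"
    using * homeomorphic_imp_injective_map by blast
  moreover have "topspace (subtopology (mtop N) (fst c)) = fst c"
    using sub space by auto
  ultimately show "inj_on (snd c) (fst c)"
    by simp
qed

lemma charts_atD:
  assumes "c \<in> charts_at N g"
  shows "c \<in> charts N" "g \<in> fst c"
  using assms by (auto simp: charts_at_def)

lemma c0_in_charts: "c0 \<in> charts1"
proof -
  have "\<one>\<^bsub>H\<^esub> \<in> (\<Union>(U, \<phi>)\<in>charts N. U)"
    using manifold one_closed space unfolding smooth_manifold_def by blast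
  then have "\<exists>c. c \<in> charts1"
    unfolding charts_at_def by auto
  then show ?thesis
    unfolding c0_def by (rule someI_ex)
qed

lemma U0_chart: "openin (top_of_set V) (\<phi>0 ` U0)" "inj_on \<phi>0 U0" "U0 \<subseteq> carrier H" "\<one>\<^bsub>H\<^esub> \<in> U0"
  using chart_simps[OF charts_atD(1)[OF c0_in_charts]] charts_atD(2)[OF c0_in_charts] unfolding U0_def \<phi>0_def by auto

lemma x0_simps: "x0 \<in> \<phi>0 ` U0" "x0 \<in> V" "\<psi>0 x0 = \<one>\<^bsub>H\<^esub>"
  using U0_chart(4) openin_imp_subset[OF U0_chart(1)] U0_chart(2) unfolding x0_def \<psi>0_def by auto

lemma \<psi>0_inverse: "y \<in> \<phi>0 ` U0 \<Longrightarrow> \<psi>0 y \<in> U0" "y \<in> \<phi>0 ` U0 \<Longrightarrow> \<phi>0 (\<psi>0 y) = y" "g \<in> U0 \<Longrightarrow> \<psi>0 (\<phi>0 g) = g"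
  "y \<in> \<phi>0 ` U0 \<Longrightarrow> \<psi>0 y \<in> carrier H"
  unfolding \<psi>0_def using U0_chart by (auto simp: inv_into_into f_inv_into_f)

lemma chart_change:
  assumes "c \<in> charts N" "c' \<in> charts N"
  shows "C2_on V (snd c ` (fst c \<inter> fst c')) V (snd c' \<circ> inv_into (fst c) (snd c))"
proof (rule smooth_on_C2[OF _ subspace_V subspace_V])
  show "smooth_on V (snd c ` (fst c \<inter> fst c')) V (snd c' \<circ> inv_into (fst c) (snd c))"
    using manifold assms unfolding smooth_manifold_def by (auto simp: case_prod_unfold)
qed

subsection \<open>The tangent space at the identity\<close>

lemma tangentD:
  assumes "\<xi> \<in> tangent1"
  shows "c \<in> charts1 \<Longrightarrow> \<xi> c \<in> V" "\<xi> c0 \<in> V"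
    "c \<in> charts1 \<Longrightarrow> \<xi> c = dir_deriv (snd c \<circ> \<psi>0) x0 (\<xi> c0)"
    "c \<notin> charts1 \<Longrightarrow> \<xi> c = 0"
  using assms c0_in_charts unfolding tangent_space_def \<psi>0_def x0_def U0_def \<phi>0_def by blast+

lemma tangent_eqI:
  assumes "\<xi> \<in> tangent1" "\<eta> \<in> tangent1" "\<xi> c0 = \<eta> c0"
  shows "\<xi> = \<eta>"
proof
  fix c
  show "\<xi> c = \<eta> c"
    using tangentD(3,4)[OF assms(1), of c] tangentD(3,4)[OF assms(2), of c] assms(3)
    by (cases "c \<in> charts1") auto
qed

text \<open>The velocity of \<open>z\<close> at \<open>e\<close> in direction \<open>v\<close>, read off in every chart, is a tangent vector: compatibility
  is the chain rule for a change of charts. It is used with \<open>z = \<psi>0\<close>, to see that every vector of the model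
  space occurs, and with a homomorphism composed with a chart.\<close>

lemma tangent_of_C1:
  fixes z :: "'x::locally_convex_space \<Rightarrow> 'g"
  assumes E: "subspace E" "v \<in> E"
    and z: "z e = \<one>\<^bsub>H\<^esub>"
    and d: "\<And>c. c \<in> charts1 \<Longrightarrow>
      \<exists>T d. openin (top_of_set E) T \<and> e \<in> T \<and> z ` T \<subseteq> fst c \<and> C1_on E T V (\<lambda>y. snd c (z y)) d"
    and \<xi>: "\<xi> = (\<lambda>c. if c \<in> charts1 then dir_deriv (\<lambda>y. snd c (z y)) e v else 0)"
  shows "\<xi> \<in> tangent1"
  unfolding tangent_space_def
proof (intro CollectI conjI ballI allI impI)
  fix c assume c: "c \<in> charts1"
  obtain T d where T: "openin (top_of_set E) T" "e \<in> T" "z ` T \<subseteq> fst c" and d: "C1_on E T V (\<lambda>y. snd c (z y)) d"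
    using d[OF c] by blast
  have \<xi>c: "\<xi> c = d (e, v)"
    unfolding \<xi> using c C1_on_dir_deriv[OF d T(2) E(2)] by simp
  then show "\<xi> c \<in> V"
    using C1_onD(6)[OF d T(2) E(2)] by simp
  fix c' assume c': "c' \<in> charts1"
  let ?\<tau> = "snd c' \<circ> inv_into (fst c) (snd c)"
  obtain T' d' where T': "openin (top_of_set E) T'" "e \<in> T'" "z ` T' \<subseteq> fst c'" and d': "C1_on E T' V (\<lambda>y. snd c' (z y)) d'"
    using assms(4)[OF c'] by blast
  obtain dt ddt where dt: "C1_on V (snd c ` (fst c \<inter> fst c')) V ?\<tau> dt"
    using chart_change[of c c'] charts_atD c c' unfolding C2_on_def by blast
  have in1: "snd c \<one>\<^bsub>H\<^esub> \<in> snd c ` (fst c \<inter> fst c')"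
    using c c' by (auto dest: charts_atD)
  have "has_dir_deriv (\<lambda>y. ?\<tau> (snd c (z y))) e v (dt (snd c (z e), d (e, v)))"
  proof (rule has_dir_deriv_chain[OF C1_on_has_dir_deriv[OF d T(2) E(2)] dt])
    show "eventually (\<lambda>t::real. snd c (z (e + t *\<^sub>R v)) \<in> V) (at 0)"
      using eventually_line[OF E(1) T(1,2) E(2)] by eventually_elim (rule C1_onD(5)[OF d])
  qed (use in1 z C1_onD(6)[OF d T(2) E(2)] in auto)
  then have "has_dir_deriv (\<lambda>y. snd c' (z y)) e v (dt (snd c (z e), d (e, v)))"
    by (rule has_dir_deriv_cong[OF _ E(1) openin_Int[OF T(1) T'(1)]])
       (use E T T' chart_simps(3)[OF charts_atD(1)[OF c]] in auto)
  then have "dir_deriv (\<lambda>y. snd c' (z y)) e v = dt (snd c (z e), d (e, v))"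
    by (rule has_dir_deriv_dir_deriv)
  moreover have "dir_deriv ?\<tau> (snd c \<one>\<^bsub>H\<^esub>) (\<xi> c) = dt (snd c (z e), d (e, v))"
    unfolding \<xi>c using C1_on_dir_deriv[OF dt in1 C1_onD(6)[OF d T(2) E(2)]] z by simp
  ultimately show "\<xi> c' = dir_deriv ?\<tau> (snd c \<one>\<^bsub>H\<^esub>) (\<xi> c)"
    using c' unfolding \<xi> by simp
qed (simp add: \<xi>)

lemma chart_of_\<psi>0:
  assumes c: "c \<in> charts1"
  shows "openin (top_of_set V) (\<phi>0 ` (U0 \<inter> fst c))" "x0 \<in> \<phi>0 ` (U0 \<inter> fst c)"
    "\<psi>0 ` \<phi>0 ` (U0 \<inter> fst c) \<subseteq> fst c" "C2_on V (\<phi>0 ` (U0 \<inter> fst c)) V (\<lambda>y. snd c (\<psi>0 y))"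
proof -
  show C: "C2_on V (\<phi>0 ` (U0 \<inter> fst c)) V (\<lambda>y. snd c (\<psi>0 y))"
    using chart_change[of "c0" c] charts_atD c c0_in_charts unfolding \<psi>0_def U0_def \<phi>0_def comp_def by blast
  show "openin (top_of_set V) (\<phi>0 ` (U0 \<inter> fst c))"
    using C2_onD(3)[OF C] .
  show "x0 \<in> \<phi>0 ` (U0 \<inter> fst c)" "\<psi>0 ` \<phi>0 ` (U0 \<inter> fst c) \<subseteq> fst c"
    using \<psi>0_inverse(3) U0_chart(4) charts_atD(2)[OF c] by (auto simp: x0_def)
qed

lemma tangent_exists:
  assumes v: "v \<in> V"
  shows "\<exists>\<xi>\<in>tangent1. \<xi> c0 = v"
proof -
  define \<xi> where "\<xi> = (\<lambda>c. if c \<in> charts1 then dir_deriv (\<lambda>y. snd c (\<psi>0 y)) x0 v else 0)"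
  have "\<xi> \<in> tangent1"
  proof (rule tangent_of_C1[OF subspace_V v x0_simps(3) _ \<xi>_def])
    fix c assume c: "c \<in> charts1"
    show "\<exists>T d. openin (top_of_set V) T \<and> x0 \<in> T \<and> \<psi>0 ` T \<subseteq> fst c \<and> C1_on V T V (\<lambda>y. snd c (\<psi>0 y)) d"
      using chart_of_\<psi>0[OF c] unfolding C2_on_def by blast
  qed
  moreover have "\<xi> c0 = v"
  proof -
    have "has_dir_deriv (\<lambda>y. y) x0 v v"
      unfolding has_dir_deriv_def
      by (rule Lim_transform_eventually[OF tendsto_const]) (simp add: eventually_at_filter)
    then have "has_dir_deriv (\<lambda>y. snd c0 (\<psi>0 y)) x0 v v"
      by (rule has_dir_deriv_cong[OF _ subspace_V U0_chart(1) x0_simps(1) v]) (simp add: \<psi>0_inverse(2) flip: \<phi>0_def)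
    then show ?thesis
      unfolding \<xi>_def using c0_in_charts has_dir_deriv_dir_deriv by auto
  qed
  ultimately show ?thesis by blast
qed

subsection \<open>Left invariant vector fields and the bracket\<close>

text \<open>The left invariant field with value \<open>v\<close> at the identity, in the coordinates of the chart \<open>c\<close>.\<close>

definition left_field where
  "left_field v c y = dir_deriv (\<lambda>z. snd c (inv_into (fst c) (snd c) y \<otimes>\<^bsub>H\<^esub> \<psi>0 z)) x0 v"

text \<open>Two charts occur because a left invariant field differentiates in the second factor, always in the
  chart \<open>c0\<close>, while its base point varies in an arbitrary chart \<open>c\<close>.\<close>

definition mult_chart where
  "mult_chart c z = snd c (inv_into (fst c) (snd c) (fst z) \<otimes>\<^bsub>H\<^esub> \<psi>0 (snd z))"

definition mult_dom where
  "mult_dom c = {z. fst z \<in> snd c ` fst c \<and> snd z \<in> \<phi>0 ` U0 \<and>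
    inv_into (fst c) (snd c) (fst z) \<otimes>\<^bsub>H\<^esub> \<psi>0 (snd z) \<in> fst c}"

lemma mult_chart_C2:
  assumes "c \<in> charts N"
  shows "C2_on (V \<times> V) (mult_dom c) V (mult_chart c)"
proof -
  obtain U \<phi> where c: "c = (U, \<phi>)" by (cases c)
  let ?m = "\<lambda>(g, h). g \<otimes>\<^bsub>H\<^esub> h"
  note inj = chart_simps(3)[OF assms, unfolded c, simplified]
  have cp: "(U \<times> U0, map_prod \<phi> \<phi>0) \<in> charts (prod_manifold N N)"
  proof -
    have "(U0, \<phi>0) \<in> charts N"
      using charts_atD(1)[OF c0_in_charts] by (simp add: U0_def \<phi>0_def)
    with assms show ?thesis
      unfolding prod_manifold_def c by auto
  qed
  have "smooth_on (mspace (prod_manifold N N)) (map_prod \<phi> \<phi>0 ` (U \<times> U0 \<inter> ?m -` U)) (mspace N)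
      (\<phi> \<circ> ?m \<circ> inv_into (U \<times> U0) (map_prod \<phi> \<phi>0))"
    by (rule smooth_map_chart[OF smooth_mult cp]) (use assms c in simp)
  then have C: "C2_on (V \<times> V) (map_prod \<phi> \<phi>0 ` (U \<times> U0 \<inter> ?m -` U)) V
      (\<phi> \<circ> ?m \<circ> inv_into (U \<times> U0) (map_prod \<phi> \<phi>0))"
    by (intro smooth_on_C2 subspace_Times subspace_V) (simp add: prod_manifold_def)
  have dom: "map_prod \<phi> \<phi>0 ` (U \<times> U0 \<inter> ?m -` U) = mult_dom c"
  proof (intro equalityI subsetI)
    fix z assume "z \<in> map_prod \<phi> \<phi>0 ` (U \<times> U0 \<inter> ?m -` U)"
    then show "z \<in> mult_dom c"
      using inj U0_chart(2) \<psi>0_inverse(3) unfolding mult_dom_def c by auto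
  next
    fix z assume z: "z \<in> mult_dom c"
    then have "z = map_prod \<phi> \<phi>0 (inv_into U \<phi> (fst z), \<psi>0 (snd z))"
      using \<psi>0_inverse(2) unfolding mult_dom_def c by (auto simp: f_inv_into_f prod_eq_iff)
    moreover have "(inv_into U \<phi> (fst z), \<psi>0 (snd z)) \<in> U \<times> U0 \<inter> ?m -` U"
      using z \<psi>0_inverse(1) unfolding mult_dom_def c by (auto simp: inv_into_into)
    ultimately show "z \<in> map_prod \<phi> \<phi>0 ` (U \<times> U0 \<inter> ?m -` U)"
      by (rule image_eqI)
  qed
  show ?thesis
  proof (rule C2_on_cong[OF C[unfolded dom]])
    fix z assume "z \<in> mult_dom c"
    then have "inv_into (U \<times> U0) (map_prod \<phi> \<phi>0) (fst z, snd z) = (inv_into U \<phi> (fst z), \<psi>0 (snd z))"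
      unfolding \<psi>0_def by (intro inv_into_map_prod inj U0_chart(2)) (auto simp: mult_dom_def c)
    then show "mult_chart c z = (\<phi> \<circ> ?m \<circ> inv_into (U \<times> U0) (map_prod \<phi> \<phi>0)) z"
      by (simp add: mult_chart_def c)
  qed
qed

lemma mult_dom_one:
  assumes "c \<in> charts1"
  shows "(snd c \<one>\<^bsub>H\<^esub>, x0) \<in> mult_dom c"
  using charts_atD[OF assms] chart_simps(3)[OF charts_atD(1)[OF assms]] x0_simps group one_closed
  unfolding mult_dom_def by (auto simp: group.is_monoid)

lemma mult_chart_one:
  assumes "c \<in> charts N" "(y, x0) \<in> mult_dom c"
  shows "mult_chart c (y, x0) = y"
proof -
  have "inv_into (fst c) (snd c) y \<in> carrier H"
    using chart_simps(4)[OF assms(1)] assms(2) by (auto simp: mult_dom_def inv_into_into subset_iff)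
  then show ?thesis
    using assms group by (auto simp: mult_chart_def x0_simps(3) group.is_monoid mult_dom_def f_inv_into_f)
qed

lemma left_field_eq:
  assumes m: "C1_on (V \<times> V) (mult_dom c) V (mult_chart c) dm" and y: "(y, x0) \<in> mult_dom c" and v: "v \<in> V"
  shows "has_dir_deriv (\<lambda>z. mult_chart c (y, z)) x0 v (dm ((y, x0), (0, v)))"
    "left_field v c y = dm ((y, x0), (0, v))"
proof -
  have "has_dir_deriv (mult_chart c) (y, x0) (0, v) (dm ((y, x0), (0, v)))"
    by (rule C1_on_has_dir_deriv[OF m y]) (use v subspace_0[OF subspace_V] in auto)
  then show *: "has_dir_deriv (\<lambda>z. mult_chart c (y, z)) x0 v (dm ((y, x0), (0, v)))"
    unfolding has_dir_deriv_def by simp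
  show "left_field v c y = dm ((y, x0), (0, v))"
    using has_dir_deriv_dir_deriv[OF *] by (simp add: left_field_def mult_chart_def)
qed

text \<open>The left invariant field is a partial derivative \<open>dm ((y, x0), (0, v))\<close> of the multiplication, which is
  \<open>C\<^sup>2\<close>.\<close>

lemma left_field_C1:
  assumes c: "c \<in> charts1" and v: "v \<in> V"
  shows "\<exists>T dl. snd c \<one>\<^bsub>H\<^esub> \<in> T \<and> T \<subseteq> snd c ` fst c \<and> C1_on V T V (left_field v c) dl"
proof -
  obtain dm ddm where m: "C1_on (V \<times> V) (mult_dom c) V (mult_chart c) dm"
      "C1_on ((V \<times> V) \<times> (V \<times> V)) (mult_dom c \<times> (V \<times> V)) V dm ddm"
    using mult_chart_C2[OF charts_atD(1)[OF c]] unfolding C2_on_def by blast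
  have V0: "0 \<in> V" by (rule subspace_0[OF subspace_V])
  have "C1_on V V V (\<lambda>y. y) (\<lambda>z. snd z)"
    using subspace_V by (intro C1_on_linear) (auto intro: continuous_on_id)
  then have pair: "C1_on V V ((V \<times> V) \<times> (V \<times> V)) (\<lambda>y. ((y, x0), (0, v))) (\<lambda>z. ((snd z, 0), (0, 0)))"
    using V0 v x0_simps(2) subspace_V by (intro C1_on_Pair C1_on_const) auto
  define T where "T = V \<inter> (\<lambda>y. ((y, x0), (0::'v, v))) -` (mult_dom c \<times> (V \<times> V))"
  have T: "openin (top_of_set V) T"
    unfolding T_def
    by (rule openin_preimage_within[OF C1_onD(8)[OF pair] _ C1_onD(5)[OF pair] C1_onD(3)[OF m(2)]]) auto
  have "C1_on V T V (\<lambda>y. dm ((y, x0), (0, v))) (\<lambda>z. ddm (((fst z, x0), (0, v)), ((snd z, 0), (0, 0))))"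
    by (rule C1_on_compose[OF C1_on_subset[OF pair T] m(2)]) (auto simp: T_def)
  then have "C1_on V T V (left_field v c) (\<lambda>z. ddm (((fst z, x0), (0, v)), ((snd z, 0), (0, 0))))"
    by (rule C1_on_cong) (auto simp: T_def left_field_eq(2)[OF m(1) _ v])
  moreover have "snd c \<one>\<^bsub>H\<^esub> \<in> T"
    using mult_dom_one[OF c] chart_simps(2)[OF charts_atD(1)[OF c]] charts_atD(2)[OF c] V0 v
    by (auto simp: T_def dest: openin_imp_subset)
  moreover have "T \<subseteq> snd c ` fst c"
    by (auto simp: T_def mult_dom_def)
  ultimately show ?thesis by blast
qed

lemma left_field_one:
  assumes c: "c \<in> charts1" and \<xi>: "\<xi> \<in> tangent1"
  shows "left_field (\<xi> c0) c (snd c \<one>\<^bsub>H\<^esub>) = \<xi> c"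
proof -
  have "left_field (\<xi> c0) c (snd c \<one>\<^bsub>H\<^esub>) = dir_deriv (\<lambda>z. snd c (\<psi>0 z)) x0 (\<xi> c0)"
    unfolding left_field_def
    by (rule dir_deriv_cong[OF subspace_V U0_chart(1) x0_simps(1) tangentD(2)[OF \<xi>]])
       (use charts_atD[OF c] chart_simps(3)[OF charts_atD(1)[OF c]] \<psi>0_inverse(4) group in \<open>auto simp: group.is_monoid\<close>)
  then show ?thesis
    using tangentD(3)[OF \<xi> c] by (simp add: comp_def)
qed

lemma left_invariant_field_chart:
  assumes "c \<in> charts N" "y \<in> snd c ` fst c"
  shows "left_invariant_field H N \<xi> (inv_into (fst c) (snd c) y) c = left_field (\<xi> c0) c y"
proof -
  let ?g = "inv_into (fst c) (snd c) y"
  have "?g \<in> fst c" using assms(2) by (rule inv_into_into)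
  moreover have "?g \<otimes>\<^bsub>H\<^esub> \<one>\<^bsub>H\<^esub> = ?g"
    using \<open>?g \<in> fst c\<close> chart_simps(4)[OF assms(1)] group by (auto simp: group.is_monoid subset_iff)
  ultimately have "c \<in> charts_at N (?g \<otimes>\<^bsub>H\<^esub> \<one>\<^bsub>H\<^esub>)"
    using assms(1) by (simp add: charts_at_def)
  then show ?thesis
    unfolding left_invariant_field_def tangent_map_def left_field_def
    by (simp add: c0_def[symmetric] Let_def U0_def[symmetric] \<phi>0_def[symmetric] \<psi>0_def[symmetric] x0_def[symmetric] comp_def)
qed

abbreviation bracket where "bracket \<equiv> lbracket (Lie_algebra_of H N)"

lemma bracket_chart:
  assumes c: "c \<in> charts1" and \<xi>: "\<xi> \<in> tangent1" and \<eta>: "\<eta> \<in> tangent1"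
  shows "bracket \<xi> \<eta> c = dir_deriv (left_field (\<eta> c0) c) (snd c \<one>\<^bsub>H\<^esub>) (\<xi> c)
      - dir_deriv (left_field (\<xi> c0) c) (snd c \<one>\<^bsub>H\<^esub>) (\<eta> c)"
proof -
  note cc = charts_atD[OF c]
  have in1: "snd c \<one>\<^bsub>H\<^esub> \<in> snd c ` fst c" using cc by blast
  have one: "left_invariant_field H N \<zeta> \<one>\<^bsub>H\<^esub> c = \<zeta> c" if "\<zeta> \<in> tangent1" for \<zeta>
    using left_invariant_field_chart[OF cc(1) in1, of \<zeta>] left_field_one[OF c that] chart_simps(3)[OF cc(1)] cc(2) by simp
  have d: "dir_deriv (\<lambda>y. left_invariant_field H N \<zeta> (inv_into (fst c) (snd c) y) c) (snd c \<one>\<^bsub>H\<^esub>) v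
      = dir_deriv (left_field (\<zeta> c0) c) (snd c \<one>\<^bsub>H\<^esub>) v" if "v \<in> V" for \<zeta> v
    by (rule dir_deriv_cong[OF subspace_V chart_simps(2)[OF cc(1)] in1 that]) (rule left_invariant_field_chart[OF cc(1)])
  show ?thesis
    using c by (simp add: Lie_algebra_of_def vector_field_bracket_def one[OF \<xi>] one[OF \<eta>]
      d[OF tangentD(1)[OF \<xi> c]] d[OF tangentD(1)[OF \<eta> c]])
qed

lemma bracket_outside: "c \<notin> charts1 \<Longrightarrow> bracket \<xi> \<eta> c = 0"
  by (simp add: Lie_algebra_of_def vector_field_bracket_def)

lemma bracket_c0_in:
  assumes \<xi>: "\<xi> \<in> tangent1" and \<eta>: "\<eta> \<in> tangent1"
  shows "bracket \<xi> \<eta> c0 \<in> V"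
proof -
  have *: "dir_deriv (left_field (\<zeta> c0) c0) (snd c0 \<one>\<^bsub>H\<^esub>) v \<in> V"
    if \<zeta>: "\<zeta> \<in> tangent1" and v: "v \<in> V" for \<zeta> v
  proof -
    obtain T d where T: "snd c0 \<one>\<^bsub>H\<^esub> \<in> T" "C1_on V T V (left_field (\<zeta> c0) c0) d"
      using left_field_C1[OF c0_in_charts tangentD(2)[OF \<zeta>]] by blast
    show ?thesis
      using C1_on_dir_deriv[OF T(2,1) v] C1_onD(6)[OF T(2,1) v] by simp
  qed
  show ?thesis
    unfolding bracket_chart[OF c0_in_charts \<xi> \<eta>]
    by (intro subspace_diff[OF subspace_V] * \<xi> \<eta> tangentD(2))
qed

definition C2_near :: "'w::locally_convex_space set \<Rightarrow> ('g \<Rightarrow> 'w) \<Rightarrow> bool"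
  where "C2_near W F \<longleftrightarrow> (\<exists>T. x0 \<in> T \<and> T \<subseteq> \<phi>0 ` U0 \<and> C2_on V T W (\<lambda>y. F (\<psi>0 y)))"

text \<open>By left invariance, differentiating \<open>F\<close> along the field at \<open>g\<close> is differentiating
  \<open>h \<mapsto> F (g h)\<close> at the identity.\<close>

lemma derivative_along_left_field:
  assumes F: "C1_on V T W (\<lambda>y. F (\<psi>0 y)) df" and y: "y \<in> T" "(y, x0) \<in> mult_dom c0" and v: "v \<in> V"
  shows "has_dir_deriv (\<lambda>z. F (\<psi>0 y \<otimes>\<^bsub>H\<^esub> \<psi>0 z)) x0 v (df (y, left_field v c0 y))"
proof -
  have c0': "c0 \<in> charts N" using charts_atD[OF c0_in_charts] by blast
  obtain dm ddm where m: "C1_on (V \<times> V) (mult_dom c0) V (mult_chart c0) dm"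
    using mult_chart_C2[OF c0'] unfolding C2_on_def by blast
  note lf = left_field_eq[OF m y(2) v]
  have y0: "mult_chart c0 (y, x0) = y" by (rule mult_chart_one[OF c0' y(2)])
  define T' where "T' = V \<inter> (\<lambda>z. (y, z)) -` mult_dom c0"
  have yV: "y \<in> V" using C1_onD(4)[OF F] y by blast
  have T': "openin (top_of_set V) T'" "x0 \<in> T'"
    unfolding T'_def
    by (rule openin_preimage_within[OF _ _ _ C1_onD(3)[OF m]])
       (use yV x0_simps y in \<open>auto intro!: continuous_intros\<close>)
  have "has_dir_deriv (\<lambda>z. F (\<psi>0 (mult_chart c0 (y, z)))) x0 v (df (mult_chart c0 (y, x0), dm ((y, x0), (0, v))))"
  proof (rule has_dir_deriv_chain[OF lf(1) F])
    show "eventually (\<lambda>t::real. mult_chart c0 (y, x0 + t *\<^sub>R v) \<in> V) (at 0)"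
      using eventually_line[OF subspace_V T' v] by eventually_elim (use C1_onD(5)[OF m] in \<open>auto simp: T'_def\<close>)
    show "dm ((y, x0), (0, v)) \<in> V"
      using C1_onD(6)[OF m y(2)] v subspace_0[OF subspace_V] by auto
  qed (use y y0 in auto)
  then have "has_dir_deriv (\<lambda>z. F (\<psi>0 y \<otimes>\<^bsub>H\<^esub> \<psi>0 z)) x0 v (df (mult_chart c0 (y, x0), dm ((y, x0), (0, v))))"
  proof (rule has_dir_deriv_cong[OF _ subspace_V T' v])
    fix z assume "z \<in> T'"
    then have "\<psi>0 y \<otimes>\<^bsub>H\<^esub> \<psi>0 z \<in> U0"
      by (auto simp: T'_def mult_dom_def U0_def \<phi>0_def \<psi>0_def)
    then show "F (\<psi>0 (mult_chart c0 (y, z))) = F (\<psi>0 y \<otimes>\<^bsub>H\<^esub> \<psi>0 z)"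
      by (simp add: mult_chart_def \<psi>0_inverse(3) flip: U0_def \<phi>0_def \<psi>0_def)
  qed
  then show ?thesis
    using lf(2) y0 by simp
qed

text \<open>The bracket formula for left invariant fields, with the fields eliminated: only derivatives of
  \<open>(g, h) \<mapsto> F (g h)\<close> at the identity occur, and these are easy to compute when \<open>F\<close> comes from an action or from
  a homomorphism.\<close>

lemma derivative_of_lie_bracket:
  assumes F: "C2_near W F" and \<xi>: "\<xi> \<in> tangent1" and \<eta>: "\<eta> \<in> tangent1"
    and a: "has_dir_deriv (\<lambda>y. dir_deriv (\<lambda>z. F (\<psi>0 y \<otimes>\<^bsub>H\<^esub> \<psi>0 z)) x0 (\<eta> c0)) x0 (\<xi> c0) a"
    and b: "has_dir_deriv (\<lambda>y. dir_deriv (\<lambda>z. F (\<psi>0 y \<otimes>\<^bsub>H\<^esub> \<psi>0 z)) x0 (\<xi> c0)) x0 (\<eta> c0) b"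
  shows "dir_deriv (\<lambda>y. F (\<psi>0 y)) x0 (bracket \<xi> \<eta> c0) = a - b"
proof -
  obtain T df ddf where T: "x0 \<in> T" "T \<subseteq> \<phi>0 ` U0"
    and f: "C1_on V T W (\<lambda>y. F (\<psi>0 y)) df" and df: "C1_on (V \<times> V) (T \<times> V) W df ddf"
    using F unfolding C2_near_def C2_on_def by blast
  note \<xi>0 = tangentD(2)[OF \<xi>] and \<eta>0 = tangentD(2)[OF \<eta>]
  obtain T1 X' where T1: "x0 \<in> T1" "C1_on V T1 V (left_field (\<xi> c0) c0) X'"
    using left_field_C1[OF c0_in_charts \<xi>0] unfolding x0_def \<phi>0_def by blast
  obtain T2 Y' where T2: "x0 \<in> T2" "C1_on V T2 V (left_field (\<eta> c0) c0) Y'"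
    using left_field_C1[OF c0_in_charts \<eta>0] unfolding x0_def \<phi>0_def by blast
  have X0: "left_field (\<xi> c0) c0 x0 = \<xi> c0" and Y0: "left_field (\<eta> c0) c0 x0 = \<eta> c0"
    using left_field_one[OF c0_in_charts \<xi>] left_field_one[OF c0_in_charts \<eta>] by (simp_all add: x0_def \<phi>0_def)
  have c0': "c0 \<in> charts N" using charts_atD[OF c0_in_charts] by blast
  note m = mult_chart_C2[OF c0']
  define S where "S = T \<inter> (\<lambda>y. (y, x0)) -` mult_dom c0"
  have S: "openin (top_of_set V) S" "x0 \<in> S"
    unfolding S_def
    by (rule openin_preimage_within[OF _ C1_onD(3)[OF f] _ C2_onD(3)[OF m]])
       (use x0_simps C1_onD(4)[OF f] T mult_dom_one[OF c0_in_charts] in \<open>auto intro!: continuous_intros simp: x0_def \<phi>0_def\<close>)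
  have P: "dir_deriv (\<lambda>z. F (\<psi>0 y \<otimes>\<^bsub>H\<^esub> \<psi>0 z)) x0 v = df (y, left_field v c0 y)" if "y \<in> S" "v \<in> V" for y v
    using that by (intro has_dir_deriv_dir_deriv derivative_along_left_field[OF f]) (auto simp: S_def)
  have b': "bracket \<xi> \<eta> c0 = Y' (x0, \<xi> c0) - X' (x0, \<eta> c0)"
    using bracket_chart[OF c0_in_charts \<xi> \<eta>] C1_on_dir_deriv[OF T1(2,1) \<eta>0] C1_on_dir_deriv[OF T2(2,1) \<xi>0]
    by (simp add: x0_def \<phi>0_def)
  have "df (x0, Y' (x0, \<xi> c0) - X' (x0, \<eta> c0)) = a - b"
  proof (rule derivative_of_bracket[OF f df T(1), of "T1 \<inter> T2" "left_field (\<xi> c0) c0" "left_field (\<eta> c0) c0"])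
    show "openin (top_of_set V) (T1 \<inter> T2)"
      using C1_onD(3)[OF T1(2)] C1_onD(3)[OF T2(2)] by (rule openin_Int)
    show "has_dir_deriv (left_field (\<eta> c0) c0) x0 (left_field (\<xi> c0) c0 x0) (Y' (x0, \<xi> c0))"
      unfolding X0 by (rule C1_on_has_dir_deriv[OF T2(2,1) \<xi>0])
    show "has_dir_deriv (left_field (\<xi> c0) c0) x0 (left_field (\<eta> c0) c0 x0) (X' (x0, \<eta> c0))"
      unfolding Y0 by (rule C1_on_has_dir_deriv[OF T1(2,1) \<eta>0])
    show "has_dir_deriv (\<lambda>y. df (y, left_field (\<eta> c0) c0 y)) x0 (left_field (\<xi> c0) c0 x0) a"
      unfolding X0 by (rule has_dir_deriv_cong[OF a subspace_V S \<xi>0]) (rule P[OF _ \<eta>0])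
    show "has_dir_deriv (\<lambda>y. df (y, left_field (\<xi> c0) c0 y)) x0 (left_field (\<eta> c0) c0 x0) b"
      unfolding Y0 by (rule has_dir_deriv_cong[OF b subspace_V S \<eta>0]) (rule P[OF _ \<xi>0])
  qed (use T1 T2 C1_onD(5,6)[OF T1(2)] C1_onD(5,6)[OF T2(2)] \<xi>0 \<eta>0 in auto)
  moreover have "bracket \<xi> \<eta> c0 \<in> V"
    unfolding b' by (intro subspace_diff[OF subspace_V] C1_onD(6)[OF T1(2,1) \<eta>0] C1_onD(6)[OF T2(2,1) \<xi>0])
  ultimately show ?thesis
    using C1_on_dir_deriv[OF f T(1)] b' by simp
qed

subsection \<open>Differentiating linear actions\<close>

text \<open>Differentiating \<open>\<rho> (g h) w = \<rho> g (\<rho> h w)\<close> in \<open>h\<close> gives \<open>\<rho> g (D v w)\<close> since \<open>\<rho> g\<close> is linear and continuous;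
  as a function of \<open>g\<close> this is the orbit map of \<open>D v w\<close>, whose derivative is \<open>D u (D v w)\<close>.\<close>

lemma action_bracket:
  fixes \<rho> :: "'g \<Rightarrow> 'w::locally_convex_space \<Rightarrow> 'w"
  defines "D \<equiv> \<lambda>v w. dir_deriv (\<lambda>y. \<rho> (\<psi>0 y) w) x0 v"
  assumes \<rho>_mult: "\<And>g h w. g \<in> carrier H \<Longrightarrow> h \<in> carrier H \<Longrightarrow> w \<in> W \<Longrightarrow> \<rho> (g \<otimes>\<^bsub>H\<^esub> h) w = \<rho> g (\<rho> h w)"
    and \<rho>_lin: "\<And>g. g \<in> carrier H \<Longrightarrow> C1_on W W W (\<rho> g) (\<lambda>z. \<rho> g (snd z))"
    and \<rho>_C2: "\<And>w. w \<in> W \<Longrightarrow> C2_near W (\<lambda>g. \<rho> g w)"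
    and \<xi>: "\<xi> \<in> tangent1" and \<eta>: "\<eta> \<in> tangent1" and w: "w \<in> W"
  shows "D (bracket \<xi> \<eta> c0) w = D (\<xi> c0) (D (\<eta> c0) w) - D (\<eta> c0) (D (\<xi> c0) w)"
proof -
  have D: "has_dir_deriv (\<lambda>y. \<rho> (\<psi>0 y) w) x0 v (D v w)" "D v w \<in> W" if vw: "v \<in> V" "w \<in> W" for v w
  proof -
    obtain T d where T: "x0 \<in> T" "C1_on V T W (\<lambda>y. \<rho> (\<psi>0 y) w) d"
      using \<rho>_C2[OF vw(2)] unfolding C2_near_def C2_on_def by blast
    have "D v w = d (x0, v)"
      unfolding D_def by (rule C1_on_dir_deriv[OF T(2,1) vw(1)])
    then show "has_dir_deriv (\<lambda>y. \<rho> (\<psi>0 y) w) x0 v (D v w)" "D v w \<in> W"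
      using C1_on_has_dir_deriv[OF T(2,1) vw(1)] C1_onD(6)[OF T(2,1) vw(1)] by simp_all
  qed
  have P: "dir_deriv (\<lambda>z. \<rho> (\<psi>0 y \<otimes>\<^bsub>H\<^esub> \<psi>0 z) w) x0 v = \<rho> (\<psi>0 y) (D v w)" if y: "y \<in> \<phi>0 ` U0" and v: "v \<in> V" for y v
  proof (rule has_dir_deriv_dir_deriv)
    have g: "\<psi>0 y \<in> carrier H" using \<psi>0_inverse(4)[OF y] .
    obtain T where T: "x0 \<in> T" "C2_on V T W (\<lambda>y. \<rho> (\<psi>0 y) w)"
      using \<rho>_C2[OF w] unfolding C2_near_def by blast
    have "has_dir_deriv (\<lambda>z. \<rho> (\<psi>0 y) (\<rho> (\<psi>0 z) w)) x0 v (\<rho> (\<psi>0 y) (snd (\<rho> (\<psi>0 x0) w, D v w)))"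
    proof (rule has_dir_deriv_chain[OF D(1)[OF v w] \<rho>_lin[OF g]])
      show "eventually (\<lambda>t::real. \<rho> (\<psi>0 (x0 + t *\<^sub>R v)) w \<in> W) (at 0)"
        using eventually_line[OF subspace_V C2_onD(3)[OF T(2)] T(1) v] by eventually_elim (rule C2_onD(5)[OF T(2)])
    qed (use D(2)[OF v w] C2_onD(5)[OF T(2,1)] in auto)
    then have "has_dir_deriv (\<lambda>z. \<rho> (\<psi>0 y) (\<rho> (\<psi>0 z) w)) x0 v (\<rho> (\<psi>0 y) (D v w))"
      by simp
    then show "has_dir_deriv (\<lambda>z. \<rho> (\<psi>0 y \<otimes>\<^bsub>H\<^esub> \<psi>0 z) w) x0 v (\<rho> (\<psi>0 y) (D v w))"
      by (rule has_dir_deriv_cong[OF _ subspace_V U0_chart(1) x0_simps(1) v]) (simp add: \<rho>_mult[OF g \<psi>0_inverse(4) w])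
  qed
  have "has_dir_deriv (\<lambda>y. dir_deriv (\<lambda>z. \<rho> (\<psi>0 y \<otimes>\<^bsub>H\<^esub> \<psi>0 z) w) x0 v) x0 u (D u (D v w))"
    if "u \<in> V" "v \<in> V" for u v
    by (rule has_dir_deriv_cong[OF D(1)[OF that(1) D(2)[OF that(2) w]] subspace_V U0_chart(1) x0_simps(1) that(1)])
       (simp add: P that)
  from derivative_of_lie_bracket[OF \<rho>_C2[OF w] \<xi> \<eta> this this]
  show ?thesis
    unfolding D_def using tangentD(2)[OF \<xi>] tangentD(2)[OF \<eta>] by simp
qed

end

section \<open>The differential of a homomorphism\<close>

locale lie_group_hom = A: lie_group_chart H N + B: lie_group_chart K P
  for H :: "('g, 'm) monoid_scheme" and N :: "('g, 'v::locally_convex_space) manifold"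
    and K :: "('h, 'k) monoid_scheme" and P :: "('h, 'w::locally_convex_space) manifold" +
  fixes q :: "'g \<Rightarrow> 'h"
  assumes q_closed: "g \<in> carrier H \<Longrightarrow> q g \<in> carrier K"
    and q_mult: "g \<in> carrier H \<Longrightarrow> h \<in> carrier H \<Longrightarrow> q (g \<otimes>\<^bsub>H\<^esub> h) = q g \<otimes>\<^bsub>K\<^esub> q h"
    and q_one: "q \<one>\<^bsub>H\<^esub> = \<one>\<^bsub>K\<^esub>"
    and q_C2: "\<exists>T. A.x0 \<in> T \<and> T \<subseteq> A.\<phi>0 ` A.U0 \<and> (\<forall>y\<in>T. q (A.\<psi>0 y) \<in> B.U0) \<and>
      C2_on A.V T B.V (\<lambda>y. B.\<phi>0 (q (A.\<psi>0 y)))"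
begin

definition dq where "dq = tangent_map N P q \<one>\<^bsub>H\<^esub>"

lemma dq_chart: "c \<in> B.charts1 \<Longrightarrow> dq \<xi> c = dir_deriv (\<lambda>y. snd c (q (A.\<psi>0 y))) A.x0 (\<xi> A.c0)"
  and dq_outside: "c \<notin> B.charts1 \<Longrightarrow> dq \<xi> c = 0"
  unfolding dq_def tangent_map_def
  by (simp_all add: q_one A.c0_def[symmetric] Let_def A.U0_def[symmetric] A.\<phi>0_def[symmetric]
      A.\<psi>0_def[symmetric] A.x0_def[symmetric] comp_def)

text \<open>Differentiability of \<open>q\<close> is assumed in one chart only; a change of charts transfers it to the others.\<close>

lemma q_chart_C2:
  assumes c: "c \<in> B.charts1"
  shows "\<exists>T. A.x0 \<in> T \<and> T \<subseteq> A.\<phi>0 ` A.U0 \<and> (\<forall>y\<in>T. q (A.\<psi>0 y) \<in> fst c) \<and>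
    C2_on A.V T B.V (\<lambda>y. snd c (q (A.\<psi>0 y)))"
proof -
  obtain T where T: "A.x0 \<in> T" "T \<subseteq> A.\<phi>0 ` A.U0" "\<forall>y\<in>T. q (A.\<psi>0 y) \<in> B.U0"
    and C: "C2_on A.V T B.V (\<lambda>y. B.\<phi>0 (q (A.\<psi>0 y)))"
    using q_C2 by blast
  note cc = B.chart_of_\<psi>0[OF c]
  define S where "S = T \<inter> (\<lambda>y. B.\<phi>0 (q (A.\<psi>0 y))) -` (B.\<phi>0 ` (B.U0 \<inter> fst c))"
  have S: "openin (top_of_set A.V) S"
    unfolding S_def by (rule openin_preimage_within[OF C2_onD(6)[OF C] C2_onD(3)[OF C] C2_onD(5)[OF C] cc(1)])
  have inS: "q (A.\<psi>0 y) \<in> fst c" if y: "y \<in> S" for y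
  proof -
    obtain g where "g \<in> B.U0" "g \<in> fst c" "B.\<phi>0 (q (A.\<psi>0 y)) = B.\<phi>0 g" "y \<in> T"
      using y by (auto simp: S_def)
    then show ?thesis
      using B.\<psi>0_inverse(3) T(3) by metis
  qed
  have "C2_on A.V S B.V (\<lambda>y. snd c (B.\<psi>0 (B.\<phi>0 (q (A.\<psi>0 y)))))"
    by (rule C2_on_compose[OF C2_on_subset[OF C S] cc(4)]) (auto simp: S_def)
  then have "C2_on A.V S B.V (\<lambda>y. snd c (q (A.\<psi>0 y)))"
    by (rule C2_on_cong) (use T(3) in \<open>simp add: S_def B.\<psi>0_inverse(3)\<close>)
  moreover have "A.x0 \<in> S"
    using T(1) cc(2) by (simp add: S_def A.x0_simps q_one B.x0_def)
  ultimately show ?thesis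
    using inS T(2) by (intro exI[of _ S]) (auto simp: S_def)
qed

lemma dq_tangent:
  assumes \<xi>: "\<xi> \<in> A.tangent1"
  shows "dq \<xi> \<in> B.tangent1"
proof (rule B.tangent_of_C1[OF A.subspace_V A.tangentD(2)[OF \<xi>], of "\<lambda>y. q (A.\<psi>0 y)"])
  show "q (A.\<psi>0 A.x0) = \<one>\<^bsub>K\<^esub>"
    by (simp add: A.x0_simps q_one)
  show "dq \<xi> = (\<lambda>c. if c \<in> B.charts1 then dir_deriv (\<lambda>y. snd c (q (A.\<psi>0 y))) A.x0 (\<xi> A.c0) else 0)"
    by (intro ext) (simp add: dq_chart dq_outside)
next
  fix c assume "c \<in> B.charts1"
  from q_chart_C2[OF this] obtain T where T: "A.x0 \<in> T" "\<forall>y\<in>T. q (A.\<psi>0 y) \<in> fst c"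
    and C: "C2_on A.V T B.V (\<lambda>y. snd c (q (A.\<psi>0 y)))" by blast
  then obtain d where "C1_on A.V T B.V (\<lambda>y. snd c (q (A.\<psi>0 y))) d"
    unfolding C2_on_def by blast
  with T C2_onD(3)[OF C] show "\<exists>T d. openin (top_of_set A.V) T \<and> A.x0 \<in> T \<and> (\<lambda>y. q (A.\<psi>0 y)) ` T \<subseteq> fst c \<and>
      C1_on A.V T B.V (\<lambda>y. snd c (q (A.\<psi>0 y))) d"
    by blast
qed

text \<open>Since \<open>q (g h) = q g (q h)\<close>, the left invariant fields of \<open>\<zeta>\<close> and \<open>dq \<zeta>\<close> are related by \<open>q\<close>, and the
  bracket formula applied to \<open>q\<close> in a chart becomes the definition of the bracket of \<open>dq \<xi>\<close> and \<open>dq \<eta>\<close>.\<close>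

lemma dq_bracket:
  assumes \<xi>: "\<xi> \<in> A.tangent1" and \<eta>: "\<eta> \<in> A.tangent1"
  shows "dq (A.bracket \<xi> \<eta>) = B.bracket (dq \<xi>) (dq \<eta>)"
proof
  fix c
  show "dq (A.bracket \<xi> \<eta>) c = B.bracket (dq \<xi>) (dq \<eta>) c"
  proof (cases "c \<in> B.charts1")
    case False
    then show ?thesis by (simp add: dq_outside B.bracket_outside)
  next
    case c: True
    note cc = B.charts_atD[OF c]
    define F where "F = (\<lambda>g. snd c (q g))"
    obtain T where T: "A.x0 \<in> T" "T \<subseteq> A.\<phi>0 ` A.U0" "\<forall>y\<in>T. q (A.\<psi>0 y) \<in> fst c"
      and C: "C2_on A.V T B.V (\<lambda>y. F (A.\<psi>0 y))"
      using q_chart_C2[OF c] unfolding F_def by blast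
    then have F: "A.C2_near B.V F"
      unfolding A.C2_near_def by blast
    obtain dF where dF: "C1_on A.V T B.V (\<lambda>y. F (A.\<psi>0 y)) dF"
      using C unfolding C2_on_def by blast
    obtain T0 d0 where T0: "A.x0 \<in> T0" "T0 \<subseteq> A.\<phi>0 ` A.U0" "\<forall>y\<in>T0. q (A.\<psi>0 y) \<in> B.U0"
      and C0: "C1_on A.V T0 B.V (\<lambda>y. B.\<phi>0 (q (A.\<psi>0 y))) d0"
      using q_C2 unfolding C2_on_def by blast
    note oT0 = C1_onD(3)[OF C0]
    obtain dm where m: "C1_on (B.V \<times> B.V) (B.mult_dom c) B.V (B.mult_chart c) dm"
      using B.mult_chart_C2[OF cc(1)] unfolding C2_on_def by blast
    define S where "S = T \<inter> (\<lambda>y. (F (A.\<psi>0 y), B.x0)) -` B.mult_dom c"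
    have S: "openin (top_of_set A.V) S" "A.x0 \<in> S"
      unfolding S_def
      by (rule openin_preimage_within[OF _ C2_onD(3)[OF C] _ C1_onD(3)[OF m]])
         (use C2_onD(5,6)[OF C] B.x0_simps T(1) B.mult_dom_one[OF c] in
           \<open>auto intro!: continuous_intros simp: F_def A.x0_simps q_one\<close>)
    have F1: "F \<one>\<^bsub>H\<^esub> = snd c \<one>\<^bsub>K\<^esub>"
      by (simp add: F_def q_one)
    \<comment> \<open>The field of \<open>\<zeta>\<close> is \<open>q\<close>-related to the field of \<open>dq \<zeta>\<close>.\<close>
    have related: "dir_deriv (\<lambda>z. F (A.\<psi>0 y \<otimes>\<^bsub>H\<^esub> A.\<psi>0 z)) A.x0 (\<zeta> A.c0)
        = B.left_field (dq \<zeta> B.c0) c (F (A.\<psi>0 y))" if \<zeta>: "\<zeta> \<in> A.tangent1" and y: "y \<in> S" for y \<zeta>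
    proof (rule has_dir_deriv_dir_deriv)
      note v = A.tangentD(2)[OF \<zeta>]
      have yT: "y \<in> T" and ym: "(F (A.\<psi>0 y), B.x0) \<in> B.mult_dom c"
        using y by (auto simp: S_def)
      have Fy: "F (A.\<psi>0 y) \<in> B.V" using C2_onD(5)[OF C yT] .
      have u: "dq \<zeta> B.c0 = d0 (A.x0, \<zeta> A.c0)"
        using dq_chart[OF B.c0_in_charts, of \<zeta>] C1_on_dir_deriv[OF C0 T0(1) v] by (simp add: B.\<phi>0_def)
      have uV: "d0 (A.x0, \<zeta> A.c0) \<in> B.V"
        by (rule C1_onD(6)[OF C0 T0(1) v])
      have pair: "C1_on A.V T0 (B.V \<times> B.V) (\<lambda>z. (F (A.\<psi>0 y), B.\<phi>0 (q (A.\<psi>0 z)))) (\<lambda>w. (0, d0 w))"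
        by (intro C1_on_Pair C0 C1_on_const A.subspace_V B.subspace_V oT0 Fy)
      have q1: "B.\<phi>0 (q (A.\<psi>0 A.x0)) = B.x0"
        by (simp add: A.x0_simps q_one B.x0_def)
      have "has_dir_deriv (\<lambda>z. B.mult_chart c (F (A.\<psi>0 y), B.\<phi>0 (q (A.\<psi>0 z)))) A.x0 (\<zeta> A.c0)
          (dm ((F (A.\<psi>0 y), B.\<phi>0 (q (A.\<psi>0 A.x0))), (0, d0 (A.x0, \<zeta> A.c0))))"
      proof (rule has_dir_deriv_chain[OF C1_on_has_dir_deriv[OF pair T0(1) v] m])
        show "eventually (\<lambda>t::real. (F (A.\<psi>0 y), B.\<phi>0 (q (A.\<psi>0 (A.x0 + t *\<^sub>R \<zeta> A.c0)))) \<in> B.V \<times> B.V) (at 0)"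
          using eventually_line[OF A.subspace_V oT0 T0(1) v] by eventually_elim (rule C1_onD(5)[OF pair])
      qed (use ym q1 uV subspace_0[OF B.subspace_V] in auto)
      then have *: "has_dir_deriv (\<lambda>z. B.mult_chart c (F (A.\<psi>0 y), B.\<phi>0 (q (A.\<psi>0 z)))) A.x0 (\<zeta> A.c0)
          (B.left_field (dq \<zeta> B.c0) c (F (A.\<psi>0 y)))"
        by (simp add: q1 u B.left_field_eq(2)[OF m ym uV])
      show "has_dir_deriv (\<lambda>z. F (A.\<psi>0 y \<otimes>\<^bsub>H\<^esub> A.\<psi>0 z)) A.x0 (\<zeta> A.c0)
          (B.left_field (dq \<zeta> B.c0) c (F (A.\<psi>0 y)))"
      proof (rule has_dir_deriv_cong[OF * A.subspace_V oT0 T0(1) v])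
        fix z assume z: "z \<in> T0"
        have "inv_into (fst c) (snd c) (F (A.\<psi>0 y)) = q (A.\<psi>0 y)"
          unfolding F_def using T(3) yT B.chart_simps(3)[OF cc(1)] by (intro inv_into_f_f) auto
        moreover have "q (A.\<psi>0 y \<otimes>\<^bsub>H\<^esub> A.\<psi>0 z) = q (A.\<psi>0 y) \<otimes>\<^bsub>K\<^esub> q (A.\<psi>0 z)"
          using yT z T(2) T0(2) by (intro q_mult A.\<psi>0_inverse(4)) auto
        ultimately show "B.mult_chart c (F (A.\<psi>0 y), B.\<phi>0 (q (A.\<psi>0 z))) = F (A.\<psi>0 y \<otimes>\<^bsub>H\<^esub> A.\<psi>0 z)"
          using z T0(3) by (simp add: B.mult_chart_def B.\<psi>0_inverse(3) F_def)
      qed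
    qed
    have along: "has_dir_deriv (\<lambda>y. dir_deriv (\<lambda>z. F (A.\<psi>0 y \<otimes>\<^bsub>H\<^esub> A.\<psi>0 z)) A.x0 (\<zeta> A.c0)) A.x0 (\<theta> A.c0)
        (dir_deriv (B.left_field (dq \<zeta> B.c0) c) (snd c \<one>\<^bsub>K\<^esub>) (dq \<theta> c))"
      if \<zeta>: "\<zeta> \<in> A.tangent1" and \<theta>: "\<theta> \<in> A.tangent1" for \<zeta> \<theta>
    proof -
      note v = A.tangentD(2)[OF \<theta>]
      obtain R dl where R: "snd c \<one>\<^bsub>K\<^esub> \<in> R" "C1_on B.V R B.V (B.left_field (dq \<zeta> B.c0) c) dl"
        using B.left_field_C1[OF c B.tangentD(2)[OF dq_tangent[OF \<zeta>]]] by blast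
      have u: "dq \<theta> c = dF (A.x0, \<theta> A.c0)"
        using dq_chart[OF c, of \<theta>] C1_on_dir_deriv[OF dF T(1) v] by (simp add: F_def)
      have uV: "dF (A.x0, \<theta> A.c0) \<in> B.V"
        by (rule C1_onD(6)[OF dF T(1) v])
      have "has_dir_deriv (\<lambda>y. B.left_field (dq \<zeta> B.c0) c (F (A.\<psi>0 y))) A.x0 (\<theta> A.c0)
          (dl (F (A.\<psi>0 A.x0), dF (A.x0, \<theta> A.c0)))"
      proof (rule has_dir_deriv_chain[OF C1_on_has_dir_deriv[OF dF T(1) v] R(2) _ uV])
        show "eventually (\<lambda>t::real. F (A.\<psi>0 (A.x0 + t *\<^sub>R \<theta> A.c0)) \<in> B.V) (at 0)"
          using eventually_line[OF A.subspace_V C1_onD(3)[OF dF] T(1) v] by eventually_elim (rule C1_onD(5)[OF dF])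
      qed (use R(1) in \<open>simp add: A.x0_simps F1\<close>)
      moreover have "dir_deriv (B.left_field (dq \<zeta> B.c0) c) (snd c \<one>\<^bsub>K\<^esub>) (dq \<theta> c) = dl (F (A.\<psi>0 A.x0), dF (A.x0, \<theta> A.c0))"
        using C1_on_dir_deriv[OF R(2,1) uV] by (simp add: A.x0_simps F1 u)
      ultimately have *: "has_dir_deriv (\<lambda>y. B.left_field (dq \<zeta> B.c0) c (F (A.\<psi>0 y))) A.x0 (\<theta> A.c0)
          (dir_deriv (B.left_field (dq \<zeta> B.c0) c) (snd c \<one>\<^bsub>K\<^esub>) (dq \<theta> c))"
        by simp
      show ?thesis
        by (rule has_dir_deriv_cong[OF * A.subspace_V S v]) (simp add: related[OF \<zeta>])
    qed
    from A.derivative_of_lie_bracket[OF F \<xi> \<eta> along[OF \<eta> \<xi>] along[OF \<xi> \<eta>]]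
    show ?thesis
      unfolding dq_chart[OF c] B.bracket_chart[OF c dq_tangent[OF \<xi>] dq_tangent[OF \<eta>]]
      by (simp add: F_def)
  qed
qed

lemma dq_chart_linear:
  assumes c: "c \<in> B.charts1"
  shows "\<exists>l. (\<forall>\<xi>. \<xi> A.c0 \<in> A.V \<longrightarrow> dq \<xi> c = l (\<xi> A.c0)) \<and>
    (\<forall>u\<in>A.V. \<forall>v\<in>A.V. l (u + v) = l u + l v) \<and> (\<forall>r. \<forall>u\<in>A.V. l (r *\<^sub>R u) = r *\<^sub>R l u)"
proof -
  obtain T d where T: "A.x0 \<in> T" and C: "C1_on A.V T B.V (\<lambda>y. snd c (q (A.\<psi>0 y))) d"
    using q_chart_C2[OF c] unfolding C2_on_def by blast
  have "dq \<xi> c = d (A.x0, \<xi> A.c0)" if "\<xi> A.c0 \<in> A.V" for \<xi>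
    unfolding dq_chart[OF c] by (rule C1_on_dir_deriv[OF C T that])
  then show ?thesis
    using C1_on_add_right[OF C T] C1_on_scale_right[OF C T]
    by (intro exI[of _ "\<lambda>v. d (A.x0, v)"]) simp
qed

lemma dq_add:
  assumes \<xi>: "\<xi> \<in> A.tangent1" and \<eta>: "\<eta> \<in> A.tangent1"
  shows "dq (\<lambda>c. \<xi> c + \<eta> c) = (\<lambda>c. dq \<xi> c + dq \<eta> c)"
proof
  note v = A.tangentD(2)[OF \<xi>] A.tangentD(2)[OF \<eta>]
  fix c show "dq (\<lambda>c. \<xi> c + \<eta> c) c = dq \<xi> c + dq \<eta> c"
  proof (cases "c \<in> B.charts1")
    case True
    from dq_chart_linear[OF this] v subspace_add[OF A.subspace_V v] show ?thesis by auto
  qed (simp add: dq_outside)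
qed

lemma dq_scale:
  assumes \<xi>: "\<xi> \<in> A.tangent1"
  shows "dq (\<lambda>c. r *\<^sub>R \<xi> c) = (\<lambda>c. r *\<^sub>R dq \<xi> c)"
proof
  note v = A.tangentD(2)[OF \<xi>]
  fix c show "dq (\<lambda>c. r *\<^sub>R \<xi> c) c = r *\<^sub>R dq \<xi> c"
  proof (cases "c \<in> B.charts1")
    case True
    from dq_chart_linear[OF this] v subspace_scale[OF A.subspace_V v] show ?thesis by auto
  qed (simp add: dq_outside)
qed

end

section \<open>Matrices\<close>

lemma sum_vec_nth: "(\<Sum>j\<in>S. f j) $ i = (\<Sum>j\<in>S. f j $ i)"
  by (induction S rule: infinite_finite_induct) auto

lemma continuous_bilinear_mult:
  assumes "continuous_inverse_algebra (sc :: 'k::real_or_complex \<Rightarrow> 'a::{real_algebra_1,locally_convex_space} \<Rightarrow> 'a)"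
  shows "continuous_bilinear ((*) :: 'a \<Rightarrow> 'a \<Rightarrow> 'a)"
  using continuous_inverse_algebra.continuous_mult[OF assms]
  unfolding continuous_bilinear_def by (auto simp: case_prod_unfold algebra_simps)

lemma matrix_vector_scaleR:
  fixes x :: "'a::real_algebra_1 ^ 'n ^ 'm"
  shows "(r *\<^sub>R x) *v y = r *\<^sub>R (x *v y)" "x *v (r *\<^sub>R y) = r *\<^sub>R (x *v y)"
  by (simp_all add: matrix_vector_mult_def vec_eq_iff scaleR_sum_right)

lemma continuous_bilinear_matrix_vector_mult:
  assumes b: "continuous_bilinear ((*) :: 'a \<Rightarrow> 'a \<Rightarrow> 'a::{real_algebra_1,locally_convex_space})"
  shows "continuous_bilinear ((*v) :: 'a ^ 'n ^ 'm \<Rightarrow> 'a ^ 'n \<Rightarrow> 'a ^ 'm)"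
  unfolding continuous_bilinear_def
proof (intro conjI allI)
  have "continuous_on UNIV (\<lambda>z :: ('a ^ 'n ^ 'm) \<times> ('a ^ 'n). \<chi> i. \<Sum>j\<in>UNIV. fst z $ i $ j * snd z $ j)"
    by (intro continuous_on_vec_lambda continuous_on_sum continuous_on_bilinear[OF b] continuous_intros)
  then show "continuous_on UNIV (\<lambda>z :: ('a ^ 'n ^ 'm) \<times> ('a ^ 'n). fst z *v snd z)"
    by (simp add: matrix_vector_mult_def)
next
  fix x :: "'a ^ 'n ^ 'm" and r :: real and y :: "'a ^ 'n"
  show "(r *\<^sub>R x) *v y = r *\<^sub>R (x *v y)" "x *v (r *\<^sub>R y) = r *\<^sub>R (x *v y)"
    by (simp_all add: matrix_vector_scaleR)
qed (simp_all add: matrix_vector_mult_add_rdistrib matrix_vector_right_distrib)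

lemma matrix_vector_axis:
  fixes m :: "'a::ring_1 ^ 'n ^ 'm"
  shows "(m *v axis j 1) $ i = m $ i $ j"
  by (simp add: matrix_vector_mult_def axis_def if_distrib cong: if_cong)

lemma matrix_mult_nth:
  fixes a :: "'a::ring_1 ^ 'n ^ 'm" and b :: "'a ^ 'l ^ 'n"
  shows "(a ** b) $ i $ j = (a *v (b *v axis j 1)) $ i"
  by (simp add: matrix_vector_mul_assoc matrix_vector_axis)

lemma matrix_mult_distrib_scale:
  fixes p :: "'a::real_algebra_1 ^ 'n ^ 'n"
  shows "p ** (x + y) ** p = p ** x ** p + p ** y ** p" "p ** (r *\<^sub>R x) ** p = r *\<^sub>R (p ** x ** p)"
proof -
  show "p ** (x + y) ** p = p ** x ** p + p ** y ** p"
    by (simp add: matrix_matrix_mult_def vec_eq_iff sum.distrib distrib_left distrib_right)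
  have "p ** (r *\<^sub>R x) = r *\<^sub>R (p ** x)" "(r *\<^sub>R y) ** p = r *\<^sub>R (y ** p)" for y
    by (simp_all add: matrix_matrix_mult_def vec_eq_iff scaleR_sum_right)
  then show "p ** (r *\<^sub>R x) ** p = r *\<^sub>R (p ** x ** p)"
    by simp
qed

lemma subspace_corner:
  fixes p :: "'a::real_algebra_1 ^ 'n ^ 'n"
  shows "subspace (range (\<lambda>x. p ** x ** p))"
  unfolding subspace_def
proof (intro conjI ballI allI)
  have "0 = p ** (0 *\<^sub>R 0) ** p" unfolding matrix_mult_distrib_scale by simp
  then show "0 \<in> range (\<lambda>x. p ** x ** p)" by blast
next
  fix x y assume "x \<in> range (\<lambda>x. p ** x ** p)" "y \<in> range (\<lambda>x. p ** x ** p)"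
  then obtain a b where ab: "x = p ** a ** p" "y = p ** b ** p" by blast
  then have "x + y = p ** (a + b) ** p" by (simp add: matrix_mult_distrib_scale)
  then show "x + y \<in> range (\<lambda>x. p ** x ** p)" by blast
next
  fix c x assume "x \<in> range (\<lambda>x. p ** x ** p)"
  then obtain a where a: "x = p ** a ** p" by blast
  then have "c *\<^sub>R x = p ** (c *\<^sub>R a) ** p" by (simp add: matrix_mult_distrib_scale)
  then show "c *\<^sub>R x \<in> range (\<lambda>x. p ** x ** p)" by blast
qed

lemma in_corner:
  fixes p :: "'a::ring_1 ^ 'n ^ 'n"
  assumes "p ** p = p"
  shows "m \<in> range (\<lambda>x. p ** x ** p) \<longleftrightarrow> p ** m = m \<and> m ** p = m"
proof
  assume "m \<in> range (\<lambda>x. p ** x ** p)"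
  then obtain x where m: "m = p ** x ** p" by blast
  have "p ** m = (p ** p) ** x ** p" "m ** p = p ** x ** (p ** p)"
    unfolding m by (simp_all only: matrix_mul_assoc)
  then show "p ** m = m \<and> m ** p = m"
    using assms m by simp
next
  assume "p ** m = m \<and> m ** p = m"
  then have "m = p ** m ** p" by simp
  then show "m \<in> range (\<lambda>x. p ** x ** p)" by blast
qed

section \<open>Finitely generated projective modules\<close>

locale projective_module =
  fixes act :: "'e::{ab_group_add,topological_space} \<Rightarrow> 'a::{real_algebra_1,locally_convex_space} \<Rightarrow> 'e"
    and p :: "'a ^ 'n ^ 'n" and \<iota> :: "'e \<Rightarrow> 'a ^ 'n"
  assumes fg: "fg_projective act p \<iota>"
begin

abbreviation "W \<equiv> range \<iota>"
abbreviation "corner \<equiv> range (\<lambda>x. p ** x ** p)"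

lemma idem: "p ** p = p"
  and inj: "inj \<iota>"
  and range_eq: "range \<iota> = range (\<lambda>x. p *v x)"
  and \<iota>_add: "\<iota> (s + t) = \<iota> s + \<iota> t"
  and \<iota>_act: "\<iota> (act s a) = (\<chi> i. \<iota> s $ i * a)"
  and homeo: "homeomorphic_map euclidean (top_of_set W) \<iota>"
proof -
  note F = fg[unfolded fg_projective_def]
  show "p ** p = p" using F by (elim conjE)
  show "inj \<iota>" using F by (elim conjE)
  show "range \<iota> = range (\<lambda>x. p *v x)" using F by (elim conjE)
  have "\<forall>s t. \<iota> (s + t) = \<iota> s + \<iota> t" using F by (elim conjE)
  then show "\<iota> (s + t) = \<iota> s + \<iota> t" by simp
  have "\<forall>s a. \<iota> (act s a) = (\<chi> i. \<iota> s $ i * a)" using F by (elim conjE)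
  then show "\<iota> (act s a) = (\<chi> i. \<iota> s $ i * a)" by simp
  show "homeomorphic_map euclidean (top_of_set W) \<iota>" using F by (elim conjE)
qed

lemma \<iota>_eq_iff: "\<iota> s = \<iota> t \<longleftrightarrow> s = t"
  using inj by (auto dest: injD)

lemma \<iota>_inv: "inv_into UNIV \<iota> (\<iota> s) = s" "w \<in> W \<Longrightarrow> \<iota> (inv_into UNIV \<iota> w) = w"
  using inj by (simp_all add: f_inv_into_f)

lemma \<iota>_diff: "\<iota> (s - t) = \<iota> s - \<iota> t"
  using \<iota>_add[of "s - t" t] by simp

lemma in_W: "w \<in> W \<longleftrightarrow> p *v w = w"
proof
  assume "w \<in> W"
  then obtain x where "w = p *v x" unfolding range_eq by blast
  then show "p *v w = w" by (simp add: matrix_vector_mul_assoc idem)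
next
  assume "p *v w = w"
  then have "w = p *v w" by simp
  then show "w \<in> W" unfolding range_eq by (rule range_eqI)
qed

lemma p_\<iota>: "p *v \<iota> s = \<iota> s"
  using in_W by blast

lemma subspace_W: "subspace W"
  unfolding subspace_def
proof (intro conjI ballI allI)
  show "0 \<in> W" unfolding in_W by simp
  show "x + y \<in> W" if "x \<in> W" "y \<in> W" for x y
    using that unfolding in_W by (simp add: matrix_vector_right_distrib)
  show "c *\<^sub>R x \<in> W" if "x \<in> W" for c x
    using that unfolding in_W by (simp add: matrix_vector_scaleR)
qed

lemma continuous_\<iota>: "continuous_on UNIV \<iota>"
  using homeomorphic_imp_continuous_map[OF homeo] by (simp add: continuous_map_in_subtopology)

lemma continuous_inv_\<iota>: "continuous_on W (inv_into UNIV \<iota>)"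
proof -
  obtain g where g: "homeomorphic_maps euclidean (top_of_set W) \<iota> g"
    using homeo homeomorphic_map_maps by blast
  then have "continuous_on W g" "\<And>s. g (\<iota> s) = s"
    by (auto simp: homeomorphic_maps_def)
  then show ?thesis
    by (elim continuous_on_eq) (auto simp: \<iota>_inv)
qed

text \<open>The generators \<open>p e\<^sub>j\<close> of \<open>p A\<^sup>n\<close>.\<close>

definition basis where "basis j = inv_into UNIV \<iota> (p *v axis j 1)"

lemma \<iota>_basis: "\<iota> (basis j) = p *v axis j 1"
  unfolding basis_def by (rule \<iota>_inv(2)) (simp add: in_W matrix_vector_mul_assoc idem)

lemma \<iota>_zero: "\<iota> 0 = 0"
  using \<iota>_diff[of 0 0] by simp

lemma \<iota>_sum: "\<iota> (\<Sum>j\<in>S. f j) = (\<Sum>j\<in>S. \<iota> (f j))"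
  by (induction S rule: infinite_finite_induct) (simp_all add: \<iota>_add \<iota>_zero)

lemma basis_expand: "(\<Sum>j\<in>UNIV. act (basis j) (\<iota> s $ j)) = s"
proof -
  have "\<iota> (\<Sum>j\<in>UNIV. act (basis j) (\<iota> s $ j)) = p *v \<iota> s"
    by (simp add: \<iota>_sum \<iota>_act \<iota>_basis vec_eq_iff sum_vec_nth matrix_vector_axis) (simp add: matrix_vector_mult_def)
  then show ?thesis
    by (simp add: p_\<iota> \<iota>_eq_iff)
qed

text \<open>The columns of the matrix are the images of the generators. It satisfies \<open>p m = m\<close> because \<open>T\<close> has values in
  \<open>p A\<^sup>n\<close>, and \<open>m p = m\<close> because the \<open>j\<close>-th generator is the \<open>j\<close>-th column of \<open>p\<close>.\<close>

lemma matrix_of_linear: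
  assumes add: "\<And>s t. T (s + t) = T s + T t" and act: "\<And>s a. T (act s a) = (\<chi> i. T s $ i * a)"
    and W: "\<And>s. T s \<in> W"
  shows "\<exists>m\<in>corner. \<forall>s. T s = m *v \<iota> s"
proof
  define m where "m = (\<chi> i j. T (basis j) $ i)"
  have T0: "T 0 = 0" using add[of 0 0] by simp
  have Tsum: "T (\<Sum>j\<in>S. f j) = (\<Sum>j\<in>S. T (f j))" for f and S :: "'n set"
    by (induction S rule: infinite_finite_induct) (simp_all add: add T0)
  show T: "\<forall>s. T s = m *v \<iota> s"
  proof
    fix s
    have "T s = T (\<Sum>j\<in>UNIV. act (basis j) (\<iota> s $ j))"
      by (simp add: basis_expand)
    also have "\<dots> = m *v \<iota> s"
      by (simp add: Tsum act vec_eq_iff sum_vec_nth m_def matrix_vector_mult_def)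
    finally show "T s = m *v \<iota> s" .
  qed
  have "p ** m = m"
  proof -
    have "(p ** m) $ i $ j = m $ i $ j" for i j
    proof -
      have "m *v axis j 1 = T (basis j)"
        by (simp add: vec_eq_iff matrix_vector_axis) (simp add: m_def)
      then show ?thesis
        using W[of "basis j"] in_W by (simp add: matrix_mult_nth) (simp add: m_def)
    qed
    then show ?thesis by (simp add: vec_eq_iff)
  qed
  moreover have "m ** p = m"
  proof -
    have "(m ** p) $ i $ j = m $ i $ j" for i j
      using T[rule_format, of "basis j"] by (simp add: matrix_mult_nth \<iota>_basis[symmetric]) (simp add: m_def)
    then show ?thesis by (simp add: vec_eq_iff)
  qed
  ultimately show "m \<in> corner"
    using in_corner[OF idem] by simp
qed

text \<open>Endomorphisms determine their matrices only because the latter satisfy \<open>m p = m\<close>.\<close>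

lemma corner_eqI:
  assumes "m \<in> corner" "m' \<in> corner" "\<And>s. m *v \<iota> s = m' *v \<iota> s"
  shows "m = m'"
proof -
  have "m = m ** p"
    using assms(1) in_corner[OF idem] by simp
  also have "m ** p = m' ** p"
    by (simp add: vec_eq_iff matrix_mult_nth assms(3) flip: \<iota>_basis)
  also have "m' ** p = m'"
    using assms(2) in_corner[OF idem] by simp
  finally show ?thesis .
qed

lemma corner_mult: 
  assumes "m \<in> corner" shows "m *v (p *v x) = m *v x" "p *v (m *v x) = m *v x" "m *v x \<in> W"
  using assms in_corner[OF idem, of m] in_W by (simp_all add: matrix_vector_mul_assoc)

lemma closed_W:
  assumes "continuous_bilinear ((*) :: 'a \<Rightarrow> 'a \<Rightarrow> 'a)"
  shows "closed W"
proof -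
  have "W = {w. p *v w = w}" using in_W by blast
  moreover have "closed {w. p *v w = w}"
    by (intro closed_Collect_eq continuous_on_id
        continuous_on_bilinear[OF continuous_bilinear_matrix_vector_mult[OF assms]] continuous_on_const)
  ultimately show ?thesis by simp
qed

end

section \<open>Lifting derivations to a projective module\<close>

locale projective_algebra_module = projective_module act p \<iota>
  for act :: "'e::{ab_group_add,topological_space} \<Rightarrow> 'a::{real_algebra_1,locally_convex_space} \<Rightarrow> 'e"
    and p :: "'a ^ 'n ^ 'n" and \<iota> :: "'e \<Rightarrow> 'a ^ 'n" +
  fixes sc :: "'k::real_or_complex \<Rightarrow> 'a \<Rightarrow> 'a"
  assumes cia: "continuous_inverse_algebra sc"
begin

lemma mult_bilinear: "continuous_bilinear ((*) :: 'a \<Rightarrow> 'a \<Rightarrow> 'a)"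
  by (rule continuous_bilinear_mult[OF cia])

lemma act_module: "act (s + t) a = act s a + act t a" "act s (a + b) = act s a + act s b"
    "act s (a * b) = act (act s a) b" "act s 1 = s"
proof -
  have "right_module act" using fg unfolding fg_projective_def by (elim conjE)
  then have *: "\<forall>s t a. act (s + t) a = act s a + act t a" "\<forall>s a b. act s (a + b) = act s a + act s b"
    "\<forall>s a b. act s (a * b) = act (act s a) b" "\<forall>s. act s 1 = s"
    unfolding right_module_def by simp_all
  from *[rule_format] show "act (s + t) a = act s a + act t a" "act s (a + b) = act s a + act s b"
    "act s (a * b) = act (act s a) b" "act s 1 = s" .
qed

lemma sc_algebra: "sc c a * b = sc c (a * b)" "a * sc c b = sc c (a * b)" "sc c (a + b) = sc c a + sc c b"
    "sc (c + d) a = sc c a + sc d a" "sc c (sc d a) = sc (c * d) a" "sc 1 a = a" "vector_space sc"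
proof -
  interpret continuous_inverse_algebra sc by (rule cia)
  show "sc c a * b = sc c (a * b)" by (rule mult_scale_left)
  show "a * sc c b = sc c (a * b)" by (rule mult_scale_right)
  show "vector_space sc" by unfold_locales
  show "sc c (a + b) = sc c a + sc c b" "sc (c + d) a = sc c a + sc d a" "sc c (sc d a) = sc (c * d) a" "sc 1 a = a"
    by (simp_all add: scale_right_distrib scale_left_distrib)
qed

lemma vector_space_module_scale: "vector_space (module_scale sc act)"
  unfolding vector_space_def module_scale_def
proof (intro conjI allI)
  fix c d :: 'k and s t
  show "act (s + t) (sc c 1) = act s (sc c 1) + act t (sc c 1)" by (rule act_module)
  show "act s (sc (c + d) 1) = act s (sc c 1) + act s (sc d 1)" by (simp add: sc_algebra act_module)
  have "sc d 1 * sc c 1 = sc (c * d) 1" by (simp add: sc_algebra mult.commute)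
  then show "act (act s (sc d 1)) (sc c 1) = act s (sc (c * d) 1)" by (simp flip: act_module(3))
  show "act s (sc 1 1) = s" by (simp add: sc_algebra act_module)
qed

lemma der_D:
  assumes "D \<in> der sc"
  shows "D (a + b) = D a + D b" "D (sc c a) = sc c (D a)" "D (a * b) = D a * b + a * D b" "continuous_on UNIV D"
    "D (sc c 1) = 0"
proof -
  have *: "Vector_Spaces.linear sc sc D" "continuous_on UNIV D" "\<forall>a b. D (a * b) = D a * b + a * D b"
    using assms unfolding der_def by blast+
  then show "D (a + b) = D a + D b" "continuous_on UNIV D"
    unfolding Vector_Spaces.linear_iff by blast+
  have scale: "D (sc c a) = sc c (D a)" for c a
    using *(1) unfolding Vector_Spaces.linear_iff by blast
  then show "D (sc c a) = sc c (D a)" .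
  show "D (a * b) = D a * b + a * D b" using *(3) by simp
  have "D 1 = 0" using *(3)[rule_format, of 1 1] by simp
  moreover have "sc c 0 = 0" using sc_algebra(3)[of c 0 0] by simp
  ultimately show "D (sc c 1) = 0" by (simp add: scale)
qed

abbreviation entrywise :: "('a \<Rightarrow> 'a) \<Rightarrow> 'a ^ 'n \<Rightarrow> 'a ^ 'n"
  where "entrywise D w \<equiv> (\<chi> i. D (w $ i))"

text \<open>The Grassmann connection \<open>s \<mapsto> p D(s)\<close> of \<open>p A\<^sup>n\<close>, shifted by the endomorphism with matrix \<open>m\<close> and
  transported to the module.\<close>

definition conn where "conn m D s = inv_into UNIV \<iota> (m *v \<iota> s + p *v entrywise D (\<iota> s))"

lemma conn_in_W:
  assumes "m \<in> corner" shows "m *v w + p *v x \<in> W"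
  by (intro subspace_add[OF subspace_W] corner_mult(3)[OF assms])
     (simp add: in_W matrix_vector_mul_assoc idem)

lemma \<iota>_conn: "m \<in> corner \<Longrightarrow> \<iota> (conn m D s) = m *v \<iota> s + p *v entrywise D (\<iota> s)"
  unfolding conn_def by (intro \<iota>_inv(2) conn_in_W)

lemma matrix_mult_right: "m *v (\<chi> i. w $ i * b) = (\<chi> i. (m *v w) $ i * b)" for m :: "'a ^ 'n ^ 'n"
  by (simp add: matrix_vector_mult_def vec_eq_iff sum_distrib_right mult.assoc)

lemma entrywise_act:
  assumes D: "D \<in> der sc"
  shows "p *v entrywise D (\<iota> (act s a)) = (\<chi> i. (p *v entrywise D (\<iota> s)) $ i * a) + \<iota> (act s (D a))"
proof -
  have "entrywise D (\<iota> (act s a)) = (\<chi> i. entrywise D (\<iota> s) $ i * a) + (\<chi> i. \<iota> s $ i * D a)"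
    by (simp add: \<iota>_act der_D(3)[OF D] vec_eq_iff)
  then have "p *v entrywise D (\<iota> (act s a)) = (\<chi> i. (p *v entrywise D (\<iota> s)) $ i * a) + (\<chi> i. (p *v \<iota> s) $ i * D a)"
    unfolding matrix_mult_right[symmetric] by (simp add: matrix_vector_right_distrib)
  then show ?thesis
    by (simp add: p_\<iota> \<iota>_act)
qed

lemma conn_Leibniz:
  assumes m: "m \<in> corner" and D: "D \<in> der sc"
  shows "conn m D (act s a) = act (conn m D s) a + act s (D a)"
proof -
  have "\<iota> (conn m D (act s a)) = \<iota> (act (conn m D s) a + act s (D a))"
    unfolding \<iota>_add \<iota>_conn[OF m] entrywise_act[OF D] \<iota>_act[of "conn m D s"]
    by (simp add: \<iota>_act[of s a] matrix_mult_right vec_eq_iff distrib_right)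
  then show ?thesis by (simp add: \<iota>_eq_iff)
qed

lemma conn_add:
  assumes m: "m \<in> corner" and D: "D \<in> der sc"
  shows "conn m D (s + t) = conn m D s + conn m D t"
proof -
  have "entrywise D (\<iota> s + \<iota> t) = entrywise D (\<iota> s) + entrywise D (\<iota> t)"
    by (simp add: der_D(1)[OF D] vec_eq_iff)
  then have "\<iota> (conn m D (s + t)) = \<iota> (conn m D s + conn m D t)"
    unfolding \<iota>_add \<iota>_conn[OF m] by (simp add: matrix_vector_right_distrib)
  then show ?thesis by (simp add: \<iota>_eq_iff)
qed

text \<open>Linearity over the ground field is the Leibniz rule for the elements \<open>sc c 1\<close>, which derivations
  annihilate.\<close>

lemma conn_DEnd_hat:
  assumes m: "m \<in> corner" and D: "D \<in> der sc"
  shows "(conn m D, D) \<in> DEnd_hat sc act"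
proof -
  have act0: "act s 0 = 0" for s using act_module(2)[of s 0 0] by simp
  have "conn m D (module_scale sc act c s) = module_scale sc act c (conn m D s)" for c s
    unfolding module_scale_def conn_Leibniz[OF m D] by (simp add: der_D(5)[OF D] act0)
  then have "Vector_Spaces.linear (module_scale sc act) (module_scale sc act) (conn m D)"
    unfolding Vector_Spaces.linear_iff using conn_add[OF m D] vector_space_module_scale by blast
  moreover have "continuous_on UNIV (conn m D)"
    unfolding conn_def
  proof (rule continuous_on_compose2[OF continuous_inv_\<iota>])
    have i: "continuous_on UNIV (\<lambda>s. \<iota> s $ i)" for i
      by (intro continuous_on_component continuous_\<iota>)
    have "continuous_on UNIV (\<lambda>s. entrywise D (\<iota> s))"
      by (intro continuous_on_vec_lambda continuous_on_compose2[OF der_D(4)[OF D] i]) auto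
    then show "continuous_on UNIV (\<lambda>s. m *v \<iota> s + p *v entrywise D (\<iota> s))"
      by (intro continuous_on_add continuous_on_bilinear[OF continuous_bilinear_matrix_vector_mult[OF mult_bilinear]]
          continuous_on_const continuous_\<iota>)
  qed (use conn_in_W[OF m] in auto)
  ultimately have "conn m D \<in> End_K sc act"
    unfolding End_K_def by blast
  then show ?thesis
    unfolding DEnd_hat_def using D by (simp add: commutator_def conn_Leibniz[OF m D] fun_eq_iff)
qed

text \<open>The difference of \<open>\<phi>\<close> and the Grassmann connection is linear over the algebra, since both satisfy the
  same Leibniz rule, so it is given by a matrix.\<close>

lemma DEnd_hat_conn:
  assumes "(\<phi>, D) \<in> DEnd_hat sc act"
  shows "\<exists>m\<in>corner. \<phi> = conn m D"
proof -
  have D: "D \<in> der sc" and \<phi>: "\<phi> \<in> End_K sc act"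
    and comm: "\<forall>a. commutator \<phi> (\<lambda>s. act s a) = (\<lambda>s. act s (D a))"
    using assms unfolding DEnd_hat_def by auto
  have add: "\<phi> (s + t) = \<phi> s + \<phi> t" for s t
    using \<phi> unfolding End_K_def Vector_Spaces.linear_iff by blast
  have act': "\<phi> (act s a) = act (\<phi> s) a + act s (D a)" for s a
    using fun_cong[OF comm[rule_format, of a], of s] unfolding commutator_def
    by (simp add: diff_eq_eq add.commute)
  define T where "T s = \<iota> (\<phi> s) - p *v entrywise D (\<iota> s)" for s
  have "\<exists>m\<in>corner. \<forall>s. T s = m *v \<iota> s"
  proof (rule matrix_of_linear)
    fix s t a
    have "entrywise D (\<iota> s + \<iota> t) = entrywise D (\<iota> s) + entrywise D (\<iota> t)"
      by (simp add: der_D(1)[OF D] vec_eq_iff)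
    then show "T (s + t) = T s + T t"
      unfolding T_def add \<iota>_add by (simp add: matrix_vector_right_distrib)
    show "T (act s a) = (\<chi> i. T s $ i * a)"
      unfolding T_def act' \<iota>_add entrywise_act[OF D] by (simp add: \<iota>_act[of "\<phi> s"] vec_eq_iff left_diff_distrib)
    show "T s \<in> W"
      unfolding T_def by (intro subspace_diff[OF subspace_W]) (simp_all add: in_W matrix_vector_mul_assoc idem p_\<iota>)
  qed
  then obtain m where m: "m \<in> corner" "\<And>s. T s = m *v \<iota> s" by blast
  have "\<phi> s = conn m D s" for s
    using m(2)[of s] \<iota>_conn[OF m(1), of D s] by (simp add: T_def diff_eq_eq flip: \<iota>_eq_iff)
  with m(1) show ?thesis by blast
qed

lemma conn_inject:
  assumes "m \<in> corner" "m' \<in> corner" "conn m D = conn m' D"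
  shows "m = m'"
proof (rule corner_eqI[OF assms(1,2)])
  fix s
  have "\<iota> (conn m D s) = \<iota> (conn m' D s)" using assms(3) by simp
  then show "m *v \<iota> s = m' *v \<iota> s"
    unfolding \<iota>_conn[OF assms(1)] \<iota>_conn[OF assms(2)] by simp
qed

lemma conn_plus:
  assumes "m \<in> corner" "m' \<in> corner"
  shows "conn (m + m') (\<lambda>a. D a + D' a) s = conn m D s + conn m' D' s"
proof -
  have "entrywise (\<lambda>a. D a + D' a) (\<iota> s) = entrywise D (\<iota> s) + entrywise D' (\<iota> s)"
    by (simp add: vec_eq_iff)
  then have "\<iota> (conn (m + m') (\<lambda>a. D a + D' a) s) = \<iota> (conn m D s + conn m' D' s)"
    unfolding \<iota>_add \<iota>_conn[OF assms(1)] \<iota>_conn[OF assms(2)] \<iota>_conn[OF subspace_add[OF subspace_corner assms]]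
    by (simp add: matrix_vector_right_distrib matrix_vector_mult_add_rdistrib)
  then show ?thesis by (simp add: \<iota>_eq_iff)
qed

lemma conn_scale:
  assumes "m \<in> corner"
  shows "conn (r *\<^sub>R m) (\<lambda>a. r *\<^sub>R D a) s = act (conn m D s) (r *\<^sub>R 1)"
proof -
  have "entrywise (\<lambda>a. r *\<^sub>R D a) (\<iota> s) = r *\<^sub>R entrywise D (\<iota> s)"
    by (simp add: vec_eq_iff)
  moreover have "\<iota> (act t (r *\<^sub>R 1)) = r *\<^sub>R \<iota> t" for t
    by (simp add: \<iota>_act vec_eq_iff)
  ultimately have "\<iota> (conn (r *\<^sub>R m) (\<lambda>a. r *\<^sub>R D a) s) = \<iota> (act (conn m D s) (r *\<^sub>R 1))"
    unfolding \<iota>_conn[OF assms] \<iota>_conn[OF subspace_scale[OF subspace_corner assms]]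
    by (simp add: matrix_vector_scaleR scaleR_add_right \<iota>_conn[OF assms])
  then show ?thesis by (simp add: \<iota>_eq_iff)
qed

end

section \<open>Smooth actions on algebras\<close>

locale smooth_algebra_action = lie_group_chart G M
  for G :: "('g, 'm) monoid_scheme" and M :: "('g, 'v::locally_convex_space) manifold" +
  fixes sc :: "'k::real_or_complex \<Rightarrow> 'a::{real_algebra_1,locally_convex_space} \<Rightarrow> 'a"
    and \<mu> :: "'g \<Rightarrow> 'a \<Rightarrow> 'a"
  assumes cia: "continuous_inverse_algebra sc"
    and action: "smooth_action G M sc \<mu>"
begin

lemma bilinear: "continuous_bilinear ((*) :: 'a \<Rightarrow> 'a \<Rightarrow> 'a)"
  by (rule continuous_bilinear_mult[OF cia])

lemma scale_of_real: "sc (of_real r) a = r *\<^sub>R a"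
  by (rule continuous_inverse_algebra.scale_of_real[OF cia])

lemma sc_vector_space: "vector_space sc"
  using cia by (simp add: continuous_inverse_algebra_def)

lemma \<mu>_Aut: "g \<in> carrier G \<Longrightarrow> \<mu> g \<in> Aut sc"
  and \<mu>_mult: "g \<in> carrier G \<Longrightarrow> h \<in> carrier G \<Longrightarrow> \<mu> (g \<otimes>\<^bsub>G\<^esub> h) = \<mu> g \<circ> \<mu> h"
  using action unfolding smooth_action_def hom_def Aut_group_def by auto

lemma \<mu>_automorphism:
  assumes "g \<in> carrier G"
  shows "\<mu> g (a + b) = \<mu> g a + \<mu> g b" "\<mu> g (sc c a) = sc c (\<mu> g a)" "\<mu> g (a * b) = \<mu> g a * \<mu> g b"
    "continuous_on UNIV (\<mu> g)" "inj (\<mu> g)"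
proof -
  have *: "Vector_Spaces.linear sc sc (\<mu> g)" "\<forall>a b. \<mu> g (a * b) = \<mu> g a * \<mu> g b" "bij (\<mu> g)" "continuous_on UNIV (\<mu> g)"
    using \<mu>_Aut[OF assms] unfolding Aut_def by auto
  then show "\<mu> g (a + b) = \<mu> g a + \<mu> g b" "\<mu> g (sc c a) = sc c (\<mu> g a)"
    unfolding Vector_Spaces.linear_iff by blast+
  show "\<mu> g (a * b) = \<mu> g a * \<mu> g b" "continuous_on UNIV (\<mu> g)" "inj (\<mu> g)"
    using * by (simp_all add: bij_is_inj)
qed

lemma \<mu>_scaleR: "g \<in> carrier G \<Longrightarrow> \<mu> g (r *\<^sub>R a) = r *\<^sub>R \<mu> g a"
  using \<mu>_automorphism(2)[of g "of_real r" a] by (simp add: scale_of_real)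

text \<open>The identity acts by an injective idempotent map.\<close>

lemma \<mu>_one: "\<mu> \<one>\<^bsub>G\<^esub> a = a"
proof -
  have "\<mu> \<one>\<^bsub>G\<^esub> (\<mu> \<one>\<^bsub>G\<^esub> a) = \<mu> \<one>\<^bsub>G\<^esub> a"
    using \<mu>_mult[OF one_closed one_closed] one_closed group by (simp add: group.is_monoid fun_eq_iff)
  then show ?thesis
    using \<mu>_automorphism(5)[OF one_closed] by (auto dest: injD)
qed

lemma action_C2: "C2_on (V \<times> UNIV) (\<phi>0 ` U0 \<times> UNIV) UNIV (\<lambda>z. \<mu> (\<psi>0 (fst z)) (snd z))"
proof -
  let ?m = "\<lambda>(g, a). \<mu> g a"
  have "smooth_map (prod_manifold M (lcs_manifold UNIV)) (lcs_manifold UNIV) ?m"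
    using action unfolding smooth_action_def by blast
  moreover have "(U0 \<times> UNIV, map_prod \<phi>0 (\<lambda>x. x)) \<in> charts (prod_manifold M (lcs_manifold UNIV))"
  proof -
    have "(U0, \<phi>0) \<in> charts M"
      using charts_atD(1)[OF c0_in_charts] by (simp add: U0_def \<phi>0_def)
    then show ?thesis
      unfolding prod_manifold_def lcs_manifold_def by auto
  qed
  moreover have "(UNIV, \<lambda>x. x) \<in> charts (lcs_manifold UNIV)"
    by (simp add: lcs_manifold_def)
  ultimately have "smooth_on (mspace (prod_manifold M (lcs_manifold UNIV)))
      (map_prod \<phi>0 (\<lambda>x. x) ` (U0 \<times> UNIV \<inter> ?m -` UNIV)) (mspace (lcs_manifold UNIV))
      ((\<lambda>x. x) \<circ> ?m \<circ> inv_into (U0 \<times> UNIV) (map_prod \<phi>0 (\<lambda>x. x)))"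
    by (rule smooth_map_chart)
  moreover have "map_prod \<phi>0 (\<lambda>x. x) ` (U0 \<times> (UNIV :: 'a set)) = \<phi>0 ` U0 \<times> UNIV"
    by (simp add: map_prod_surj_on)
  ultimately have "smooth_on (V \<times> UNIV) (\<phi>0 ` U0 \<times> UNIV) UNIV (?m \<circ> inv_into (U0 \<times> UNIV) (map_prod \<phi>0 (\<lambda>x. x)))"
    by (simp add: prod_manifold_def lcs_manifold_def comp_def)
  then have "C2_on (V \<times> UNIV) (\<phi>0 ` U0 \<times> UNIV) UNIV (?m \<circ> inv_into (U0 \<times> UNIV) (map_prod \<phi>0 (\<lambda>x. x)))"
    by (intro smooth_on_C2 subspace_Times subspace_V) auto
  then show ?thesis
  proof (rule C2_on_cong)
    fix z :: "'v \<times> 'a" assume "z \<in> \<phi>0 ` U0 \<times> UNIV"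
    then have "inv_into (U0 \<times> UNIV) (map_prod \<phi>0 (\<lambda>x. x)) (fst z, snd z) = (\<psi>0 (fst z), inv_into UNIV (\<lambda>x. x) (snd z))"
      unfolding \<psi>0_def by (intro inv_into_map_prod U0_chart(2)) auto
    moreover have "inv_into UNIV (\<lambda>x. x) (snd z) = snd z"
      by (rule inv_into_f_eq) auto
    ultimately show "\<mu> (\<psi>0 (fst z)) (snd z) = (?m \<circ> inv_into (U0 \<times> UNIV) (map_prod \<phi>0 (\<lambda>x. x))) z"
      by simp
  qed
qed

lemma orbit_C2: "C2_on V (\<phi>0 ` U0) UNIV (\<lambda>y. \<mu> (\<psi>0 y) a)"
proof -
  have "C2_on V (\<phi>0 ` U0) V (\<lambda>y. y)"
    by (rule C2_on_linear) (use subspace_V U0_chart(1) in \<open>auto intro: continuous_on_id\<close>)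
  then have "C2_on V (\<phi>0 ` U0) (V \<times> UNIV) (\<lambda>y. (y, a))"
    by (intro C2_on_Pair C2_on_const subspace_V U0_chart(1)) auto
  from C2_on_compose[OF this action_C2] show ?thesis by auto
qed

text \<open>The derivation \<open>L(\<mu>)\<close> as a function of the coordinates \<open>u\<close> of a tangent vector in the chart \<open>c0\<close>.\<close>

definition infinitesimal where "infinitesimal u a = dir_deriv (\<lambda>y. \<mu> (\<psi>0 y) a) x0 u"

lemma infinitesimal_deriv:
  assumes "u \<in> V"
  shows "has_dir_deriv (\<lambda>y. \<mu> (\<psi>0 y) a) x0 u (infinitesimal u a)"
proof -
  obtain d where d: "C1_on V (\<phi>0 ` U0) UNIV (\<lambda>y. \<mu> (\<psi>0 y) a) d"
    using orbit_C2 unfolding C2_on_def by blast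
  show ?thesis
    unfolding infinitesimal_def C1_on_dir_deriv[OF d x0_simps(1) assms]
    by (rule C1_on_has_dir_deriv[OF d x0_simps(1) assms])
qed

lemma Lie_action_eq: "Lie_action G M \<mu> x a = infinitesimal (x c0) a"
  unfolding Lie_action_def infinitesimal_def
  by (simp add: c0_def[symmetric] Let_def U0_def[symmetric] \<phi>0_def[symmetric] \<psi>0_def[symmetric] x0_def[symmetric] dir_deriv_def)

lemma infinitesimal_left:
  assumes "u \<in> V" "v \<in> V"
  shows "infinitesimal (u + v) a = infinitesimal u a + infinitesimal v a"
    "infinitesimal (r *\<^sub>R u) a = r *\<^sub>R infinitesimal u a"
proof -
  obtain d where d: "C1_on V (\<phi>0 ` U0) UNIV (\<lambda>y. \<mu> (\<psi>0 y) a) d"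
    using orbit_C2 unfolding C2_on_def by blast
  have *: "infinitesimal w a = d (x0, w)" if "w \<in> V" for w
    unfolding infinitesimal_def by (rule C1_on_dir_deriv[OF d x0_simps(1) that])
  show "infinitesimal (u + v) a = infinitesimal u a + infinitesimal v a"
    using C1_on_add_right[OF d x0_simps(1) assms] by (simp add: * assms subspace_add[OF subspace_V])
  show "infinitesimal (r *\<^sub>R u) a = r *\<^sub>R infinitesimal u a"
    using C1_on_scale_right[OF d x0_simps(1) assms(1)] by (simp add: * assms subspace_scale[OF subspace_V])
qed

lemma infinitesimal_eqI:
  assumes u: "u \<in> V" and l: "has_dir_deriv f x0 u l"
    and f: "\<And>y. y \<in> \<phi>0 ` U0 \<Longrightarrow> f y = \<mu> (\<psi>0 y) a"
  shows "infinitesimal u a = l"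
  unfolding infinitesimal_def
  by (rule has_dir_deriv_dir_deriv[OF has_dir_deriv_cong[OF l subspace_V U0_chart(1) x0_simps(1) u f]])

text \<open>Each identity for derivations is the derivative at the identity of the corresponding identity for
  the automorphisms \<open>\<mu> g\<close>. Continuity uses that the action is differentiable jointly in the group element
  and the algebra element.\<close>

lemma infinitesimal_der:
  assumes u: "u \<in> V"
  shows "infinitesimal u \<in> der sc"
proof -
  have add: "infinitesimal u (a + b) = infinitesimal u a + infinitesimal u b" for a b
    by (rule infinitesimal_eqI[OF u has_dir_deriv_add[OF infinitesimal_deriv[OF u] infinitesimal_deriv[OF u]]])
       (simp_all add: \<mu>_automorphism(1) \<psi>0_inverse(4))
  have scale: "infinitesimal u (sc c a) = sc c (infinitesimal u a)" for c a
  proof (rule infinitesimal_eqI[OF u])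
    have "continuous_on UNIV (\<lambda>a. sc c a)"
    proof -
      have "continuous_on UNIV (\<lambda>a::'a. (c, a))"
        by (intro continuous_on_Pair continuous_on_const continuous_on_id)
      from continuous_on_compose2[OF continuous_inverse_algebra.continuous_scale[OF cia] this]
      show ?thesis by simp
    qed
    moreover have "sc c (r *\<^sub>R a) = r *\<^sub>R sc c a" for r a
      unfolding scale_of_real[symmetric]
      using sc_vector_space by (simp add: vector_space_def mult.commute)
    moreover have "sc c (a + b) = sc c a + sc c b" for a b
      using sc_vector_space by (simp add: vector_space_def)
    ultimately have "C1_on UNIV UNIV UNIV (sc c) (\<lambda>z. sc c (snd z))"
      by (intro C1_on_linear) auto
    from has_dir_deriv_chain[OF infinitesimal_deriv[OF u, of a] this]
    show "has_dir_deriv (\<lambda>y. sc c (\<mu> (\<psi>0 y) a)) x0 u (sc c (infinitesimal u a))"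
      by simp
  qed (simp_all add: \<mu>_automorphism(2) \<psi>0_inverse(4))
  have mult: "infinitesimal u (a * b) = infinitesimal u a * b + a * infinitesimal u b" for a b
  proof (rule infinitesimal_eqI[OF u])
    obtain da db where d: "C1_on V (\<phi>0 ` U0) UNIV (\<lambda>y. \<mu> (\<psi>0 y) a) da" "C1_on V (\<phi>0 ` U0) UNIV (\<lambda>y. \<mu> (\<psi>0 y) b) db"
      using orbit_C2[of a] orbit_C2[of b] unfolding C2_on_def by blast
    from C1_on_has_dir_deriv[OF C1_on_bilinear[OF bilinear d] x0_simps(1) u]
    show "has_dir_deriv (\<lambda>y. \<mu> (\<psi>0 y) a * \<mu> (\<psi>0 y) b) x0 u (infinitesimal u a * b + a * infinitesimal u b)"
      using C1_on_dir_deriv[OF d(1) x0_simps(1) u] C1_on_dir_deriv[OF d(2) x0_simps(1) u]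
      by (simp add: infinitesimal_def x0_simps(3) \<mu>_one)
  qed (simp_all add: \<mu>_automorphism(3) \<psi>0_inverse(4))
  have "continuous_on UNIV (infinitesimal u)"
  proof -
    obtain d where d: "C1_on (V \<times> UNIV) (\<phi>0 ` U0 \<times> UNIV) UNIV (\<lambda>z. \<mu> (\<psi>0 (fst z)) (snd z)) d"
      using action_C2 unfolding C2_on_def by blast
    have "infinitesimal u a = d ((x0, a), (u, 0))" for a
    proof -
      have "has_dir_deriv (\<lambda>z. \<mu> (\<psi>0 (fst z)) (snd z)) (x0, a) (u, 0) (d ((x0, a), (u, 0)))"
        by (rule C1_on_has_dir_deriv[OF d]) (use x0_simps(1) u in auto)
      then have "has_dir_deriv (\<lambda>y. \<mu> (\<psi>0 y) a) x0 u (d ((x0, a), (u, 0)))"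
        unfolding has_dir_deriv_def by simp
      then show ?thesis
        using has_dir_deriv_unique[OF infinitesimal_deriv[OF u]] by simp
    qed
    moreover have "continuous_on UNIV (\<lambda>a. d ((x0, a), (u, 0)))"
      by (rule continuous_on_compose2[OF C1_onD(9)[OF d]]) (use x0_simps(1) u in \<open>auto intro!: continuous_intros\<close>)
    ultimately show ?thesis
      by simp
  qed
  with add scale mult sc_vector_space show ?thesis
    unfolding der_def Vector_Spaces.linear_iff by auto
qed

lemma Lie_action_bracket:
  assumes x: "x \<in> tangent1" and y: "y \<in> tangent1"
  shows "Lie_action G M \<mu> (bracket x y) = commutator (Lie_action G M \<mu> x) (Lie_action G M \<mu> y)"
proof
  fix a
  have lin: "C1_on UNIV UNIV UNIV (\<mu> g) (\<lambda>z. \<mu> g (snd z))" if "g \<in> carrier G" for g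
    using \<mu>_automorphism[OF that] \<mu>_scaleR[OF that] by (intro C1_on_linear) auto
  have near: "C2_near UNIV (\<lambda>g. \<mu> g w)" for w
    unfolding C2_near_def using orbit_C2 x0_simps(1) by blast
  show "Lie_action G M \<mu> (bracket x y) a = commutator (Lie_action G M \<mu> x) (Lie_action G M \<mu> y) a"
    using action_bracket[of UNIV "\<mu>", OF _ lin near x y, of a]
    by (simp add: \<mu>_mult commutator_def Lie_action_eq infinitesimal_def)
qed

lemma vector_action_mult:
  fixes m :: "'a ^ 'n ^ 'n"
  assumes g: "g \<in> carrier G"
  shows "vector_action \<mu> g (m *v w) = matrix_action \<mu> g m *v vector_action \<mu> g w"
proof -
  have 0: "\<mu> g 0 = 0" using \<mu>_automorphism(1)[OF g, of 0 0] by simp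
  have sum: "\<mu> g (\<Sum>j\<in>S. f j) = (\<Sum>j\<in>S. \<mu> g (f j))" for f and S :: "'n set"
    by (induction S rule: infinite_finite_induct) (simp_all add: \<mu>_automorphism(1)[OF g] 0)
  show ?thesis
    by (simp add: vector_action_def matrix_action_def matrix_vector_mult_def vec_eq_iff sum \<mu>_automorphism(3)[OF g])
qed

end

section \<open>The extension of the group\<close>

locale module_extension = projective_module act p \<iota> + G: smooth_algebra_action G M sc \<mu>
  for act :: "'e::{ab_group_add,topological_space} \<Rightarrow> 'a::{real_algebra_1,locally_convex_space} \<Rightarrow> 'e"
    and p :: "'a ^ 'n ^ 'n" and \<iota> :: "'e \<Rightarrow> 'a ^ 'n"
    and G :: "('g, 'm) monoid_scheme" and M :: "('g, 'v::locally_convex_space) manifold"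
    and sc :: "'k::real_or_complex \<Rightarrow> 'a \<Rightarrow> 'a" and \<mu> :: "'g \<Rightarrow> 'a \<Rightarrow> 'a" +
  fixes M_hat :: "(('e \<Rightarrow> 'e) \<times> 'g, 'w::locally_convex_space) manifold"
  assumes natural: "natural_lie_structure G M \<mu> sc act p \<iota> M_hat"
begin

abbreviation "Gh \<equiv> G_hat G \<mu> sc act"
abbreviation "UG \<equiv> U_G G \<mu> p"
abbreviation "GLA \<equiv> GL_A sc act"
abbreviation "mat_of \<equiv> matrix_of_End p \<iota>"

definition Q where "Q = {(\<phi>, g) \<in> carrier Gh. g \<in> UG}"
definition trivialization where "trivialization = (\<lambda>(\<phi>, g). (\<phi>, \<one>\<^bsub>G\<^esub>) \<otimes>\<^bsub>Gh\<^esub> sigma \<mu> p \<iota> g)"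
abbreviation "product \<equiv> prod_manifold (GL_A_manifold sc act p \<iota>) (open_submanifold M UG)"

lemma lie_hat: "lie_group Gh M_hat"
  and diffeo: "diffeomorphism product (open_submanifold M_hat Q) trivialization"
proof -
  note N = natural[unfolded natural_lie_structure_def Let_def, folded Q_def trivialization_def]
  show "lie_group Gh M_hat"
    using N by (elim conjE)
  show "diffeomorphism product (open_submanifold M_hat Q) trivialization"
    using N by (elim conjE)
qed

sublocale hat: lie_group_chart Gh M_hat
  by (rule lie_group_chart.intro[OF lie_hat])

subsection \<open>Endomorphisms\<close>

lemma \<iota>_scaleR: "\<iota> (act s (r *\<^sub>R 1)) = r *\<^sub>R \<iota> s"
  by (simp add: \<iota>_act vec_eq_iff)

lemma module_scale_real: "module_scale sc act (of_real r) s = act s (r *\<^sub>R 1)"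
  by (simp add: module_scale_def G.scale_of_real)

lemma End_K_D:
  assumes "\<phi> \<in> End_K sc act"
  shows "\<phi> (s + t) = \<phi> s + \<phi> t" "\<phi> (act s (r *\<^sub>R 1)) = act (\<phi> s) (r *\<^sub>R 1)" "continuous_on UNIV \<phi>"
proof -
  have lin: "Vector_Spaces.linear (module_scale sc act) (module_scale sc act) \<phi>" and "continuous_on UNIV \<phi>"
    using assms unfolding End_K_def by blast+
  then show "continuous_on UNIV \<phi>" "\<phi> (s + t) = \<phi> s + \<phi> t"
    unfolding Vector_Spaces.linear_iff by blast+
  have "\<phi> (module_scale sc act (of_real r) s) = module_scale sc act (of_real r) (\<phi> s)"
    using lin unfolding Vector_Spaces.linear_iff by blast
  then show "\<phi> (act s (r *\<^sub>R 1)) = act (\<phi> s) (r *\<^sub>R 1)"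
    unfolding module_scale_real .
qed

lemma GLA_D:
  assumes "\<phi> \<in> GLA"
  shows "\<phi> \<in> End_K sc act" "\<phi> (act s a) = act (\<phi> s) a"
  using assms unfolding GL_A_def End_A_def by blast+

lemma mat_of_matrix:
  assumes "\<phi> \<in> GLA"
  shows "mat_of \<phi> \<in> corner" "\<iota> (\<phi> s) = mat_of \<phi> *v \<iota> s"
proof -
  have "\<exists>m\<in>corner. \<forall>s. \<iota> (\<phi> s) = m *v \<iota> s"
    by (rule matrix_of_linear) (simp_all add: End_K_D[OF GLA_D(1)[OF assms]] GLA_D(2)[OF assms] \<iota>_add \<iota>_act)
  then obtain m where m: "m \<in> corner" "\<forall>s. \<iota> (\<phi> s) = m *v \<iota> s"
    by blast
  have "mat_of \<phi> \<in> corner \<and> (\<forall>s. \<iota> (\<phi> s) = mat_of \<phi> *v \<iota> s)"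
    unfolding matrix_of_End_def
  proof (rule theI)
    show "m \<in> corner \<and> (\<forall>s. \<iota> (\<phi> s) = m *v \<iota> s)"
      using m by blast
    fix m' assume m': "m' \<in> corner \<and> (\<forall>s. \<iota> (\<phi> s) = m' *v \<iota> s)"
    show "m' = m"
    proof (rule corner_eqI)
      show "m' *v \<iota> s = m *v \<iota> s" for s
        using m m' by metis
    qed (use m m' in blast)+
  qed
  then show "mat_of \<phi> \<in> corner" "\<iota> (\<phi> s) = mat_of \<phi> *v \<iota> s" by blast+
qed

lemma inj_mat_of: "inj_on mat_of GLA"
proof (rule inj_onI)
  fix \<phi> \<psi> assume *: "\<phi> \<in> GLA" "\<psi> \<in> GLA" "mat_of \<phi> = mat_of \<psi>"
  show "\<phi> = \<psi>"
  proof
    fix s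
    have "\<iota> (\<phi> s) = \<iota> (\<psi> s)" using * mat_of_matrix(2) by metis
    then show "\<phi> s = \<psi> s" by (simp add: \<iota>_eq_iff)
  qed
qed

lemma Gh_D:
  assumes "\<gamma> \<in> carrier Gh"
  shows "snd \<gamma> \<in> carrier G" "fst \<gamma> \<in> End_K sc act"
  using assms unfolding G_hat_def GammaL_def GL_K_def by auto

lemma Gh_mult: "\<gamma> \<otimes>\<^bsub>Gh\<^esub> \<delta> = (fst \<gamma> \<circ> fst \<delta>, snd \<gamma> \<otimes>\<^bsub>G\<^esub> snd \<delta>)"
  and Gh_one: "\<one>\<^bsub>Gh\<^esub> = (id, \<one>\<^bsub>G\<^esub>)"
  by (simp_all add: G_hat_def case_prod_unfold)

text \<open>With \<open>P = g * p\<close>, the vector \<open>g \<sharp> s\<close> is fixed by \<open>P\<close>, so the summand \<open>(1 - p) (1 - P)\<close> of \<open>\<gamma>(g)\<close>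
  annihilates it and \<open>p P\<close> acts on it as \<open>p\<close>.\<close>

lemma \<iota>_S_E:
  assumes g: "g \<in> carrier G"
  shows "\<iota> (S_E \<mu> p \<iota> g s) = p *v vector_action \<mu> g (\<iota> s)"
proof -
  let ?P = "matrix_action \<mu> g p" and ?x = "vector_action \<mu> g (\<iota> s)"
  have "?P *v ?x = ?x"
    by (simp add: G.vector_action_mult[OF g, symmetric] p_\<iota>)
  then have "gamma \<mu> p g *v ?x = p *v ?x"
    unfolding gamma_def
    by (simp add: matrix_vector_mult_add_rdistrib matrix_vector_mul_assoc[symmetric] matrix_vector_mult_diff_rdistrib)
  moreover have "p *v ?x \<in> W"
    by (simp add: in_W matrix_vector_mul_assoc idem)
  ultimately show ?thesis
    unfolding S_E_def by (simp add: \<iota>_inv(2))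
qed

lemma one_UG: "\<one>\<^bsub>G\<^esub> \<in> UG"
proof -
  have 1: "matrix_action \<mu> \<one>\<^bsub>G\<^esub> p = p"
    by (simp add: matrix_action_def vec_eq_iff G.\<mu>_one)
  have "gamma \<mu> p \<one>\<^bsub>G\<^esub> *v x = mat 1 *v x" for x
  proof -
    have "p *v (p *v x) = p *v x" by (simp add: matrix_vector_mul_assoc idem)
    then show ?thesis
      unfolding gamma_def 1
      by (simp add: matrix_vector_mult_add_rdistrib matrix_vector_mul_assoc[symmetric] matrix_vector_mult_diff_rdistrib
          matrix_vector_mult_diff_distrib)
  qed
  then have "gamma \<mu> p \<one>\<^bsub>G\<^esub> = mat 1"
    using matrix_eq[of "gamma \<mu> p \<one>\<^bsub>G\<^esub>" "mat 1"] by blast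
  then show ?thesis
    unfolding U_G_def using G.one_closed by (auto simp: invertible_def intro!: exI[of _ "mat 1"])
qed

lemma trivialization_apply: "trivialization (\<phi>, g) = (\<phi> \<circ> S_E \<mu> p \<iota> g, \<one>\<^bsub>G\<^esub> \<otimes>\<^bsub>G\<^esub> g)"
  by (simp add: trivialization_def Gh_mult sigma_def)

lemma UG_carrier: "g \<in> UG \<Longrightarrow> g \<in> carrier G"
  by (simp add: U_G_def)

subsection \<open>Local coordinates\<close>

lemma topspace_product: "topspace (mtop product) = GLA \<times> UG"
proof -
  have "topspace (mtop (GL_A_manifold sc act p \<iota>)) = GLA"
    by (simp add: GL_A_manifold_def topspace_pullback_topology)
  moreover have "topspace (mtop (open_submanifold M UG)) = UG"
    using UG_carrier by (auto simp: open_submanifold_def G.space)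
  ultimately show ?thesis
    by (simp add: prod_manifold_def)
qed

lemma topspace_Q: "topspace (mtop (open_submanifold M_hat Q)) = Q"
  by (auto simp: open_submanifold_def hat.space Q_def)

definition untrivialize where "untrivialize = inv_into (GLA \<times> UG) trivialization"

lemma untrivialize_spec:
  assumes "\<gamma> \<in> Q"
  shows "untrivialize \<gamma> \<in> GLA \<times> UG" "trivialization (untrivialize \<gamma>) = \<gamma>" "snd (untrivialize \<gamma>) = snd \<gamma>"
proof -
  have "\<gamma> \<in> trivialization ` (GLA \<times> UG)"
    using diffeo assms unfolding diffeomorphism_def topspace_product topspace_Q bij_betw_def by blast
  then show *: "untrivialize \<gamma> \<in> GLA \<times> UG" "trivialization (untrivialize \<gamma>) = \<gamma>"
    unfolding untrivialize_def by (auto intro: inv_into_into simp: f_inv_into_f)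
  obtain \<phi> g where \<phi>g: "untrivialize \<gamma> = (\<phi>, g)" by (cases "untrivialize \<gamma>")
  then have "\<gamma> = (\<phi> \<circ> S_E \<mu> p \<iota> g, \<one>\<^bsub>G\<^esub> \<otimes>\<^bsub>G\<^esub> g)" "g \<in> carrier G"
    using * trivialization_apply UG_carrier by auto
  then show "snd (untrivialize \<gamma>) = snd \<gamma>"
    using \<phi>g G.group by (simp add: group.is_monoid)
qed

lemma untrivialize_trivialization: "z \<in> GLA \<times> UG \<Longrightarrow> untrivialize (trivialization z) = z"
  and trivialization_in_Q: "z \<in> GLA \<times> UG \<Longrightarrow> trivialization z \<in> Q"
  using diffeo unfolding diffeomorphism_def topspace_product topspace_Q bij_betw_def untrivialize_def
  by auto

lemma one_Q: "\<one>\<^bsub>Gh\<^esub> \<in> Q"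
  using hat.one_closed one_UG by (simp add: Q_def Gh_one)

abbreviation "dom_prod \<equiv> GLA \<times> (G.U0 \<inter> UG)"
abbreviation "prod_chart \<equiv> map_prod mat_of G.\<phi>0"

text \<open>The trivialization in charts, and its inverse. The trivialization need not map \<open>dom_prod\<close> into the chart
  domain \<open>hat.U0\<close>, nor its inverse \<open>hat.U0 \<inter> Q\<close> into \<open>dom_prod\<close>, so both are restricted to the points where
  this holds.\<close>

definition "coord_dom = hat.\<phi>0 ` (hat.U0 \<inter> Q \<inter> untrivialize -` dom_prod)"
definition "coord y = prod_chart (untrivialize (hat.\<psi>0 y))"
definition "param_dom = prod_chart ` (dom_prod \<inter> trivialization -` (hat.U0 \<inter> Q))"
definition "param z = hat.\<phi>0 (trivialization (inv_into dom_prod prod_chart z))"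

lemma charts_product: "(dom_prod, prod_chart) \<in> charts product" and charts_Q: "(hat.U0 \<inter> Q, hat.\<phi>0) \<in> charts (open_submanifold M_hat Q)"
proof -
  have "(G.U0, G.\<phi>0) \<in> charts M"
    using G.charts_atD(1)[OF G.c0_in_charts] by (simp add: G.U0_def G.\<phi>0_def)
  then show "(dom_prod, prod_chart) \<in> charts product"
    unfolding prod_manifold_def GL_A_manifold_def open_submanifold_def by auto
  have "(hat.U0, hat.\<phi>0) \<in> charts M_hat"
    using hat.charts_atD(1)[OF hat.c0_in_charts] by (simp add: hat.U0_def hat.\<phi>0_def)
  then show "(hat.U0 \<inter> Q, hat.\<phi>0) \<in> charts (open_submanifold M_hat Q)"
    unfolding open_submanifold_def by auto
qed

lemma mspaces: "mspace product = corner \<times> G.V" "mspace (open_submanifold M_hat Q) = hat.V"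
  by (simp_all add: prod_manifold_def GL_A_manifold_def open_submanifold_def)

lemma subspace_product: "subspace (corner \<times> G.V)"
  by (intro subspace_Times subspace_corner G.subspace_V)

lemma inj_prod_chart: "inj_on prod_chart dom_prod"
  by (intro map_prod_inj_on inj_mat_of inj_on_subset[OF G.U0_chart(2)]) auto

lemma coord_C2: "C2_on hat.V coord_dom (corner \<times> G.V) coord"
proof -
  have "smooth_map (open_submanifold M_hat Q) product untrivialize"
    using diffeo unfolding diffeomorphism_def topspace_product untrivialize_def by blast
  from smooth_map_chart[OF this charts_Q charts_product]
  have "C2_on hat.V coord_dom (corner \<times> G.V) (prod_chart \<circ> untrivialize \<circ> inv_into (hat.U0 \<inter> Q) hat.\<phi>0)"
    unfolding mspaces coord_dom_def by (rule smooth_on_C2[OF _ hat.subspace_V subspace_product])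
  then show ?thesis
  proof (rule C2_on_cong)
    fix y assume "y \<in> coord_dom"
    then obtain \<gamma> where \<gamma>: "\<gamma> \<in> hat.U0" "\<gamma> \<in> Q" "y = hat.\<phi>0 \<gamma>" unfolding coord_dom_def by blast
    have "inv_into (hat.U0 \<inter> Q) hat.\<phi>0 y = \<gamma>"
      unfolding \<gamma>(3) using \<gamma>(1,2) by (intro inv_into_f_f inj_on_subset[OF hat.U0_chart(2)]) auto
    then show "coord y = (prod_chart \<circ> untrivialize \<circ> inv_into (hat.U0 \<inter> Q) hat.\<phi>0) y"
      using \<gamma> by (simp add: coord_def hat.\<psi>0_inverse(3))
  qed
qed

lemma param_C2: "C2_on (corner \<times> G.V) param_dom hat.V param"
proof -
  have "smooth_map product (open_submanifold M_hat Q) trivialization"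
    using diffeo unfolding diffeomorphism_def by blast
  from smooth_map_chart[OF this charts_product charts_Q]
  have "C2_on (corner \<times> G.V) param_dom hat.V (hat.\<phi>0 \<circ> trivialization \<circ> inv_into dom_prod prod_chart)"
    unfolding mspaces param_dom_def by (rule smooth_on_C2[OF _ subspace_product hat.subspace_V])
  then show ?thesis
    by (rule C2_on_cong) (simp add: param_def)
qed

lemma coord_domD:
  assumes "y \<in> coord_dom"
  shows "y \<in> hat.\<phi>0 ` hat.U0" "hat.\<psi>0 y \<in> hat.U0" "hat.\<psi>0 y \<in> Q" "untrivialize (hat.\<psi>0 y) \<in> dom_prod" "hat.\<phi>0 (hat.\<psi>0 y) = y"
  using assms unfolding coord_dom_def by (auto simp: hat.\<psi>0_inverse(3))

lemma one_coord_dom: "hat.x0 \<in> coord_dom"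
proof -
  have "untrivialize \<one>\<^bsub>Gh\<^esub> \<in> dom_prod"
    using untrivialize_spec[OF one_Q] G.U0_chart(4) by (auto simp: Gh_one mem_Times_iff)
  then show ?thesis
    unfolding coord_dom_def hat.x0_def using hat.U0_chart(4) one_Q by blast
qed

lemma coord_param:
  shows "y \<in> coord_dom \<Longrightarrow> coord y \<in> param_dom" "y \<in> coord_dom \<Longrightarrow> param (coord y) = y"
    "z \<in> param_dom \<Longrightarrow> param z \<in> coord_dom" "z \<in> param_dom \<Longrightarrow> coord (param z) = z"
proof -
  assume y: "y \<in> coord_dom"
  note D = coord_domD[OF y]
  have t: "trivialization (untrivialize (hat.\<psi>0 y)) = hat.\<psi>0 y"
    by (rule untrivialize_spec(2)[OF D(3)])
  show "coord y \<in> param_dom"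
    unfolding coord_def param_dom_def using D t by (intro imageI) auto
  show "param (coord y) = y"
    unfolding param_def coord_def using inv_into_f_f[OF inj_prod_chart D(4)] t D(5) by simp
next
  assume "z \<in> param_dom"
  then have "\<exists>w\<in>dom_prod \<inter> trivialization -` (hat.U0 \<inter> Q). z = prod_chart w"
    unfolding param_dom_def image_iff .
  then obtain w where "w \<in> dom_prod \<inter> trivialization -` (hat.U0 \<inter> Q)" and z: "z = prod_chart w"
    by (rule bexE)
  then have w: "w \<in> dom_prod" "trivialization w \<in> hat.U0 \<inter> Q"
    by simp_all
  have inv: "inv_into dom_prod prod_chart z = w"
    unfolding z by (rule inv_into_f_f[OF inj_prod_chart w(1)])
  have u: "untrivialize (trivialization w) = w"
    using w(1) by (intro untrivialize_trivialization) auto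
  show "param z \<in> coord_dom"
    unfolding param_def coord_dom_def inv using w u by (intro imageI) auto
  show "coord (param z) = z"
    unfolding param_def coord_def inv using w u by (simp add: hat.\<psi>0_inverse(3) z)
qed

lemma coord_snd:
  assumes "y \<in> coord_dom"
  shows "snd (coord y) = G.\<phi>0 (snd (hat.\<psi>0 y))" "snd (hat.\<psi>0 y) \<in> G.U0" "snd (hat.\<psi>0 y) = G.\<psi>0 (snd (coord y))" "fst (coord y) \<in> corner"
    "snd (coord y) \<in> G.\<phi>0 ` G.U0"
proof -
  note D = coord_domD[OF assms]
  show 1: "snd (coord y) = G.\<phi>0 (snd (hat.\<psi>0 y))"
    by (simp add: coord_def untrivialize_spec(3)[OF D(3)])
  show 2: "snd (hat.\<psi>0 y) \<in> G.U0"
    using D(4) untrivialize_spec(3)[OF D(3)] by (auto simp: mem_Times_iff)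
  show "snd (hat.\<psi>0 y) = G.\<psi>0 (snd (coord y))"
    unfolding 1 using 2 by (simp add: G.\<psi>0_inverse(3))
  show "fst (coord y) \<in> corner"
    using D(4) by (auto simp: coord_def mem_Times_iff intro: mat_of_matrix(1))
  show "snd (coord y) \<in> G.\<phi>0 ` G.U0"
    unfolding 1 using 2 by blast
qed

text \<open>The idempotent \<open>p\<close> produced by \<open>S_E\<close> is absorbed by the matrix, which lies in \<open>p M\<^sub>n(A) p\<close>.\<close>

lemma action_in_coords:
  assumes "y \<in> coord_dom"
  shows "\<iota> (fst (hat.\<psi>0 y) s) = fst (coord y) *v vector_action \<mu> (G.\<psi>0 (snd (coord y))) (\<iota> s)"
proof -
  note D = coord_domD[OF assms]
  obtain \<phi> g where \<phi>g: "untrivialize (hat.\<psi>0 y) = (\<phi>, g)"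
    by (cases "untrivialize (hat.\<psi>0 y)")
  have g: "g = snd (hat.\<psi>0 y)"
    using untrivialize_spec(3)[OF D(3)] \<phi>g by simp
  have \<phi>: "\<phi> \<in> GLA" "g \<in> carrier G"
    using D(4) \<phi>g UG_carrier by auto
  have "hat.\<psi>0 y = trivialization (\<phi>, g)"
    using untrivialize_spec(2)[OF D(3)] \<phi>g by simp
  then have "fst (hat.\<psi>0 y) s = \<phi> (S_E \<mu> p \<iota> g s)"
    by (simp add: trivialization_apply)
  then have "\<iota> (fst (hat.\<psi>0 y) s) = mat_of \<phi> *v vector_action \<mu> g (\<iota> s)"
    by (simp add: mat_of_matrix[OF \<phi>(1)] \<iota>_S_E[OF \<phi>(2)] corner_mult)
  moreover have "fst (coord y) = mat_of \<phi>"
    by (simp add: coord_def \<phi>g)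
  moreover have "G.\<psi>0 (snd (coord y)) = g"
    unfolding g by (rule coord_snd(3)[OF assms, symmetric])
  ultimately show ?thesis
    by simp
qed

lemma coord_one: "fst (coord hat.x0) = p" "snd (coord hat.x0) = G.x0"
proof -
  note S = coord_snd[OF one_coord_dom]
  show 2: "snd (coord hat.x0) = G.x0"
    using S(1) by (simp add: hat.x0_simps(3) Gh_one G.x0_def)
  show "fst (coord hat.x0) = p"
  proof (rule corner_eqI[OF S(4)])
    show "p \<in> corner" by (simp add: in_corner idem)
    fix s
    have "\<iota> s = fst (coord hat.x0) *v vector_action \<mu> \<one>\<^bsub>G\<^esub> (\<iota> s)"
      using action_in_coords[OF one_coord_dom, of s] by (simp add: hat.x0_simps(3) Gh_one 2 G.x0_simps(3))
    moreover have "vector_action \<mu> \<one>\<^bsub>G\<^esub> (\<iota> s) = \<iota> s"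
      by (simp add: vector_action_def vec_eq_iff G.\<mu>_one)
    ultimately show "fst (coord hat.x0) *v \<iota> s = p *v \<iota> s"
      by (simp add: p_\<iota>)
  qed
qed

subsection \<open>The projection onto the group\<close>

sublocale proj: lie_group_hom Gh M_hat G M snd
proof
  show "\<exists>T. hat.x0 \<in> T \<and> T \<subseteq> hat.\<phi>0 ` hat.U0 \<and> (\<forall>y\<in>T. snd (hat.\<psi>0 y) \<in> G.U0) \<and>
      C2_on hat.V T G.V (\<lambda>y. G.\<phi>0 (snd (hat.\<psi>0 y)))"
  proof (intro exI conjI ballI)
    have "C2_on (corner \<times> G.V) (corner \<times> G.V) G.V snd"
      by (rule C2_on_linear) (use subspace_product G.subspace_V in \<open>auto intro: continuous_intros\<close>)
    then have "C2_on hat.V coord_dom G.V (\<lambda>y. snd (coord y))"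
      by (rule C2_on_compose[OF coord_C2]) (use C2_onD(5)[OF coord_C2] in auto)
    then show "C2_on hat.V coord_dom G.V (\<lambda>y. G.\<phi>0 (snd (hat.\<psi>0 y)))"
      by (rule C2_on_cong) (simp add: coord_snd(1))
  qed (use one_coord_dom coord_domD(1) coord_snd(2) in auto)
qed (auto simp: Gh_D(1) Gh_mult Gh_one)

sublocale grassmann: projective_algebra_module act p \<iota> sc
  by (intro projective_algebra_module.intro projective_algebra_module_axioms.intro
      projective_module_axioms G.cia)

subsection \<open>The representation on the module\<close>

lemma representation_C2: "C2_on hat.V coord_dom W (\<lambda>y. \<iota> (fst (hat.\<psi>0 y) s))"
proof (rule C2_on_codomain[OF _ subspace_W closed_W[OF G.bilinear]])
  have "C2_on (corner \<times> G.V) (corner \<times> G.V) corner fst" "C2_on (corner \<times> G.V) (corner \<times> G.V) G.V snd"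
    by (rule C2_on_linear; use subspace_product subspace_corner G.subspace_V in \<open>auto intro: continuous_intros\<close>)+
  from this[THEN C2_on_compose[OF coord_C2]] C2_onD(5)[OF coord_C2]
  have c: "C2_on hat.V coord_dom corner (\<lambda>y. fst (coord y))" "C2_on hat.V coord_dom G.V (\<lambda>y. snd (coord y))"
    by auto
  have "C2_on G.V (G.\<phi>0 ` G.U0) UNIV (\<lambda>y. vector_action \<mu> (G.\<psi>0 y) w)" for w
    unfolding vector_action_def by (intro C2_on_vec G.orbit_C2)
  from C2_on_bilinear[OF continuous_bilinear_matrix_vector_mult[OF G.bilinear] c(1) C2_on_compose[OF c(2) this]]
  have "C2_on hat.V coord_dom UNIV (\<lambda>y. fst (coord y) *v vector_action \<mu> (G.\<psi>0 (snd (coord y))) (\<iota> s))"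
    using coord_snd(5) by blast
  then show "C2_on hat.V coord_dom UNIV (\<lambda>y. \<iota> (fst (hat.\<psi>0 y) s))"
    by (rule C2_on_cong) (rule action_in_coords)
qed auto

definition dcoord where "dcoord v = dir_deriv coord hat.x0 v"

lemma dcoord_C1: "\<exists>d. C1_on hat.V coord_dom (corner \<times> G.V) coord d \<and> (\<forall>v\<in>hat.V. d (hat.x0, v) = dcoord v)"
proof -
  obtain d where d: "C1_on hat.V coord_dom (corner \<times> G.V) coord d"
    using coord_C2 unfolding C2_on_def by blast
  have "d (hat.x0, v) = dcoord v" if "v \<in> hat.V" for v
    unfolding dcoord_def using C1_on_dir_deriv[OF d one_coord_dom that] by simp
  with d show ?thesis by blast
qed

lemma dcoord_in: "v \<in> hat.V \<Longrightarrow> fst (dcoord v) \<in> corner \<and> snd (dcoord v) \<in> G.V"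
  using dcoord_C1 C1_onD(6)[OF _ one_coord_dom] by (metis mem_Times_iff)

lemma dcoord_bij: "bij_betw dcoord hat.V (corner \<times> G.V)"
proof -
  obtain d where d: "C1_on hat.V coord_dom (corner \<times> G.V) coord d" "\<forall>v\<in>hat.V. d (hat.x0, v) = dcoord v"
    using dcoord_C1 by blast
  obtain d' where d': "C1_on (corner \<times> G.V) param_dom hat.V param d'"
    using param_C2 unfolding C2_on_def by blast
  have "bij_betw (\<lambda>v. d (hat.x0, v)) hat.V (corner \<times> G.V)"
    by (rule local_inverse_derivative_bij[OF d(1) d']) (simp_all add: coord_param one_coord_dom)
  then show ?thesis
    by (rule bij_betw_cong[THEN iffD1, rotated]) (simp add: d(2))
qed

lemma dcoord_linear:
  assumes "u \<in> hat.V" "v \<in> hat.V"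
  shows "dcoord (u + v) = dcoord u + dcoord v" "dcoord (r *\<^sub>R u) = r *\<^sub>R dcoord u"
proof -
  obtain d where d: "C1_on hat.V coord_dom (corner \<times> G.V) coord d" "\<forall>v\<in>hat.V. d (hat.x0, v) = dcoord v"
    using dcoord_C1 by blast
  show "dcoord (u + v) = dcoord u + dcoord v"
    using C1_on_add_right[OF d(1) one_coord_dom assms] d(2) assms subspace_add[OF hat.subspace_V] by metis
  show "dcoord (r *\<^sub>R u) = r *\<^sub>R dcoord u"
    using C1_on_scale_right[OF d(1) one_coord_dom assms(1)] d(2) assms subspace_scale[OF hat.subspace_V] by metis
qed

text \<open>The product rule for \<open>m (g \<sharp> s)\<close> at \<open>m = p\<close>, \<open>g = 1\<close>.\<close>

lemma representation_deriv:
  assumes v: "v \<in> hat.V"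
  shows "has_dir_deriv (\<lambda>y. \<iota> (fst (hat.\<psi>0 y) s)) hat.x0 v
    (\<iota> (grassmann.conn (fst (dcoord v)) (G.infinitesimal (snd (dcoord v))) s))"
proof -
  obtain d where d: "C1_on hat.V coord_dom (corner \<times> G.V) coord d" "\<forall>v\<in>hat.V. d (hat.x0, v) = dcoord v"
    using dcoord_C1 by blast
  have fstsnd: "C1_on (corner \<times> G.V) (corner \<times> G.V) corner fst (\<lambda>z. fst (snd z))"
      "C1_on (corner \<times> G.V) (corner \<times> G.V) G.V snd (\<lambda>z. snd (snd z))"
    by (rule C1_on_linear; use subspace_product subspace_corner G.subspace_V in \<open>auto intro: continuous_intros\<close>)+
  have c: "C1_on hat.V coord_dom corner (\<lambda>y. fst (coord y)) (\<lambda>z. fst (snd (coord (fst z), d z)))"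
      "C1_on hat.V coord_dom G.V (\<lambda>y. snd (coord y)) (\<lambda>z. snd (snd (coord (fst z), d z)))"
    by (rule C1_on_compose[OF d(1) fstsnd(1) C1_onD(5)[OF d(1)]],
        assumption, rule C1_on_compose[OF d(1) fstsnd(2) C1_onD(5)[OF d(1)]])
  obtain dO where dO: "C1_on G.V (G.\<phi>0 ` G.U0) UNIV (\<lambda>y. vector_action \<mu> (G.\<psi>0 y) (\<iota> s)) dO"
    using C2_on_vec[OF G.orbit_C2] unfolding C2_on_def vector_action_def by metis
  have dO_eq: "dO (G.x0, u) = grassmann.entrywise (G.infinitesimal u) (\<iota> s)" if u: "u \<in> G.V" for u
  proof -
    have "has_dir_deriv (\<lambda>y. vector_action \<mu> (G.\<psi>0 y) (\<iota> s)) G.x0 u (grassmann.entrywise (G.infinitesimal u) (\<iota> s))"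
      unfolding has_dir_deriv_def vector_action_def
      using G.infinitesimal_deriv[OF u] unfolding has_dir_deriv_def by (intro vec_tendstoI) simp
    then show ?thesis
      using C1_on_has_dir_deriv[OF dO G.x0_simps(1) u] has_dir_deriv_unique by blast
  qed
  have "C1_on hat.V coord_dom UNIV (\<lambda>y. vector_action \<mu> (G.\<psi>0 (snd (coord y))) (\<iota> s))
      (\<lambda>z. dO (snd (coord (fst z)), snd (snd (coord (fst z), d z))))"
    by (rule C1_on_compose[OF c(2) dO coord_snd(5)])
  from C1_on_has_dir_deriv[OF C1_on_bilinear[OF continuous_bilinear_matrix_vector_mult[OF G.bilinear] c(1) this] one_coord_dom v]
  have "has_dir_deriv (\<lambda>y. fst (coord y) *v vector_action \<mu> (G.\<psi>0 (snd (coord y))) (\<iota> s)) hat.x0 v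
      (fst (dcoord v) *v vector_action \<mu> (G.\<psi>0 (snd (coord hat.x0))) (\<iota> s) +
       fst (coord hat.x0) *v dO (snd (coord hat.x0), snd (dcoord v)))"
    using d(2) v by simp
  moreover have "vector_action \<mu> (G.\<psi>0 (snd (coord hat.x0))) (\<iota> s) = \<iota> s"
    by (simp add: coord_one G.x0_simps(3) vector_action_def vec_eq_iff G.\<mu>_one)
  ultimately have "has_dir_deriv (\<lambda>y. fst (coord y) *v vector_action \<mu> (G.\<psi>0 (snd (coord y))) (\<iota> s)) hat.x0 v
      (\<iota> (grassmann.conn (fst (dcoord v)) (G.infinitesimal (snd (dcoord v))) s))"
    using dcoord_in[OF v] by (simp add: grassmann.\<iota>_conn coord_one dO_eq)
  then show ?thesis
    by (rule has_dir_deriv_cong[OF _ hat.subspace_V C2_onD(3)[OF coord_C2] one_coord_dom v]) (simp add: action_in_coords)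
qed

lemma dq_c0:
  assumes "\<xi> \<in> hat.tangent1"
  shows "proj.dq \<xi> G.c0 = snd (dcoord (\<xi> hat.c0))"
proof -
  note v = hat.tangentD(2)[OF assms]
  obtain d where d: "C1_on hat.V coord_dom (corner \<times> G.V) coord d" "\<forall>v\<in>hat.V. d (hat.x0, v) = dcoord v"
    using dcoord_C1 by blast
  have "has_dir_deriv coord hat.x0 (\<xi> hat.c0) (dcoord (\<xi> hat.c0))"
    using C1_on_has_dir_deriv[OF d(1) one_coord_dom v] d(2) v by simp
  then have "has_dir_deriv (\<lambda>y. snd (coord y)) hat.x0 (\<xi> hat.c0) (snd (dcoord (\<xi> hat.c0)))"
    unfolding has_dir_deriv_def using tendsto_snd by fastforce
  then have "has_dir_deriv (\<lambda>y. snd G.c0 (snd (hat.\<psi>0 y))) hat.x0 (\<xi> hat.c0) (snd (dcoord (\<xi> hat.c0)))"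
    by (rule has_dir_deriv_cong[OF _ hat.subspace_V C2_onD(3)[OF coord_C2] one_coord_dom v])
       (simp add: coord_snd(1) G.\<phi>0_def)
  then show ?thesis
    unfolding proj.dq_chart[OF G.c0_in_charts] by (rule has_dir_deriv_dir_deriv)
qed

text \<open>The derivative of the action on the module, written through coordinates so that its dependence on the
  matrix component and on the derivation is visible.\<close>

definition dE where "dE \<xi> = grassmann.conn (fst (dcoord (\<xi> hat.c0))) (G.infinitesimal (snd (dcoord (\<xi> hat.c0))))"

lemma Lie_action_dq:
  assumes "\<xi> \<in> hat.tangent1"
  shows "Lie_action G M \<mu> (proj.dq \<xi>) = G.infinitesimal (snd (dcoord (\<xi> hat.c0)))"
  by (intro ext) (simp add: G.Lie_action_eq dq_c0[OF assms])

text \<open>The module carries no structure of a locally convex space of its own, so the representation is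
  transported to \<open>p A\<^sup>n\<close> before it is differentiated.\<close>

lemma dE_bracket:
  assumes \<xi>: "\<xi> \<in> hat.tangent1" and \<eta>: "\<eta> \<in> hat.tangent1"
  shows "dE (hat.bracket \<xi> \<eta>) = commutator (dE \<xi>) (dE \<eta>)"
proof
  fix s
  define \<rho> where "\<rho> \<gamma> w = \<iota> (fst \<gamma> (inv_into UNIV \<iota> w))" for \<gamma> :: "('e \<Rightarrow> 'e) \<times> 'g" and w
  have lin: "C1_on W W W (\<rho> \<gamma>) (\<lambda>z. \<rho> \<gamma> (snd z))" if \<gamma>: "\<gamma> \<in> carrier Gh" for \<gamma>
  proof (rule C1_on_linear[OF subspace_W subspace_W])
    note E = End_K_D[OF Gh_D(2)[OF \<gamma>]]
    show "\<rho> \<gamma> w \<in> W" for w by (simp add: \<rho>_def)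
    show "\<rho> \<gamma> (w + w') = \<rho> \<gamma> w + \<rho> \<gamma> w'" if ww: "w \<in> W" "w' \<in> W" for w w'
    proof -
      obtain s t where "w = \<iota> s" "w' = \<iota> t" using ww by blast
      then show ?thesis by (simp add: \<rho>_def \<iota>_inv E(1) flip: \<iota>_add)
    qed
    show "\<rho> \<gamma> (r *\<^sub>R w) = r *\<^sub>R \<rho> \<gamma> w" if ww: "w \<in> W" for r w
    proof -
      obtain s where "w = \<iota> s" using ww by blast
      then show ?thesis by (simp add: \<rho>_def \<iota>_inv E(2) flip: \<iota>_scaleR)
    qed
    have "continuous_on W (\<lambda>w. fst \<gamma> (inv_into UNIV \<iota> w))"
      by (rule continuous_on_compose2[OF E(3) continuous_inv_\<iota>]) auto
    then show "continuous_on W (\<rho> \<gamma>)"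
      unfolding \<rho>_def by (rule continuous_on_compose2[OF continuous_\<iota>]) auto
  qed simp
  have near: "hat.C2_near W (\<lambda>\<gamma>. \<rho> \<gamma> w)" for w
    unfolding hat.C2_near_def \<rho>_def
    by (intro exI[of _ coord_dom] conjI one_coord_dom representation_C2) (use coord_domD(1) in blast)
  have D: "dir_deriv (\<lambda>y. \<rho> (hat.\<psi>0 y) (\<iota> t)) hat.x0 (\<zeta> hat.c0) = \<iota> (dE \<zeta> t)" if "\<zeta> hat.c0 \<in> hat.V" for \<zeta> t
    using has_dir_deriv_dir_deriv[OF representation_deriv[OF that, of t]] by (simp add: \<rho>_def \<iota>_inv dE_def)
  have "dir_deriv (\<lambda>y. \<rho> (hat.\<psi>0 y) (\<iota> s)) hat.x0 (hat.bracket \<xi> \<eta> hat.c0) =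
      dir_deriv (\<lambda>y. \<rho> (hat.\<psi>0 y) (dir_deriv (\<lambda>y. \<rho> (hat.\<psi>0 y) (\<iota> s)) hat.x0 (\<eta> hat.c0))) hat.x0 (\<xi> hat.c0) -
      dir_deriv (\<lambda>y. \<rho> (hat.\<psi>0 y) (dir_deriv (\<lambda>y. \<rho> (hat.\<psi>0 y) (\<iota> s)) hat.x0 (\<xi> hat.c0))) hat.x0 (\<eta> hat.c0)"
    by (rule hat.action_bracket[where W = W, OF _ lin near \<xi> \<eta>]) (simp_all add: \<rho>_def Gh_mult \<iota>_inv)
  then have "\<iota> (dE (hat.bracket \<xi> \<eta>) s) = \<iota> (dE \<xi> (dE \<eta> s)) - \<iota> (dE \<eta> (dE \<xi> s))"
    by (simp add: D hat.bracket_c0_in[OF \<xi> \<eta>] hat.tangentD(2)[OF \<xi>] hat.tangentD(2)[OF \<eta>])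
  then show "dE (hat.bracket \<xi> \<eta>) s = commutator (dE \<xi>) (dE \<eta>) s"
    by (simp add: commutator_def \<iota>_eq_iff flip: \<iota>_diff)
qed

subsection \<open>The isomorphism\<close>

definition lie_iso where "lie_iso \<xi> = (proj.dq \<xi>, (dE \<xi>, Lie_action G M \<mu> (proj.dq \<xi>)))"

lemma Lie_algebra_of_hat:
  "lcarrier (Lie_algebra_of Gh M_hat) = hat.tangent1"
  "ladd (Lie_algebra_of Gh M_hat) \<xi> \<eta> = (\<lambda>c. \<xi> c + \<eta> c)"
  "lscale (Lie_algebra_of Gh M_hat) r \<xi> = (\<lambda>c. r *\<^sub>R \<xi> c)"
  by (simp_all add: Lie_algebra_of_def)

text \<open>In coordinates a tangent vector is a pair \<open>(m, u)\<close>, and the map is \<open>(m, u) \<mapsto> (x, conn m D)\<close> with \<open>x\<close> the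
  tangent vector of coordinates \<open>u\<close> and \<open>D\<close> its derivation. For a
  given \<open>D\<close>, the possible second components are exactly the \<open>conn m D\<close>.\<close>

lemma bij_lie_iso: "bij_betw lie_iso (lcarrier (Lie_algebra_of Gh M_hat)) (lcarrier (pullback_DEnd_hat G M \<mu> sc act))"
  (is "bij_betw _ ?A ?B")
proof -
  have A: "?A = hat.tangent1"
    by (rule Lie_algebra_of_hat)
  have B: "?B = {(x, (\<phi>, D)). x \<in> G.tangent1 \<and> (\<phi>, D) \<in> DEnd_hat sc act \<and> Lie_action G M \<mu> x = D}"
    by (simp add: pullback_DEnd_hat_def Lie_algebra_of_def)
  show ?thesis
    unfolding A B
  proof (rule bij_betw_imageI)
    show "inj_on lie_iso (hat.tangent1)"
    proof (rule inj_onI)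
      fix \<xi> \<eta> assume \<xi>: "\<xi> \<in> hat.tangent1" and \<eta>: "\<eta> \<in> hat.tangent1"
        and eq: "lie_iso \<xi> = lie_iso \<eta>"
      note v\<xi> = hat.tangentD(2)[OF \<xi>] and v\<eta> = hat.tangentD(2)[OF \<eta>]
      have 1: "proj.dq \<xi> = proj.dq \<eta>" and 2: "dE \<xi> = dE \<eta>"
        using eq by (simp_all add: lie_iso_def)
      have snd: "snd (dcoord (\<xi> hat.c0)) = snd (dcoord (\<eta> hat.c0))"
        using 1 dq_c0[OF \<xi>] dq_c0[OF \<eta>] by simp
      have "fst (dcoord (\<xi> hat.c0)) = fst (dcoord (\<eta> hat.c0))"
        using dcoord_in[OF v\<xi>] dcoord_in[OF v\<eta>] 2[unfolded dE_def snd] by (blast intro: grassmann.conn_inject)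
      then have "dcoord (\<xi> hat.c0) = dcoord (\<eta> hat.c0)"
        using snd by (simp add: prod_eq_iff)
      then have "\<xi> hat.c0 = \<eta> hat.c0"
        using v\<xi> v\<eta> bij_betw_imp_inj_on[OF dcoord_bij] by (blast dest: inj_onD)
      then show "\<xi> = \<eta>"
        by (rule hat.tangent_eqI[OF \<xi> \<eta>])
    qed
    show "lie_iso ` hat.tangent1 =
      {(x, (\<phi>, D)). x \<in> G.tangent1 \<and> (\<phi>, D) \<in> DEnd_hat sc act \<and> Lie_action G M \<mu> x = D}"
    proof (intro equalityI subsetI)
      fix z assume "z \<in> lie_iso ` hat.tangent1"
      then obtain \<xi> where \<xi>: "\<xi> \<in> hat.tangent1" and z: "z = lie_iso \<xi>" by blast
      note v = dcoord_in[OF hat.tangentD(2)[OF \<xi>]]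
      have "(dE \<xi>, Lie_action G M \<mu> (proj.dq \<xi>)) \<in> DEnd_hat sc act"
        unfolding dE_def Lie_action_dq[OF \<xi>] using v by (intro grassmann.conn_DEnd_hat G.infinitesimal_der) auto
      then show "z \<in> {(x, (\<phi>, D)). x \<in> G.tangent1 \<and> (\<phi>, D) \<in> DEnd_hat sc act \<and> Lie_action G M \<mu> x = D}"
        using proj.dq_tangent[OF \<xi>] by (simp add: z lie_iso_def)
    next
      fix z assume "z \<in> {(x, (\<phi>, D)). x \<in> G.tangent1 \<and> (\<phi>, D) \<in> DEnd_hat sc act \<and> Lie_action G M \<mu> x = D}"
      then obtain x \<phi> D where z: "z = (x, (\<phi>, D))" and x: "x \<in> G.tangent1"
        and \<phi>: "(\<phi>, D) \<in> DEnd_hat sc act" and D: "Lie_action G M \<mu> x = D" by auto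
      obtain m where m: "m \<in> corner" "\<phi> = grassmann.conn m D"
        using grassmann.DEnd_hat_conn[OF \<phi>] by blast
      have "(m, x G.c0) \<in> dcoord ` hat.V"
        using m(1) G.tangentD(2)[OF x] bij_betw_imp_surj_on[OF dcoord_bij] by blast
      then obtain v where v: "v \<in> hat.V" "dcoord v = (m, x G.c0)" by force
      obtain \<xi> where \<xi>: "\<xi> \<in> hat.tangent1" "\<xi> hat.c0 = v"
        using hat.tangent_exists[OF v(1)] by blast
      have dq: "proj.dq \<xi> = x"
        by (rule G.tangent_eqI[OF proj.dq_tangent[OF \<xi>(1)] x]) (simp add: dq_c0[OF \<xi>(1)] \<xi>(2) v(2))
      have "G.infinitesimal (x G.c0) = D"
        unfolding D[symmetric] by (intro ext) (simp add: G.Lie_action_eq)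
      then have "lie_iso \<xi> = z"
        by (simp add: lie_iso_def dq dE_def \<xi>(2) v(2) z D m(2))
      with \<xi>(1) show "z \<in> lie_iso ` hat.tangent1" by blast
    qed
  qed
qed

lemmas pullback_ops = pullback_DEnd_hat_def prod_lie_algebra_def DEnd_hat_lie_algebra_def
  End_lie_algebra_def der_lie_algebra_def commutator_lie_algebra_def

lemma lie_iso_add:
  assumes \<xi>: "\<xi> \<in> hat.tangent1" and \<eta>: "\<eta> \<in> hat.tangent1"
  shows "lie_iso (\<lambda>c. \<xi> c + \<eta> c) = ladd (pullback_DEnd_hat G M \<mu> sc act) (lie_iso \<xi>) (lie_iso \<eta>)"
proof -
  note v\<xi> = hat.tangentD(2)[OF \<xi>] and v\<eta> = hat.tangentD(2)[OF \<eta>]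
  have L: "Lie_action G M \<mu> (\<lambda>c. proj.dq \<xi> c + proj.dq \<eta> c) = (\<lambda>a. Lie_action G M \<mu> (proj.dq \<xi>) a + Lie_action G M \<mu> (proj.dq \<eta>) a)"
    using G.infinitesimal_left(1)[OF G.tangentD(2)[OF proj.dq_tangent[OF \<xi>]] G.tangentD(2)[OF proj.dq_tangent[OF \<eta>]]]
    by (intro ext) (simp add: G.Lie_action_eq)
  have I: "G.infinitesimal (snd (dcoord (\<xi> hat.c0)) + snd (dcoord (\<eta> hat.c0))) =
      (\<lambda>a. G.infinitesimal (snd (dcoord (\<xi> hat.c0))) a + G.infinitesimal (snd (dcoord (\<eta> hat.c0))) a)"
    using dcoord_in[OF v\<xi>] dcoord_in[OF v\<eta>] by (intro ext G.infinitesimal_left(1)) auto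
  have E: "dE (\<lambda>c. \<xi> c + \<eta> c) = (\<lambda>s. dE \<xi> s + dE \<eta> s)"
    unfolding dE_def dcoord_linear(1)[OF v\<xi> v\<eta>] fst_add snd_add I
    using dcoord_in[OF v\<xi>] dcoord_in[OF v\<eta>] by (intro ext grassmann.conn_plus) auto
  show ?thesis
    by (simp add: lie_iso_def proj.dq_add[OF \<xi> \<eta>] L E pullback_ops Lie_algebra_of_def)
qed

lemma lie_iso_scale:
  assumes \<xi>: "\<xi> \<in> hat.tangent1"
  shows "lie_iso (\<lambda>c. r *\<^sub>R \<xi> c) = lscale (pullback_DEnd_hat G M \<mu> sc act) r (lie_iso \<xi>)"
proof -
  note v\<xi> = hat.tangentD(2)[OF \<xi>]
  have L: "Lie_action G M \<mu> (\<lambda>c. r *\<^sub>R proj.dq \<xi> c) = (\<lambda>a. sc (of_real r) (Lie_action G M \<mu> (proj.dq \<xi>) a))"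
    using G.infinitesimal_left(2)[OF G.tangentD(2)[OF proj.dq_tangent[OF \<xi>]] G.tangentD(2)[OF proj.dq_tangent[OF \<xi>]]]
    by (intro ext) (simp add: G.Lie_action_eq G.scale_of_real)
  have I: "G.infinitesimal (r *\<^sub>R snd (dcoord (\<xi> hat.c0))) = (\<lambda>a. r *\<^sub>R G.infinitesimal (snd (dcoord (\<xi> hat.c0))) a)"
    using dcoord_in[OF v\<xi>] by (intro ext G.infinitesimal_left(2)) auto
  have E: "dE (\<lambda>c. r *\<^sub>R \<xi> c) = (\<lambda>s. module_scale sc act (of_real r) (dE \<xi> s))"
    unfolding dE_def dcoord_linear(2)[OF v\<xi> v\<xi>] fst_scaleR snd_scaleR I module_scale_real
    using dcoord_in[OF v\<xi>] by (intro ext grassmann.conn_scale) auto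
  show ?thesis
    by (simp add: lie_iso_def proj.dq_scale[OF \<xi>] L E pullback_ops Lie_algebra_of_def)
qed

lemma lie_iso_bracket:
  assumes \<xi>: "\<xi> \<in> hat.tangent1" and \<eta>: "\<eta> \<in> hat.tangent1"
  shows "lie_iso (hat.bracket \<xi> \<eta>) = lbracket (pullback_DEnd_hat G M \<mu> sc act) (lie_iso \<xi>) (lie_iso \<eta>)"
  unfolding lie_iso_def proj.dq_bracket[OF \<xi> \<eta>] dE_bracket[OF \<xi> \<eta>]
    G.Lie_action_bracket[OF proj.dq_tangent[OF \<xi>] proj.dq_tangent[OF \<eta>]]
  by (simp add: pullback_ops)

theorem Lie_algebra_isomorphic_pullback:
  "lie_isomorphic (Lie_algebra_of Gh M_hat) (pullback_DEnd_hat G M \<mu> sc act)"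
  unfolding lie_isomorphic_def
proof (intro exI[of _ lie_iso] conjI ballI allI bij_lie_iso)
qed (simp_all add: Lie_algebra_of_hat lie_iso_add lie_iso_scale lie_iso_bracket)

end

section \<open>The Lie algebra of the extension\<close>

text \<open>The derivation in an element of the pull-back is determined by the component in the Lie algebra of the
  group, so dropping it loses nothing.\<close>

lemma pullback_DEnd_hat_isomorphic_pullback_DEnd:
  "lie_isomorphic (pullback_DEnd_hat G M \<mu> sc act) (pullback_DEnd G M \<mu> sc act)"
  unfolding lie_isomorphic_def
proof (intro exI[of _ "\<lambda>(x, (\<phi>, D)). (x, \<phi>)"] conjI)
  show "bij_betw (\<lambda>(x, (\<phi>, D)). (x, \<phi>)) (lcarrier (pullback_DEnd_hat G M \<mu> sc act)) (lcarrier (pullback_DEnd G M \<mu> sc act))"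
  proof (rule bij_betw_byWitness[where f' = "\<lambda>(x, \<phi>). (x, (\<phi>, Lie_action G M \<mu> x))"])
    show "(\<lambda>(x, (\<phi>, D)). (x, \<phi>)) ` lcarrier (pullback_DEnd_hat G M \<mu> sc act) \<subseteq> lcarrier (pullback_DEnd G M \<mu> sc act)"
      by (auto simp: pullback_DEnd_hat_def pullback_DEnd_def DEnd_hat_def DEnd_def)
  qed (auto simp: pullback_DEnd_hat_def pullback_DEnd_def)
qed (auto simp: pullback_DEnd_hat_def pullback_DEnd_def prod_lie_algebra_def DEnd_hat_lie_algebra_def)

theorem proposition4p7:
  fixes sc :: "'k::real_or_complex \<Rightarrow> 'a::{real_algebra_1,locally_convex_space} \<Rightarrow> 'a"
    and G :: "('g, 'm) monoid_scheme"
    and M :: "('g, 'v::locally_convex_space) manifold"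
    and \<mu> :: "'g \<Rightarrow> 'a \<Rightarrow> 'a"
    and act :: "'e::{ab_group_add,topological_space} \<Rightarrow> 'a \<Rightarrow> 'e"
    and p :: "'a ^ 'n ^ 'n"
    and \<iota> :: "'e \<Rightarrow> 'a ^ 'n"
    and M_hat :: "(('e \<Rightarrow> 'e) \<times> 'g, 'w::locally_convex_space) manifold"
  assumes "continuous_inverse_algebra sc"
    and "mackey_complete TYPE('a)"
    and "lie_group G M"
    and "smooth_action G M sc \<mu>"
    and "fg_projective act p \<iota>"
    and "\<mu> ` carrier G \<subseteq> Aut_E sc act"
    and "natural_lie_structure G M \<mu> sc act p \<iota> M_hat"
  shows "lie_isomorphic (Lie_algebra_of (G_hat G \<mu> sc act) M_hat)
      (pullback_DEnd_hat G M \<mu> sc act) \<and>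
    lie_isomorphic (pullback_DEnd_hat G M \<mu> sc act) (pullback_DEnd G M \<mu> sc act)"
proof
  interpret module_extension act p \<iota> G M sc \<mu> M_hat
    using assms by (intro module_extension.intro projective_module.intro smooth_algebra_action.intro
      lie_group_chart.intro smooth_algebra_action_axioms.intro module_extension_axioms.intro)
  show "lie_isomorphic (Lie_algebra_of (G_hat G \<mu> sc act) M_hat) (pullback_DEnd_hat G M \<mu> sc act)"
    by (rule Lie_algebra_isomorphic_pullback)
  show "lie_isomorphic (pullback_DEnd_hat G M \<mu> sc act) (pullback_DEnd G M \<mu> sc act)"
    by (rule pullback_DEnd_hat_isomorphic_pullback_DEnd)
qed

end
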